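(* For every $t\in\mathbb{N}$ and every class $\mathcal{G}$ of $K_{1,t}$-free graphs, $\mathcal{G}$ has bounded path independence number if and only if there is a forest $F$ such that no graph in $\mathcal{G}$ contains $F$ as an induced minor.
   Context: All graphs are finite and simple; $\mathbb{N}=\{1,2,\dots\}$. A graph is $K_{1,t}$-free if it has no induced subgraph isomorphic to the star $K_{1,t}$. A graph $H$ is an induced minor of $G$ if $H$ can be obtained from an induced subgraph of $G$ by contracting edges. A path-decomposition is a tree-decomposition whose indexing tree is a path. For $X\subseteq V(G)$, $\alpha(X):=\alpha(G[X])$ is the independence number of $G[X]$. The path independence number of $G$ is the minimum integer $k$ such that $G$ has a path-decomposition in which every bag $B$ satisfies $\alpha(B)\le k$. A class has bounded path independence number if there is a constant $k$ such that every graph in the class has path independence number at most $k$. *)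

theory Defs
  imports "Graph_Theory.Graph_Theory"
begin

text \<open>
  A finite simple graph is a \<^term>\<open>G :: 'a pair_pre_digraph\<close> with \<^term>\<open>pair_graph G\<close>: finitely
  many vertices and an irreflexive symmetric arc relation.  The empty graph is allowed.
\<close>

definition star_free :: "nat \<Rightarrow> 'a pair_pre_digraph \<Rightarrow> bool" where
  "star_free t G \<longleftrightarrow>
     \<not> (\<exists>H :: 'a pair_pre_digraph. induced_subgraph (with_proj H) (with_proj G) \<and>
       complete_bipartite_digraph 1 t (with_proj H))"

text \<open>The vertex obtained by contracting the edge \<open>uv\<close> keeps the name \<open>u\<close>.\<close>

definition contract_edge :: "'a pair_pre_digraph \<Rightarrow> 'a \<Rightarrow> 'a \<Rightarrow> 'a pair_pre_digraph" where
  "contract_edge G u v = (let r = (\<lambda>x. if x = v then u else x) in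
     \<lparr> pverts = r ` pverts G,
       parcs = {(r x, r y) | x y. (x, y) \<in> parcs G \<and> r x \<noteq> r y} \<rparr>)"

inductive contracts_to :: "'a pair_pre_digraph \<Rightarrow> 'a pair_pre_digraph \<Rightarrow> bool" where
  refl: "contracts_to G G"
| step: "contracts_to G H \<Longrightarrow> (u, v) \<in> parcs H \<Longrightarrow> contracts_to G (contract_edge H u v)"

definition induced_minor :: "'b pair_pre_digraph \<Rightarrow> 'a pair_pre_digraph \<Rightarrow> bool" where
  "induced_minor H G \<longleftrightarrow> (\<exists>(G' :: 'a pair_pre_digraph) (G'' :: 'a pair_pre_digraph).
     induced_subgraph (with_proj G') (with_proj G) \<and> contracts_to G' G'' \<and>
     digraph_iso (with_proj G'') (with_proj H))"

text \<open>
  The constant \<^const>\<open>forest\<close> forbids all directed cycles, including the closed walk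
  \<open>u, v, u\<close> along an edge and its reverse, so no symmetric digraph with an edge satisfies it.
  In a simple graph the undirected cycles are the directed cycles of length at least three.
\<close>

definition forest_graph :: "'a pair_pre_digraph \<Rightarrow> bool" where
  "forest_graph F \<longleftrightarrow> pair_graph F \<and> \<not> (\<exists>p. pre_digraph.cycle (with_proj F) p \<and> length p \<ge> 3)"

definition tree_graph :: "'a pair_pre_digraph \<Rightarrow> bool" where
  "tree_graph T \<longleftrightarrow> forest_graph T \<and> connected (with_proj T)"

definition path_graph :: "'a pair_pre_digraph \<Rightarrow> bool" where
  "path_graph T \<longleftrightarrow> (\<exists>xs. xs \<noteq> [] \<and> distinct xs \<and> pverts T = set xs \<and>
     parcs T = set (zip xs (tl xs)) \<union> (set (zip xs (tl xs)))\<inverse>)"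

text \<open>
  \<^const>\<open>connected\<close> includes nonemptiness, so the last conjunct below also says that every
  vertex lies in some bag.
\<close>

definition tree_decomposition ::
    "'a pair_pre_digraph \<Rightarrow> 'b pair_pre_digraph \<Rightarrow> ('b \<Rightarrow> 'a set) \<Rightarrow> bool" where
  "tree_decomposition G T B \<longleftrightarrow> tree_graph T \<and>
     (\<forall>x\<in>pverts T. B x \<subseteq> pverts G) \<and>
     (\<forall>(u, v)\<in>parcs G. \<exists>x\<in>pverts T. u \<in> B x \<and> v \<in> B x) \<and>
     (\<forall>v\<in>pverts G. connected (with_proj T \<restriction> {x \<in> pverts T. v \<in> B x}))"

definition path_decomposition ::
    "'a pair_pre_digraph \<Rightarrow> 'b pair_pre_digraph \<Rightarrow> ('b \<Rightarrow> 'a set) \<Rightarrow> bool" where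
  "path_decomposition G T B \<longleftrightarrow> tree_decomposition G T B \<and> path_graph T"

definition independent_set :: "('a, 'b) pre_digraph \<Rightarrow> 'a set \<Rightarrow> bool" where
  "independent_set G I \<longleftrightarrow> I \<subseteq> verts G \<and> (\<forall>u\<in>I. \<forall>v\<in>I. \<not> u \<rightarrow>\<^bsub>G\<^esub> v)"

definition independence_number :: "('a, 'b) pre_digraph \<Rightarrow> nat" where
  "independence_number G = Max (card ` {I. independent_set G I})"

definition path_independence_number :: "'a pair_pre_digraph \<Rightarrow> nat" where
  "path_independence_number G = (LEAST k. \<exists>(T :: nat pair_pre_digraph) B.
     path_decomposition G T B \<and> (\<forall>x\<in>pverts T. independence_number (with_proj G \<restriction> B x) \<le> k))"

definition bounded_path_independence_number :: "'a pair_pre_digraph set \<Rightarrow> bool" where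
  "bounded_path_independence_number \<G> \<longleftrightarrow> (\<exists>k. \<forall>G\<in>\<G>. path_independence_number G \<le> k)"

end

theory Submission
  imports Defs
begin

text \<open>
  A model of a forest assigns to its vertices disjoint connected hubs, adjacent exactly along the edges.
  Trees of ternary height \<open>k\<close> with subdivided edges force an independent set of size \<open>k + 1\<close> in some bag of
  every path-decomposition, so bounded path independence number excludes one of them.

  For the converse it suffices to find a rooted tree \<open>F\<close>, since every forest is an induced subgraph of a
  tree. Let \<open>F\<close> arise from \<open>F1\<close> and \<open>F2\<close> by joining their roots, and argue by induction that a connected
  \<open>K\<^bsub>1,t\<^esub>\<close>-free graph without a good path-decomposition contains \<open>F\<close> with any prescribed vertex in
  the root hub. Call a connected set rich if it has no good path-decomposition, and grow a root hub \<open>Z\<close>. Two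
  anticomplete rich sets touching the neighbourhood of \<open>Z\<close> supply models of \<open>F1\<close> and \<open>F2\<close>. Otherwise the
  rich sets pairwise touch, hence form a bramble, whose order is measured by the independence number of a
  hitting set. If the order is large, the bramble itself contains a model of \<open>F\<close> attached to \<open>Z\<close>: a hub
  grown inside a member cuts off large sub-brambles attached to that hub, and as a vertex meets at most \<open>t\<close>
  pairwise anticomplete sets, \<open>t + 1\<close> models of \<open>F1\<close> leave one unaffected. If the order is small, delete a
  minimal hitting set \<open>Y\<close>: at most one component remains rich, its neighbourhood lies in \<open>Y\<close>, and iterating
  produces a path-decomposition.
\<close>

section \<open>Independence and connectedness relative to an edge relation\<close>

text \<open>The obstacle is that the models must be induced: a chosen hub makes its whole
  neighbourhood unusable, and for a large hub this loss has no bound. In a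
  \<open>K_{1,t}\<close>-free graph a single vertex spoils only a set of independence number at most
  \<open>t\<close>. Losses are therefore charged to few single vertices: the last vertex of a hub
  grown vertex by vertex, and the landing vertices through which other models reach a hub. This is
  why hitting sets are measured by independence number and why all thresholds depend only on
  \<open>t\<close> and the tree. Prescribing a vertex of the root hub drives the induction on the
  tree: if the prescribed vertex is the only one that a landing vertex sees, the landing vertex
  attaches to the root hub and to nothing else. Repeated deletion of hitting sets does not increase
  the width, because the boundary of the remaining rich component lies in the latest hitting set. A
  bag pays for at most two consecutive boundaries (\<open>2 * s\<close>) and one piece that is not
  rich (\<open>k\<close>).\<close>

definition indep :: "('a \<times> 'a) set \<Rightarrow> 'a set \<Rightarrow> bool" where
  "indep E I \<longleftrightarrow> (\<forall>x\<in>I. \<forall>y\<in>I. (x, y) \<notin> E)"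

text \<open>Stated as a bound on finite independent subsets, so that it applies to neighbourhoods
  and hitting sets without a finiteness assumption on them.\<close>

definition alpha_le :: "('a \<times> 'a) set \<Rightarrow> 'a set \<Rightarrow> nat \<Rightarrow> bool" where
  "alpha_le E S k \<longleftrightarrow> (\<forall>I\<subseteq>S. finite I \<longrightarrow> indep E I \<longrightarrow> card I \<le> k)"

text \<open>Connectedness in terms of cuts; this form makes unions and images easy.\<close>

definition conn_in :: "('a \<times> 'a) set \<Rightarrow> 'a set \<Rightarrow> bool" where
  "conn_in E S \<longleftrightarrow> S \<noteq> {} \<and>
     (\<forall>A. A \<subseteq> S \<longrightarrow> A \<noteq> {} \<longrightarrow> A \<noteq> S \<longrightarrow> (\<exists>x\<in>A. \<exists>y\<in>S - A. (x, y) \<in> E))"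

definition comp_of :: "('a \<times> 'a) set \<Rightarrow> 'a set \<Rightarrow> 'a \<Rightarrow> 'a set" where
  "comp_of E X x = \<Union>{S. S \<subseteq> X \<and> conn_in E S \<and> x \<in> S}"

definition minor_model :: "('a \<times> 'a) set \<Rightarrow> 'b set \<Rightarrow> ('b \<times> 'b) set \<Rightarrow> ('b \<Rightarrow> 'a set) \<Rightarrow> bool" where
  "minor_model E V F H \<longleftrightarrow> (\<forall>v\<in>V. conn_in E (H v)) \<and>
     (\<forall>u\<in>V. \<forall>v\<in>V. u \<noteq> v \<longrightarrow>
        H u \<inter> H v = {} \<and> ((u, v) \<in> F \<longleftrightarrow> (\<exists>x\<in>H u. \<exists>y\<in>H v. (x, y) \<in> E)))"

lemma indep_subset: "indep E I \<Longrightarrow> J \<subseteq> I \<Longrightarrow> indep E J"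
  by (auto simp: indep_def)

lemma alpha_leD: "alpha_le E S k \<Longrightarrow> I \<subseteq> S \<Longrightarrow> finite I \<Longrightarrow> indep E I \<Longrightarrow> card I \<le> k"
  by (auto simp: alpha_le_def)

lemma alpha_le_mono: "alpha_le E S k \<Longrightarrow> T \<subseteq> S \<Longrightarrow> k \<le> l \<Longrightarrow> alpha_le E T l"
  unfolding alpha_le_def by (meson order_trans)

lemma alpha_le_empty [simp]: "alpha_le E {} k"
  by (simp add: alpha_le_def)

lemma alpha_le_Un:
  assumes "alpha_le E S a" "alpha_le E T b"
  shows "alpha_le E (S \<union> T) (a + b)"
  unfolding alpha_le_def
proof (intro allI impI)
  fix I assume I: "I \<subseteq> S \<union> T" "finite I" "indep E I"
  have "card (I \<inter> S) \<le> a" "card (I - S) \<le> b"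
    using I indep_subset[OF I(3), of "I \<inter> S"] indep_subset[OF I(3), of "I - S"]
    by (auto intro!: alpha_leD[OF assms(1)] alpha_leD[OF assms(2)])
  moreover have "card I = card (I \<inter> S) + card (I - S)"
    using I(2) by (metis card_Int_Diff)
  ultimately show "card I \<le> a + b" by simp
qed

lemma alpha_le_singleton: "alpha_le E {x} 1"
  unfolding alpha_le_def by (auto dest: card_mono[rotated])

lemma conn_in_nonempty: "conn_in E S \<Longrightarrow> S \<noteq> {}"
  by (simp add: conn_in_def)

lemma conn_in_empty [simp]: "\<not> conn_in E {}"
  by (simp add: conn_in_def)

lemma conn_in_singleton [simp]: "conn_in E {x}"
  by (auto simp: conn_in_def)

lemma conn_in_cut:
  assumes "conn_in E S" "A \<subseteq> S" "A \<noteq> {}" "A \<noteq> S"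
  obtains x y where "x \<in> A" "y \<in> S - A" "(x, y) \<in> E"
  using assms unfolding conn_in_def by blast

lemma conn_in_cut':
  assumes "conn_in E S" "a \<in> S" "a \<in> A" "b \<in> S" "b \<notin> A"
  obtains x y where "x \<in> S" "x \<in> A" "y \<in> S" "y \<notin> A" "(x, y) \<in> E"
proof -
  have "S \<inter> A \<subseteq> S" "S \<inter> A \<noteq> {}" "S \<inter> A \<noteq> S" using assms by auto
  from conn_in_cut[OF assms(1) this] show ?thesis using that by blast
qed

lemma conn_inI:
  assumes "S \<noteq> {}"
    and "\<And>A a b. a \<in> S \<Longrightarrow> a \<in> A \<Longrightarrow> b \<in> S \<Longrightarrow> b \<notin> A \<Longrightarrow> \<exists>x\<in>S. \<exists>y\<in>S. x \<in> A \<and> y \<notin> A \<and> (x, y) \<in> E"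
  shows "conn_in E S"
  unfolding conn_in_def
proof (intro conjI allI impI)
  fix A assume A: "A \<subseteq> S" "A \<noteq> {}" "A \<noteq> S"
  then obtain a b where "a \<in> S" "a \<in> A" "b \<in> S" "b \<notin> A" by blast
  from assms(2)[OF this] show "\<exists>x\<in>A. \<exists>y\<in>S - A. (x, y) \<in> E" by blast
qed (rule assms(1))

lemma conn_in_Union:
  assumes "\<And>S. S \<in> \<S> \<Longrightarrow> conn_in E S \<and> x \<in> S" "\<S> \<noteq> {}"
  shows "conn_in E (\<Union>\<S>)"
proof (rule conn_inI)
  show "\<Union>\<S> \<noteq> {}" using assms by blast
next
  fix A a b assume a: "a \<in> \<Union>\<S>" "a \<in> A" and b: "b \<in> \<Union>\<S>" "b \<notin> A"
  obtain S T where ST: "S \<in> \<S>" "a \<in> S" "T \<in> \<S>" "b \<in> T" using a b by blast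
  show "\<exists>y\<in>\<Union>\<S>. \<exists>z\<in>\<Union>\<S>. y \<in> A \<and> z \<notin> A \<and> (y, z) \<in> E"
  proof (cases "x \<in> A")
    case True
    have "conn_in E T" "x \<in> T" using assms(1)[OF ST(3)] by auto
    from conn_in_cut'[OF this True ST(4) b(2)] ST show ?thesis by (metis UnionI)
  next
    case False
    have "conn_in E S" "x \<in> S" using assms(1)[OF ST(1)] by auto
    from conn_in_cut'[OF this(1) ST(2) a(2) this(2) False] ST show ?thesis by (metis UnionI)
  qed
qed

lemma conn_in_Un: "conn_in E S \<Longrightarrow> conn_in E T \<Longrightarrow> x \<in> S \<Longrightarrow> x \<in> T \<Longrightarrow> conn_in E (S \<union> T)"
  using conn_in_Union[of "{S, T}" E x] by auto

text \<open>Carries the touching of two bramble members over to connected supersets, so that refined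
  brambles need no new proof of pairwise touching.\<close>

lemma conn_in_Un_mono:
  assumes "conn_in E (A \<union> B)" "conn_in E A'" "conn_in E B'"
    and "A \<subseteq> A'" "B \<subseteq> B'" "A \<noteq> {}" "B \<noteq> {}"
  shows "conn_in E (A' \<union> B')"
proof -
  obtain a b where ab: "a \<in> A" "b \<in> B" using assms by blast
  then have "conn_in E (A' \<union> (A \<union> B))"
    using assms by (intro conn_in_Un[of E A' _ a]) auto
  then have "conn_in E (A' \<union> (A \<union> B) \<union> B')"
    using assms ab by (intro conn_in_Un[of E _ B' b]) auto
  moreover have "A' \<union> (A \<union> B) \<union> B' = A' \<union> B'" using assms by auto
  ultimately show ?thesis by simp
qed

lemma comp_of_subset: "comp_of E X x \<subseteq> X"
  by (auto simp: comp_of_def)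

lemma comp_of_self: "x \<in> X \<Longrightarrow> x \<in> comp_of E X x"
  unfolding comp_of_def by (rule UnionI[of "{x}"]) auto

lemma conn_in_comp_of: "x \<in> X \<Longrightarrow> conn_in E (comp_of E X x)"
  unfolding comp_of_def by (rule conn_in_Union[of _ _ x]) (auto intro: exI[of _ "{x}"])

lemma comp_of_maximal:
  assumes "x \<in> X" "conn_in E S" "S \<subseteq> X" "y \<in> S" "y \<in> comp_of E X x"
  shows "S \<subseteq> comp_of E X x"
proof -
  have "conn_in E (S \<union> comp_of E X x)" using assms conn_in_comp_of[of x X E] by (intro conn_in_Un) auto
  then have "S \<union> comp_of E X x \<subseteq> comp_of E X x"
    using assms comp_of_subset[of E X x] comp_of_self[of x X E]
    by (subst (2) comp_of_def) (intro Union_upper, auto)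
  then show ?thesis by simp
qed

lemma comp_of_eq:
  assumes "x \<in> X" "y \<in> comp_of E X x"
  shows "comp_of E X y = comp_of E X x"
proof
  have "y \<in> X" using assms comp_of_subset[of E X x] by auto
  then show "comp_of E X y \<subseteq> comp_of E X x"
    using assms conn_in_comp_of[of y X E] comp_of_subset[of E X y] comp_of_self[of y X E]
    by (intro comp_of_maximal[of x X E _ y]) auto
  show "comp_of E X x \<subseteq> comp_of E X y"
    using assms conn_in_comp_of[of x X E] comp_of_subset[of E X x] comp_of_self[of y X E] \<open>y \<in> X\<close>
    by (intro comp_of_maximal[of y X E _ y]) auto
qed

lemma conn_in_image:
  assumes "conn_in E S"
    and "\<And>x y. x \<in> S \<Longrightarrow> y \<in> S \<Longrightarrow> (x, y) \<in> E \<Longrightarrow> f x \<noteq> f y \<Longrightarrow> (f x, f y) \<in> E'"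
  shows "conn_in E' (f ` S)"
proof (rule conn_inI)
  show "f ` S \<noteq> {}" using conn_in_nonempty[OF assms(1)] by simp
next
  fix A a b assume "a \<in> f ` S" "a \<in> A" "b \<in> f ` S" "b \<notin> A"
  then obtain a' b' where "a' \<in> S" "a' \<in> f -` A" "b' \<in> S" "b' \<notin> f -` A" by auto
  from conn_in_cut'[OF assms(1) this] obtain x y
    where "x \<in> S" "x \<in> f -` A" "y \<in> S" "y \<notin> f -` A" "(x, y) \<in> E" .
  moreover from this have "(f x, f y) \<in> E'" by (intro assms(2)) auto
  ultimately show "\<exists>x\<in>f ` S. \<exists>y\<in>f ` S. x \<in> A \<and> y \<notin> A \<and> (x, y) \<in> E'"
    by (intro bexI[of _ "f x"] bexI[of _ "f y"]) auto
qed

lemma conn_in_mono_edges: "conn_in E S \<Longrightarrow> E \<subseteq> E' \<Longrightarrow> conn_in E' S"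
  using conn_in_image[of E S id E'] by auto

lemma conn_in_Restr: "conn_in (Restr E S) S \<longleftrightarrow> conn_in E S"
proof
  show "conn_in (Restr E S) S \<Longrightarrow> conn_in E S" by (erule conn_in_mono_edges) auto
  show "conn_in E S \<Longrightarrow> conn_in (Restr E S) S" using conn_in_image[of E S id "Restr E S"] by simp
qed

locale ugraph =
  fixes E :: "('a \<times> 'a) set"
  assumes symE: "sym E" and irreflE: "irrefl E"
begin

lemma E_sym: "(x, y) \<in> E \<Longrightarrow> (y, x) \<in> E"
  using symE by (auto dest: symD)

lemma E_irrefl: "(x, x) \<notin> E"
  using irreflE by (auto simp: irrefl_def)

lemma conn_in_edge: "(x, y) \<in> E \<Longrightarrow> conn_in E {x, y}"
  by (rule conn_inI) (auto dest: E_sym)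

lemma conn_in_touch:
  assumes "conn_in E S" "conn_in E T" "(x, y) \<in> E" "x \<in> S" "y \<in> T"
  shows "conn_in E (S \<union> T)"
proof -
  have "conn_in E (S \<union> {x, y})"
    using assms conn_in_edge[of x y] by (intro conn_in_Un[of E S _ x]) auto
  then have "conn_in E (S \<union> {x, y} \<union> T)"
    using assms by (intro conn_in_Un[of E _ T y]) auto
  moreover have "S \<union> {x, y} \<union> T = S \<union> T" using assms by auto
  ultimately show ?thesis by simp
qed

lemma conn_in_insert:
  assumes "conn_in E S" "(x, y) \<in> E" "x \<in> S"
  shows "conn_in E (insert y S)"
  using conn_in_touch[OF assms(1) conn_in_singleton assms(2,3), of y] by simp

lemma comp_of_closed:
  assumes "x \<in> X" "y \<in> comp_of E X x" "(y, z) \<in> E" "z \<in> X"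
  shows "z \<in> comp_of E X x"
  using assms comp_of_maximal[of x X E "{y, z}" y] comp_of_subset[of E X x] conn_in_edge[of y z] by auto

text \<open>Some edge of \<open>S\<close> leaves the component, and its far end is outside
  \<open>X\<close> because the component is closed under neighbours in \<open>X\<close>. This
  supplies the contact vertex between a component and the separator that cut it off.\<close>

lemma comp_of_exit:
  assumes "x \<in> X" "conn_in E S" "comp_of E X x \<subseteq> S" "\<not> S \<subseteq> X"
  obtains y z where "y \<in> comp_of E X x" "z \<in> S" "z \<notin> X" "(y, z) \<in> E"
proof -
  obtain b where b: "b \<in> S" "b \<notin> X" using assms by auto
  then have "b \<notin> comp_of E X x" using comp_of_subset[of E X x] by auto
  moreover have "x \<in> comp_of E X x" by (rule comp_of_self[OF assms(1)])
  ultimately obtain y z where "y \<in> comp_of E X x" "z \<in> S" "z \<notin> comp_of E X x" "(y, z) \<in> E"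
    using conn_in_cut'[of E S x "comp_of E X x" b] assms(2,3) b by (metis subsetD)
  with comp_of_closed[of x X y z] assms(1) that show ?thesis by blast
qed

end

section \<open>Brambles of large order contain every rooted tree\<close>

abbreviation link :: "('b \<times> 'b) set \<Rightarrow> 'b \<Rightarrow> ('b \<times> 'b) set \<Rightarrow> 'b \<Rightarrow> ('b \<times> 'b) set" where
  "link F1 r1 F2 r2 \<equiv> F1 \<union> F2 \<union> {(r1, r2), (r2, r1)}"

text \<open>The first tree is hung as a whole below \<open>r2\<close>, which stays the root. With
  exactly two subtrees per step, an induction step needs only two anticomplete sources of
  models.\<close>

inductive rooted_tree :: "'b set \<Rightarrow> ('b \<times> 'b) set \<Rightarrow> 'b \<Rightarrow> bool" where
  single: "rooted_tree {r} {} r"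
| join: "rooted_tree V1 F1 r1 \<Longrightarrow> rooted_tree V2 F2 r2 \<Longrightarrow> V1 \<inter> V2 = {} \<Longrightarrow>
    rooted_tree (V1 \<union> V2) (link F1 r1 F2 r2) r2"

lemma rooted_tree_root: "rooted_tree V F r \<Longrightarrow> r \<in> V"
  by (induction rule: rooted_tree.induct) auto

lemma rooted_tree_finite: "rooted_tree V F r \<Longrightarrow> finite V"
  by (induction rule: rooted_tree.induct) auto

lemma rooted_tree_edges: "rooted_tree V F r \<Longrightarrow> F \<subseteq> V \<times> V"
  by (induction rule: rooted_tree.induct) (auto dest: rooted_tree_root)

lemma rooted_tree_sym: "rooted_tree V F r \<Longrightarrow> sym F"
  by (induction rule: rooted_tree.induct) (auto simp: sym_def)

text \<open>For a bramble: its order, in terms of the independence number of hitting sets, exceeds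
  \<open>s\<close>.\<close>

definition unhit :: "('a \<times> 'a) set \<Rightarrow> 'a set set \<Rightarrow> nat \<Rightarrow> bool" where
  "unhit E \<D> s \<longleftrightarrow> (\<forall>Y. alpha_le E Y s \<longrightarrow> (\<exists>D\<in>\<D>. D \<inter> Y = {}))"

text \<open>Since the members are connected, \<open>conn_in E (D \<union> D')\<close> says that they touch.\<close>

definition linked_bramble :: "('a \<times> 'a) set \<Rightarrow> 'a set \<Rightarrow> 'a set \<Rightarrow> 'a set set \<Rightarrow> bool" where
  "linked_bramble E C L \<D> \<longleftrightarrow> finite C \<and> L \<inter> C = {} \<and>
     (\<forall>D\<in>\<D>. D \<subseteq> C \<and> conn_in E D \<and> E `` D \<inter> L \<noteq> {}) \<and>
     (\<forall>D\<in>\<D>. \<forall>D'\<in>\<D>. conn_in E (D \<union> D'))"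

text \<open>A model that can be attached from outside: \<open>l\<close> sees the root hub and no
  other hub, so a hub containing \<open>l\<close> becomes adjacent to the root alone.\<close>

definition prong ::
    "('a \<times> 'a) set \<Rightarrow> 'b set \<Rightarrow> ('b \<times> 'b) set \<Rightarrow> 'b \<Rightarrow> 'a set \<Rightarrow> 'a \<Rightarrow> ('b \<Rightarrow> 'a set) \<Rightarrow> bool" where
  "prong E V F r C l H \<longleftrightarrow> minor_model E V F H \<and>
     (\<forall>v\<in>V. H v \<subseteq> C \<and> (l \<in> E `` H v \<longleftrightarrow> v = r))"

text \<open>What has to be given up so that later hubs are anticomplete to the model and are not
  seen by \<open>l\<close>.\<close>

definition prong_zone :: "('a \<times> 'a) set \<Rightarrow> 'b set \<Rightarrow> 'a \<Rightarrow> ('b \<Rightarrow> 'a set) \<Rightarrow> 'a set" where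
  "prong_zone E V l H = E `` {l} \<union> \<Union>(H ` V) \<union> E `` \<Union>(H ` V)"

text \<open>The function \<open>f\<close> records the order needed to leave a bramble of order \<open>> s\<close>; it must not depend on
  the graph.\<close>

definition grabs ::
    "('a \<times> 'a) set \<Rightarrow> 'b set \<Rightarrow> ('b \<times> 'b) set \<Rightarrow> 'b \<Rightarrow> (nat \<Rightarrow> nat) \<Rightarrow> bool" where
  "grabs E V F r f \<longleftrightarrow> (\<forall>s C L \<D>. linked_bramble E C L \<D> \<longrightarrow> unhit E \<D> (f s) \<longrightarrow>
     (\<exists>l\<in>L. \<exists>H \<D>'. prong E V F r C l H \<and>
        linked_bramble E (C - prong_zone E V l H) L \<D>' \<and>
        unhit E \<D>' s \<and> (\<forall>D'\<in>\<D>'. \<exists>D\<in>\<D>. D \<subseteq> D')))"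

lemma unhitD: "unhit E \<D> s \<Longrightarrow> alpha_le E Y s \<Longrightarrow> \<exists>D\<in>\<D>. D \<inter> Y = {}"
  by (auto simp: unhit_def)

lemma not_unhitE:
  assumes "\<not> unhit E \<D> s"
  obtains Y where "alpha_le E Y s" "\<And>D. D \<in> \<D> \<Longrightarrow> D \<inter> Y \<noteq> {}"
  using assms unfolding unhit_def by auto

lemma linked_brambleD:
  assumes "linked_bramble E C L \<D>"
  shows "finite C" "L \<inter> C = {}" "\<And>D. D \<in> \<D> \<Longrightarrow> D \<subseteq> C" "\<And>D. D \<in> \<D> \<Longrightarrow> conn_in E D"
    "\<And>D. D \<in> \<D> \<Longrightarrow> E `` D \<inter> L \<noteq> {}" "\<And>D D'. D \<in> \<D> \<Longrightarrow> D' \<in> \<D> \<Longrightarrow> conn_in E (D \<union> D')"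
  using assms unfolding linked_bramble_def by auto

text \<open>Touching is inherited since each new member contains an old one. The landing set may
  change, as contact with it is required anew.\<close>

lemma linked_bramble_refine:
  assumes lb: "linked_bramble E C L \<D>"
    and "finite C'" "L' \<inter> C' = {}"
    and ref: "\<And>A. A \<in> \<A> \<Longrightarrow> A \<subseteq> C' \<and> conn_in E A \<and> E `` A \<inter> L' \<noteq> {} \<and> (\<exists>D\<in>\<D>. D \<subseteq> A)"
  shows "linked_bramble E C' L' \<A>"
  unfolding linked_bramble_def
proof (intro conjI ballI)
  fix A B assume "A \<in> \<A>" "B \<in> \<A>"
  then obtain D D' where "D \<in> \<D>" "D \<subseteq> A" "D' \<in> \<D>" "D' \<subseteq> B" "conn_in E A" "conn_in E B"
    using ref by meson
  moreover from this have "conn_in E D" "conn_in E D'" "conn_in E (D \<union> D')"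
    using linked_brambleD[OF lb] by blast+
  ultimately show "conn_in E (A \<union> B)"
    by (intro conn_in_Un_mono[of E D D' A B]) (auto dest: conn_in_nonempty)
qed (use assms in auto)

text \<open>New members contain old ones and so still see the original landing set \<open>L\<close>,
  even if the new bramble was built for another landing set.\<close>

lemma linked_bramble_refine_same:
  assumes lb: "linked_bramble E C L \<D>" and lb': "linked_bramble E C' L' \<A>"
    and "C' \<subseteq> C" and ref: "\<And>A. A \<in> \<A> \<Longrightarrow> \<exists>D\<in>\<D>. D \<subseteq> A"
  shows "linked_bramble E C' L \<A>"
proof (rule linked_bramble_refine[OF lb])
  show "finite C'" "L \<inter> C' = {}" using linked_brambleD[OF lb] linked_brambleD[OF lb'] assms(3) by auto
  fix A assume A: "A \<in> \<A>"
  then obtain D where D: "D \<in> \<D>" "D \<subseteq> A" using ref by blast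
  then have "E `` D \<inter> L \<noteq> {}" using linked_brambleD[OF lb] by blast
  then show "A \<subseteq> C' \<and> conn_in E A \<and> E `` A \<inter> L \<noteq> {} \<and> (\<exists>D\<in>\<D>. D \<subseteq> A)"
    using D linked_brambleD[OF lb'] A by blast
qed

section \<open>Brambles in graphs whose neighbourhoods have bounded independence number\<close>

locale star_bounded = ugraph +
  fixes t :: nat
  assumes alpha_nbhd: "alpha_le E (E `` {x}) t"
begin

lemma alpha_closed_nbhd: "alpha_le E (insert x (E `` {x})) (Suc t)"
  using alpha_le_Un[OF alpha_le_singleton[of E x] alpha_nbhd[of x]] by simp

text \<open>\<open>R'\<close> is a largest connected set containing \<open>x\<close> that fails
  \<open>Q\<close>, so one boundary vertex \<open>q\<close> more achieves \<open>Q\<close>. Thus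
  \<open>R\<close> differs from a failing set in a single vertex, to which the loss can be charged;
  \<open>R'\<close> is empty if \<open>Q {x}\<close> holds already.\<close>

lemma grow_connected:
  assumes "finite D" "conn_in E D" "x \<in> D" "Q D"
  obtains R R' q where "R \<subseteq> D" "conn_in E R" "x \<in> R" "Q R" "R = insert q R'" "R' = {} \<or> \<not> Q R'"
proof (cases "Q {x}")
  case True
  then show ?thesis using that[of "{x}" x "{}"] assms by auto
next
  case False
  let ?P = "\<lambda>R. R \<subseteq> D \<and> conn_in E R \<and> x \<in> R \<and> \<not> Q R"
  have "?P {x}" using False assms by auto
  moreover have "\<forall>R. ?P R \<longrightarrow> card R < Suc (card D)"
    using assms(1) by (auto simp: less_Suc_eq_le card_mono)
  ultimately obtain R' where R': "?P R'" and max: "\<And>R. ?P R \<Longrightarrow> card R \<le> card R'"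
    using ex_has_greatest_nat[of ?P "{x}" card "Suc (card D)"] by (metis less_imp_le)
  have "R' \<noteq> D" using R' assms by auto
  then obtain y q where q: "y \<in> R'" "q \<in> D - R'" "(y, q) \<in> E"
    using conn_in_cut[OF assms(2), of R'] R' by blast
  have "conn_in E (insert q R')" using conn_in_insert[of R' y q] R' q by auto
  moreover have "card (insert q R') > card R'"
    using q R' finite_subset[OF _ assms(1), of R'] by simp
  ultimately have "Q (insert q R')" using max[of "insert q R'"] R' q by fastforce
  then show ?thesis using that[of "insert q R'" q R'] R' q \<open>conn_in E (insert q R')\<close> by auto
qed

text \<open>The hub \<open>R\<close> is grown inside one member of the bramble just until the members meeting its closed
  neighbourhood have order \<open>> s\<close>. These members tie the rest of the bramble to \<open>E `` R\<close>.\<close>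

lemma bramble_new_hub:
  assumes lb: "linked_bramble E C L \<D>" and big: "unhit E \<D> (2 * s + 2 * t + 1)"
  shows "\<exists>l R \<A>. l \<in> L \<and> R \<subseteq> C \<and> conn_in E R \<and> l \<in> E `` R \<and>
    linked_bramble E (C - (E `` {l} \<union> R \<union> E `` R)) (E `` R \<inter> C) \<A> \<and> unhit E \<A> s \<and>
    (\<forall>A\<in>\<A>. \<exists>D\<in>\<D>. D \<subseteq> A)"
proof -
  note lbD = linked_brambleD[OF lb]
  obtain D0 where D0: "D0 \<in> \<D>" using unhitD[OF big, of "{}"] by auto
  then obtain l x where l: "l \<in> L" and x: "x \<in> D0" "(x, l) \<in> E" using lbD(5) by blast
  define \<D>l where "\<D>l = {D \<in> \<D>. D \<inter> E `` {l} = {}}"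
  \<comment> \<open>Dropping the members that meet the neighbourhood of \<open>l\<close> uses up
    \<open>t\<close> of the threshold.\<close>
  have bigl: "\<exists>D\<in>\<D>l. D \<inter> Y = {}" if "alpha_le E Y (2 * s + t + 1)" for Y
  proof -
    have "alpha_le E (Y \<union> E `` {l}) (2 * s + t + 1 + t)"
      by (rule alpha_le_Un[OF that alpha_nbhd])
    then have "alpha_le E (Y \<union> E `` {l}) (2 * s + 2 * t + 1)" by (rule alpha_le_mono) auto
    from unhitD[OF big this] show ?thesis unfolding \<D>l_def by blast
  qed
  define Q where "Q R = unhit E {D \<in> \<D>l. D \<inter> (R \<union> E `` R) \<noteq> {}} s" for R
  \<comment> \<open>Every member touches \<open>D0\<close> and hence meets its closed neighbourhood,
    so \<open>Q D0\<close> only asks for the order of \<open>\<D>l\<close>.\<close>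
  have "Q D0" unfolding Q_def unhit_def
  proof (intro allI impI)
    fix Y assume "alpha_le E Y s"
    then have "alpha_le E Y (2 * s + t + 1)" by (rule alpha_le_mono) auto
    then obtain D where D: "D \<in> \<D>l" "D \<inter> Y = {}" using bigl by blast
    have "D \<inter> (D0 \<union> E `` D0) \<noteq> {}"
    proof (rule ccontr)
      assume disj: "\<not> ?thesis"
      have "D \<in> \<D>" using D by (simp add: \<D>l_def)
      have "conn_in E (D0 \<union> D)" "D \<noteq> {}"
        using lbD(6)[OF D0 \<open>D \<in> \<D>\<close>] conn_in_nonempty[OF lbD(4)[OF \<open>D \<in> \<D>\<close>]] by auto
      moreover have "D0 \<noteq> D0 \<union> D" "D0 \<noteq> {}" using disj x \<open>D \<noteq> {}\<close> by auto
      ultimately obtain y z where "y \<in> D0" "z \<in> D" "(y, z) \<in> E"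
        using conn_in_cut[of E "D0 \<union> D" D0] by blast
      with disj show False by blast
    qed
    with D show "\<exists>D\<in>{D \<in> \<D>l. D \<inter> (D0 \<union> E `` D0) \<noteq> {}}. D \<inter> Y = {}" by blast
  qed
  moreover have "finite D0" using lbD D0 by (meson finite_subset)
  ultimately obtain R R' q where R: "R \<subseteq> D0" "conn_in E R" "x \<in> R" "Q R" "R = insert q R'" "R' = {} \<or> \<not> Q R'"
    using lbD(4)[OF D0] x(1) by - (rule grow_connected[of D0 x Q])
  \<comment> \<open>The failure of \<open>Q R'\<close> gives a small set hitting all members near
    \<open>R'\<close>; if \<open>R'\<close> is empty, there are no such members and
    \<open>{}\<close> serves.\<close>
  obtain Y0 where Y0: "alpha_le E Y0 s" "\<And>D. D \<in> \<D>l \<Longrightarrow> D \<inter> (R' \<union> E `` R') \<noteq> {} \<Longrightarrow> D \<inter> Y0 \<noteq> {}"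
  proof (cases "R' = {}")
    case True
    show ?thesis by (rule that[of "{}"]) (simp_all add: True)
  next
    case False
    with R(6) have "\<not> Q R'" by simp
    then obtain Y where Y: "alpha_le E Y s"
      "\<And>D. D \<in> {D \<in> \<D>l. D \<inter> (R' \<union> E `` R') \<noteq> {}} \<Longrightarrow> D \<inter> Y \<noteq> {}"
      unfolding Q_def by (erule not_unhitE)
    show ?thesis by (rule that[OF Y(1)], rule Y(2)) simp
  qed
  define \<D>1 where "\<D>1 = {D \<in> \<D>l. D \<inter> (R \<union> E `` R) = {}}"
  \<comment> \<open>The rest of the threshold is spent here: \<open>s\<close> for \<open>Y\<close>,
    \<open>s\<close> for \<open>Y0\<close>, and \<open>Suc t\<close> for the closed neighbourhood of
    \<open>q\<close>. A member avoiding the last two is far from all of \<open>R\<close>.\<close>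
  have big1: "\<exists>D\<in>\<D>1. D \<inter> Y = {}" if "alpha_le E Y s" for Y
  proof -
    have "alpha_le E (Y \<union> (Y0 \<union> insert q (E `` {q}))) (s + (s + Suc t))"
      by (intro alpha_le_Un that Y0 alpha_closed_nbhd)
    then have "alpha_le E (Y \<union> (Y0 \<union> insert q (E `` {q}))) (2 * s + t + 1)" by (rule alpha_le_mono) auto
    then obtain D where D: "D \<in> \<D>l" "D \<inter> (Y \<union> (Y0 \<union> insert q (E `` {q}))) = {}" using bigl by blast
    have "D \<inter> Y0 = {}" using D(2) by blast
    then have "D \<inter> (R' \<union> E `` R') = {}" using Y0(2)[OF D(1)] by argo
    with D have "D \<inter> (R \<union> E `` R) = {}" unfolding R(5) by blast
    with D show ?thesis unfolding \<D>1_def by blast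
  qed
  define C1 where "C1 = C - (E `` {l} \<union> R \<union> E `` R)"
  define \<A> where "\<A> = {A. A \<subseteq> C1 \<and> conn_in E A \<and> E `` A \<inter> (E `` R \<inter> C) \<noteq> {} \<and> (\<exists>D\<in>\<D>1. D \<subseteq> A)}"
  have sub1: "\<D>1 \<subseteq> \<D>" by (auto simp: \<D>1_def \<D>l_def)
  have "linked_bramble E C1 (E `` R \<inter> C) \<A>"
    by (rule linked_bramble_refine[OF lb]) (use lbD(1) sub1 in \<open>auto simp: C1_def \<A>_def\<close>)
  moreover have "unhit E \<A> s" unfolding unhit_def
  proof (intro allI impI)
    fix Y assume Y: "alpha_le E Y s"
    obtain D' where D': "D' \<in> \<D>1" "D' \<inter> Y = {}" using big1[OF Y] by blast
    obtain D where "D \<in> {D \<in> \<D>l. D \<inter> (R \<union> E `` R) \<noteq> {}}" "D \<inter> Y = {}"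
      using unhitD[OF R(4)[unfolded Q_def] Y] by (rule bexE)
    then have D: "D \<in> \<D>l" "D \<inter> (R \<union> E `` R) \<noteq> {}" "D \<inter> Y = {}" by simp_all
    have DD: "D \<in> \<D>" "D' \<in> \<D>" using D(1) D'(1) sub1 by (auto simp: \<D>l_def)
    \<comment> \<open>\<open>D'\<close> is far from \<open>R\<close>, while \<open>D\<close> meets
      its closed neighbourhood. As the two touch, the component containing \<open>D'\<close> of
      their union outside that neighbourhood must border on it.\<close>
    define S where "S = D \<union> D'"
    define X where "X = S - (R \<union> E `` R)"
    have S: "conn_in E S" "S \<subseteq> C" "S \<inter> Y = {}" "S \<inter> E `` {l} = {}"
      using lbD(6)[OF DD] lbD(3)[OF DD(1)] lbD(3)[OF DD(2)] D D' by (auto simp: S_def \<D>1_def \<D>l_def)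
    have "D' \<subseteq> X" using D'(1) by (auto simp: X_def S_def \<D>1_def)
    obtain d where d: "d \<in> D'" using conn_in_nonempty[OF lbD(4)[OF DD(2)]] by blast
    define A where "A = comp_of E X d"
    have dX: "d \<in> X" using d \<open>D' \<subseteq> X\<close> by auto
    have "D' \<subseteq> A" unfolding A_def
      using comp_of_maximal[OF dX lbD(4)[OF DD(2)] \<open>D' \<subseteq> X\<close> d] comp_of_self[OF dX] by auto
    have AX: "A \<subseteq> X" unfolding A_def by (rule comp_of_subset)
    have cA: "conn_in E A" unfolding A_def by (rule conn_in_comp_of[OF dX])
    have AC1: "A \<subseteq> C1" using AX S by (auto simp: X_def C1_def)
    have "\<not> S \<subseteq> X" using D(2) by (auto simp: X_def S_def)
    then obtain y z where yz: "y \<in> A" "z \<in> S" "z \<notin> X" "(y, z) \<in> E"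
      using comp_of_exit[OF dX S(1)] AX unfolding A_def X_def by blast
    have "z \<in> R \<union> E `` R" using yz by (auto simp: X_def)
    \<comment> \<open>A vertex of \<open>A\<close> next to \<open>R\<close> would belong to the
      neighbourhood that \<open>A\<close> avoids. So the exit vertex is a neighbour of
      \<open>R\<close>, which makes it a legitimate landing vertex.\<close>
    moreover have "z \<notin> R" using yz AX E_sym[OF yz(4)] by (auto simp: X_def)
    ultimately have "z \<in> E `` A \<inter> (E `` R \<inter> C)" using yz S(2) by auto
    then have "A \<in> \<A>" using AC1 cA \<open>D' \<subseteq> A\<close> D'(1) by (auto simp: \<A>_def)
    moreover have "A \<inter> Y = {}" using AX S(3) by (auto simp: X_def)
    ultimately show "\<exists>D\<in>\<A>. D \<inter> Y = {}" by blast
  qed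
  moreover have "\<exists>D\<in>\<D>. D \<subseteq> A" if "A \<in> \<A>" for A using that sub1 by (auto simp: \<A>_def)
  moreover have "l \<in> E `` R" using R(3) x(2) by auto
  moreover have "R \<subseteq> C" using R(1) lbD(3)[OF D0] by auto
  ultimately show ?thesis using l R(2) unfolding C1_def
    by - (rule exI[of _ l], rule exI[of _ R], rule exI[of _ \<A>], simp)
qed

section \<open>Joining models along a hub\<close>

lemma minor_model_Un:
  assumes m1: "minor_model E V1 F1 H" and m2: "minor_model E V2 F2 H" and disj: "V1 \<inter> V2 = {}"
    and F: "F1 \<subseteq> V1 \<times> V1" "F2 \<subseteq> V2 \<times> V2"
    and r: "r1 \<in> V1" "r2 \<in> V2"
    and cross: "\<And>u v. u \<in> V1 \<Longrightarrow> v \<in> V2 \<Longrightarrow> H u \<inter> H v = {} \<and>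
      ((\<exists>x\<in>H u. \<exists>y\<in>H v. (x, y) \<in> E) \<longleftrightarrow> u = r1 \<and> v = r2)"
  shows "minor_model E (V1 \<union> V2) (link F1 r1 F2 r2) H"
  unfolding minor_model_def
proof (intro conjI ballI impI)
  fix v assume "v \<in> V1 \<union> V2"
  then show "conn_in E (H v)" using m1 m2 by (auto simp: minor_model_def)
next
  fix u v assume uv: "u \<in> V1 \<union> V2" "v \<in> V1 \<union> V2" "u \<noteq> v"
  have adj_sym: "(\<exists>x\<in>H u. \<exists>y\<in>H v. (x, y) \<in> E) \<longleftrightarrow> (\<exists>x\<in>H v. \<exists>y\<in>H u. (x, y) \<in> E)" using E_sym by blast
  consider "u \<in> V1" "v \<in> V1" "u \<notin> V2" "v \<notin> V2" | "u \<in> V2" "v \<in> V2" "u \<notin> V1" "v \<notin> V1"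
    | "u \<in> V1" "v \<in> V2" "u \<notin> V2" "v \<notin> V1" | "u \<in> V2" "v \<in> V1" "u \<notin> V1" "v \<notin> V2"
    using uv disj by blast
  then have "H u \<inter> H v = {} \<and>
    ((u, v) \<in> link F1 r1 F2 r2 \<longleftrightarrow> (\<exists>x\<in>H u. \<exists>y\<in>H v. (x, y) \<in> E))"
  proof cases
    case 1
    then have "(u, v) \<in> link F1 r1 F2 r2 \<longleftrightarrow> (u, v) \<in> F1" using F r by auto
    with 1 m1 uv(3) show ?thesis by (simp add: minor_model_def)
  next
    case 2
    then have "(u, v) \<in> link F1 r1 F2 r2 \<longleftrightarrow> (u, v) \<in> F2" using F r by auto
    with 2 m2 uv(3) show ?thesis by (simp add: minor_model_def)
  next
    case 3
    then have "(u, v) \<in> link F1 r1 F2 r2 \<longleftrightarrow> u = r1 \<and> v = r2" using F r by auto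
    with 3 cross[of u v] show ?thesis by simp
  next
    case 4
    then have "(u, v) \<in> link F1 r1 F2 r2 \<longleftrightarrow> v = r1 \<and> u = r2" using F r by auto
    with 4 cross[of v u] adj_sym show ?thesis by (simp add: Int_commute)
  qed
  then show "H u \<inter> H v = {}"
    and "(u, v) \<in> link F1 r1 F2 r2 \<longleftrightarrow> (\<exists>x\<in>H u. \<exists>y\<in>H v. (x, y) \<in> E)" by blast+
qed

text \<open>Neither \<open>S\<close> nor its neighbourhood meets another hub, so absorbing
  \<open>S\<close> into the root hub creates no overlap and no adjacency.\<close>

lemma minor_model_enlarge:
  assumes m: "minor_model E V F H" and r: "r \<in> V" and conn: "conn_in E (S \<union> H r)"
    and disj: "\<And>v. v \<in> V \<Longrightarrow> v \<noteq> r \<Longrightarrow> (S \<union> E `` S) \<inter> H v = {}"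
    and H': "\<And>v. v \<in> V \<Longrightarrow> H' v = (if v = r then S \<union> H r else H v)"
  shows "minor_model E V F H'"
  unfolding minor_model_def
proof (intro conjI ballI impI)
  fix v assume "v \<in> V"
  then show "conn_in E (H' v)" using m conn H' by (simp add: minor_model_def)
next
  fix u v assume uv: "u \<in> V" "v \<in> V" "u \<noteq> v"
  have mm: "H u \<inter> H v = {}" "(u, v) \<in> F \<longleftrightarrow> (\<exists>x\<in>H u. \<exists>y\<in>H v. (x, y) \<in> E)"
    using m uv by (auto simp: minor_model_def)
  have d: "(S \<union> E `` S) \<inter> H w = {}" if "w \<in> {u, v}" "w \<noteq> r" for w using disj that uv by blast
  show "H' u \<inter> H' v = {}" using mm(1) d[of u] d[of v] uv H' by (auto split: if_splits)
  have "(\<exists>x\<in>H' u. \<exists>y\<in>H' v. (x, y) \<in> E) \<longleftrightarrow> (\<exists>x\<in>H u. \<exists>y\<in>H v. (x, y) \<in> E)"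
  proof (cases "u = r")
    case True
    then have "(\<exists>x\<in>S. \<exists>y\<in>H v. (x, y) \<in> E) = False" using d[of v] uv by blast
    then show ?thesis using True uv H'[of u] H'[of v] by auto
  next
    case False
    show ?thesis
    proof (cases "v = r")
      case True
      then have "(\<exists>x\<in>H u. \<exists>y\<in>S. (x, y) \<in> E) = False" using d[of u] uv E_sym by blast
      then show ?thesis using True uv H'[of u] H'[of v] by auto
    qed (use False H' uv in simp)
  qed
  then show "(u, v) \<in> F \<longleftrightarrow> (\<exists>x\<in>H' u. \<exists>y\<in>H' v. (x, y) \<in> E)" using mm by simp
qed

lemma minor_model_cong: "(\<And>v. v \<in> V \<Longrightarrow> H v = H' v) \<Longrightarrow> minor_model E V F H = minor_model E V F H'"
  by (simp add: minor_model_def)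

lemma prongD:
  assumes "prong E V F r C l H"
  shows "minor_model E V F H" "\<And>v. v \<in> V \<Longrightarrow> H v \<subseteq> C" "\<And>v. v \<in> V \<Longrightarrow> l \<in> E `` H v \<longleftrightarrow> v = r"
  using assms by (auto simp: prong_def)

text \<open>The hub of \<open>r2\<close> absorbs \<open>R\<close> and both landing vertices.
  \<open>R\<close> is anticomplete to both models, so the first model is reached only through
  \<open>la\<close> or \<open>lb\<close>, and only at \<open>r1\<close>. The two landing vertices
  may coincide, and each may see the root hub of the other model.\<close>

lemma join_prongs:
  assumes R: "conn_in E R" "la \<in> E `` R" "lb \<in> E `` R"
    and pa: "prong E V1 F1 r1 C1 la Ha" and pb: "prong E V2 F2 r2 C2 lb Hb"
    and t1: "rooted_tree V1 F1 r1" and t2: "rooted_tree V2 F2 r2" and V: "V1 \<inter> V2 = {}"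
    and C: "(C1 \<union> C2) \<inter> (R \<union> E `` R) = {}"
    and sep: "\<And>u v. u \<in> V1 \<Longrightarrow> v \<in> V2 \<Longrightarrow> Ha u \<inter> (Hb v \<union> E `` Hb v) = {}"
    and la: "\<And>v. v \<in> V2 \<Longrightarrow> v \<noteq> r2 \<Longrightarrow> la \<notin> E `` Hb v"
    and lb: "\<And>v. v \<in> V1 \<Longrightarrow> v \<noteq> r1 \<Longrightarrow> lb \<notin> E `` Ha v"
  defines "H \<equiv> \<lambda>v. if v \<in> V1 then Ha v else if v = r2 then insert la (insert lb R) \<union> Hb r2 else Hb v"
  shows "minor_model E (V1 \<union> V2) (link F1 r1 F2 r2) H"
proof (rule minor_model_Un)
  note [simp] = rooted_tree_root[OF t1] rooted_tree_root[OF t2]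
  note pa = prongD[OF pa] and pb = prongD[OF pb]
  let ?S = "insert la (insert lb R)"
  have sub: "Ha u \<inter> (R \<union> E `` R) = {}" "Hb v \<inter> (R \<union> E `` R) = {}" if "u \<in> V1" "v \<in> V2" for u v
    using pa(2)[OF that(1)] pb(2)[OF that(2)] C by blast+
  show "minor_model E V1 F1 H"
    using pa(1) by (rule minor_model_cong[THEN iffD1, rotated]) (simp add: H_def)
  show "minor_model E V2 F2 H"
  proof (rule minor_model_enlarge[OF pb(1), of r2 ?S])
    obtain xa xb where x: "xa \<in> R" "(xa, la) \<in> E" "xb \<in> R" "(xb, lb) \<in> E" using R by blast
    have c: "conn_in E ?S" using conn_in_insert[OF conn_in_insert[OF R(1) x(4,3)] x(2)] x(1) by simp
    have cb: "conn_in E (Hb r2)" using pb(1) by (simp add: minor_model_def)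
    have "lb \<in> E `` Hb r2" using pb(3)[of r2] by simp
    then obtain y where "y \<in> Hb r2" "(lb, y) \<in> E" using E_sym by blast
    with c cb show "conn_in E (?S \<union> Hb r2)" by (intro conn_in_touch[of ?S _ lb y]) auto
  next
    fix v assume v: "v \<in> V2" "v \<noteq> r2"
    have "la \<notin> E `` Hb v" "lb \<notin> E `` Hb v" using la v pb(3)[of v] by auto
    then have "(la, z) \<notin> E" "(lb, z) \<notin> E" if "z \<in> Hb v" for z using that E_sym by blast+
    moreover have "Hb v \<inter> (R \<union> E `` R) = {}" using sub(2)[of r1 v] v by simp
    moreover from this have "la \<notin> Hb v" "lb \<notin> Hb v" using R by auto
    ultimately show "(?S \<union> E `` ?S) \<inter> Hb v = {}" by auto
  next
    fix v assume "v \<in> V2"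
    then show "H v = (if v = r2 then ?S \<union> Hb r2 else Hb v)" using V by (auto simp: H_def)
  qed simp
  show "F1 \<subseteq> V1 \<times> V1" "F2 \<subseteq> V2 \<times> V2" by (rule rooted_tree_edges[OF t1], rule rooted_tree_edges[OF t2])
  show "V1 \<inter> V2 = {}" "r1 \<in> V1" "r2 \<in> V2" by (simp_all add: V)
  fix u v assume uv: "u \<in> V1" "v \<in> V2"
  have Hu: "H u = Ha u" using uv by (simp add: H_def)
  have no: "\<not> (\<exists>x\<in>Ha u. \<exists>y\<in>Hb v. (x, y) \<in> E)" "Ha u \<inter> Hb v = {}" using sep[OF uv] E_sym by blast+
  show "H u \<inter> H v = {} \<and> ((\<exists>x\<in>H u. \<exists>y\<in>H v. (x, y) \<in> E) \<longleftrightarrow> u = r1 \<and> v = r2)"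
  proof (cases "v = r2")
    case True
    then have Hv: "H v = ?S \<union> Hb v" using uv V by (auto simp: H_def)
    have sR: "Ha u \<inter> ?S = {}" using sub(1)[OF uv] R by blast
    have "(\<exists>x\<in>Ha u. \<exists>y\<in>R. (x, y) \<in> E) = False" using sub(1)[OF uv] E_sym by blast
    moreover have "(\<exists>x\<in>Ha u. (x, la) \<in> E) = (u = r1)" using pa(3)[OF uv(1)] by blast
    moreover have "(\<exists>x\<in>Ha u. (x, lb) \<in> E) \<longrightarrow> u = r1" using lb[OF uv(1)] by blast
    ultimately show ?thesis using True no sR unfolding Hu Hv by blast
  next
    case False
    then have "H v = Hb v" using uv V by (auto simp: H_def)
    then show ?thesis using Hu no False by simp
  qed
qed

end

section \<open>Extracting models from brambles of large order\<close>

context star_bounded begin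

lemma prong_subset: "prong E V F r C l H \<Longrightarrow> C \<subseteq> C' \<Longrightarrow> prong E V F r C' l H"
  by (auto simp: prong_def)

text \<open>The induction extracts \<open>n\<close> prongs with target order \<open>f s\<close> and
  one more from what is left. Each later model avoids the zones of the earlier ones, so the models
  are pairwise anticomplete.\<close>

lemma grabs_many:
  fixes F :: "('b \<times> 'b) set" and n s :: nat
  assumes g: "grabs E V F r f"
  shows "\<forall>C L \<D>. linked_bramble E C L \<D> \<longrightarrow> unhit E \<D> ((f ^^ n) s) \<longrightarrow>
    (\<exists>l H C' \<D>'. C' \<subseteq> C \<and>
       (\<forall>i<n. l i \<in> L \<and> prong E V F r C (l i) (H i) \<and> C' \<inter> prong_zone E V (l i) (H i) = {}) \<and>
       (\<forall>j<n. \<forall>i<j. \<Union>(H j ` V) \<inter> prong_zone E V (l i) (H i) = {}) \<and>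
       linked_bramble E C' L \<D>' \<and> unhit E \<D>' s \<and> (\<forall>D'\<in>\<D>'. \<exists>D\<in>\<D>. D \<subseteq> D'))"
proof (induction n arbitrary: s)
  case 0
  show ?case
  proof (intro allI impI)
    fix C L \<D> assume "linked_bramble E C L \<D>" "unhit E \<D> ((f ^^ 0) s)"
    then show "\<exists>l H C' \<D>'. C' \<subseteq> C \<and>
       (\<forall>i<0::nat. l i \<in> L \<and> prong E V F r C (l i) (H i) \<and> C' \<inter> prong_zone E V (l i) (H i) = {}) \<and>
       (\<forall>j<0::nat. \<forall>i<j. \<Union>(H j ` V) \<inter> prong_zone E V (l i) (H i) = {}) \<and>
       linked_bramble E C' L \<D>' \<and> unhit E \<D>' s \<and> (\<forall>D'\<in>\<D>'. \<exists>D\<in>\<D>. D \<subseteq> D')"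
      by - (rule exI, rule exI, rule exI[of _ C], rule exI[of _ \<D>], simp, blast)
  qed
next
  case (Suc n)
  note s1 = g[unfolded grabs_def, THEN spec, of s]
  note s0 = Suc.IH[of "f s"]
  show ?case
  proof (intro allI impI)
    fix C L \<D> assume br: "linked_bramble E C L \<D>" and "unhit E \<D> ((f ^^ Suc n) s)"
    then have un: "unhit E \<D> ((f ^^ n) (f s))" by (simp add: funpow_swap1)
    from s0[rule_format, OF br un] obtain l H C' \<D>' where
      1: "C' \<subseteq> C" and
      2: "\<forall>i<n. l i \<in> L \<and> prong E V F r C (l i) (H i) \<and> C' \<inter> prong_zone E V (l i) (H i) = {}" and
      3: "\<forall>j<n. \<forall>i<j. \<Union>(H j ` V) \<inter> prong_zone E V (l i) (H i) = {}" and
      4: "linked_bramble E C' L \<D>'" "unhit E \<D>' (f s)" and 5: "\<forall>D'\<in>\<D>'. \<exists>D\<in>\<D>. D \<subseteq> D'"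
      by (elim exE conjE)
    from s1[rule_format, OF 4] obtain l1 H1 \<D>1 where
      6: "l1 \<in> L" "prong E V F r C' l1 H1" and
      7: "linked_bramble E (C' - prong_zone E V l1 H1) L \<D>1" "unhit E \<D>1 s" and
      8: "\<forall>D'\<in>\<D>1. \<exists>D\<in>\<D>'. D \<subseteq> D'"
      by (elim bexE exE conjE)
    define l' where "l' = l(n := l1)"
    define H' where "H' = H(n := H1)"
    define C1 where "C1 = C' - prong_zone E V l1 H1"
    have old: "l' i = l i" "H' i = H i" if "i < n" for i using that by (auto simp: l'_def H'_def)
    have new: "l' n = l1" "H' n = H1" by (auto simp: l'_def H'_def)
    have sub: "\<Union>(H1 ` V) \<subseteq> C'" using prongD(2)[OF 6(2)] by blast
    have "\<forall>i<Suc n. l' i \<in> L \<and> prong E V F r C (l' i) (H' i) \<and> C1 \<inter> prong_zone E V (l' i) (H' i) = {}"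
    proof (intro allI impI)
      fix i assume "i < Suc n"
      then consider "i < n" | "i = n" by linarith
      then show "l' i \<in> L \<and> prong E V F r C (l' i) (H' i) \<and> C1 \<inter> prong_zone E V (l' i) (H' i) = {}"
      proof cases
        case 1
        then show ?thesis using 2 old[OF 1] unfolding C1_def by (metis Diff_subset Int_mono order_refl subset_empty)
      next
        case 2
        then show ?thesis using 6(1) new prong_subset[OF 6(2) \<open>C' \<subseteq> C\<close>] unfolding C1_def
          by (simp add: Diff_Int_distrib2)
      qed
    qed
    moreover have "\<forall>j<Suc n. \<forall>i<j. \<Union>(H' j ` V) \<inter> prong_zone E V (l' i) (H' i) = {}"
    proof (intro allI impI)
      fix j i assume j: "j < Suc n" "i < j"
      show "\<Union>(H' j ` V) \<inter> prong_zone E V (l' i) (H' i) = {}"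
      proof (cases "j = n")
        case True
        have "C' \<inter> prong_zone E V (l i) (H i) = {}" using 2 True j by simp
        then have "\<Union>(H1 ` V) \<inter> prong_zone E V (l i) (H i) = {}" using sub by blast
        then show ?thesis using True old[of i] new j by simp
      next
        case False
        then show ?thesis using 3 old[of j] old[of i] j by simp
      qed
    qed
    moreover have "\<forall>D'\<in>\<D>1. \<exists>D\<in>\<D>. D \<subseteq> D'" using 5 8 by (meson order_trans)
    moreover have "C1 \<subseteq> C" using 1 by (auto simp: C1_def)
    ultimately show "\<exists>l H C' \<D>'. C' \<subseteq> C \<and>
       (\<forall>i<Suc n. l i \<in> L \<and> prong E V F r C (l i) (H i) \<and> C' \<inter> prong_zone E V (l i) (H i) = {}) \<and>
       (\<forall>j<Suc n. \<forall>i<j. \<Union>(H j ` V) \<inter> prong_zone E V (l i) (H i) = {}) \<and>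
       linked_bramble E C' L \<D>' \<and> unhit E \<D>' s \<and> (\<forall>D'\<in>\<D>'. \<exists>D\<in>\<D>. D \<subseteq> D')"
      using 7 unfolding C1_def[symmetric]
      by - (rule exI[of _ l'], rule exI[of _ H'], rule exI[of _ C1], rule exI[of _ \<D>1], simp)
  qed
qed

text \<open>A vertex meets at most \<open>t\<close> of several pairwise anticomplete sets.\<close>

lemma nbhd_misses_one:
  assumes "\<And>i j. j < Suc t \<Longrightarrow> i < j \<Longrightarrow> M j \<inter> (M i \<union> E `` M i) = {}"
  obtains i where "i < Suc t" "l \<notin> E `` M i"
proof (rule ccontr)
  assume no: "\<not> thesis"
  have "\<forall>i<Suc t. \<exists>y. y \<in> M i \<and> (l, y) \<in> E"
  proof (intro allI impI)
    fix i assume "i < Suc t"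
    with no that have "l \<in> E `` M i" by blast
    then show "\<exists>y. y \<in> M i \<and> (l, y) \<in> E" using E_sym by blast
  qed
  then obtain y where y: "\<And>i. i < Suc t \<Longrightarrow> y i \<in> M i \<and> (l, y i) \<in> E" by metis
  have ne: "y i \<noteq> y j \<and> (y i, y j) \<notin> E" if "i < j" "j < Suc t" for i j
    using assms[OF that(2,1)] y[OF that(2)] y[of i] that by fastforce
  have "inj_on y {..<Suc t}"
    by (rule inj_onI) (metis lessThan_iff linorder_neqE_nat ne)
  then have "card (y ` {..<Suc t}) = Suc t" by (simp add: card_image)
  moreover have "indep E (y ` {..<Suc t})" unfolding indep_def
  proof (intro ballI)
    fix a b assume "a \<in> y ` {..<Suc t}" "b \<in> y ` {..<Suc t}"
    then obtain i j where ij: "i < Suc t" "j < Suc t" "a = y i" "b = y j" by blast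
    consider "i < j" | "i = j" | "j < i" by linarith
    then show "(a, b) \<notin> E"
      by cases (use ij ne[of i j] ne[of j i] E_irrefl E_sym in blast)+
  qed
  moreover have "y ` {..<Suc t} \<subseteq> E `` {l}" using y by blast
  ultimately show False using alpha_leD[OF alpha_nbhd[of l], of "y ` {..<Suc t}"] by simp
qed

text \<open>The hub grown inside the bramble is the whole model. The remaining bramble is linked to
  the neighbourhood of that hub, but its members contain old ones and therefore still see
  \<open>L\<close>.\<close>

lemma grabs_single: "grabs E {r} {} r (\<lambda>s. 2 * s + 2 * t + 1)"
  unfolding grabs_def
proof (intro allI impI)
  fix s C L \<D> assume lb: "linked_bramble E C L \<D>" and big: "unhit E \<D> (2 * s + 2 * t + 1)"
  from bramble_new_hub[OF this] obtain l R \<A> where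
    h: "l \<in> L" "R \<subseteq> C" "conn_in E R" "l \<in> E `` R"
    "linked_bramble E (C - (E `` {l} \<union> R \<union> E `` R)) (E `` R \<inter> C) \<A>" "unhit E \<A> s"
    and ref: "\<forall>A\<in>\<A>. \<exists>D\<in>\<D>. D \<subseteq> A"
    by (elim exE conjE)
  have "prong E {r} {} r C l (\<lambda>_. R)" using h by (auto simp: prong_def minor_model_def)
  moreover have "linked_bramble E (C - (E `` {l} \<union> R \<union> E `` R)) L \<A>"
    by (rule linked_bramble_refine_same[OF lb h(5)]) (use ref in auto)
  ultimately show "\<exists>l\<in>L. \<exists>H \<D>'. prong E {r} {} r C l H \<and>
      linked_bramble E (C - prong_zone E {r} l H) L \<D>' \<and>
      unhit E \<D>' s \<and> (\<forall>D'\<in>\<D>'. \<exists>D\<in>\<D>. D \<subseteq> D')"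
    using h(1,6) ref by (intro bexI[of _ l] exI[of _ "\<lambda>_. R"] exI[of _ \<A>]) (auto simp: prong_zone_def)
qed

text \<open>From the inside out, the threshold reserves order for the model of \<open>F2\<close>,
  for \<open>t + 1\<close> models of \<open>F1\<close>, and for the central hub. The models of
  \<open>F1\<close> are extracted before that of \<open>F2\<close>: deleting their zones hides the
  model of \<open>F2\<close> from every \<open>ls i\<close>. The vertex \<open>lb\<close> comes last
  and may see some models of \<open>F1\<close>, hence the \<open>t + 1\<close> copies.\<close>

lemma grabs_join:
  fixes F1 F2 :: "('b \<times> 'b) set"
  assumes t1: "rooted_tree V1 F1 r1" and t2: "rooted_tree V2 F2 r2" and V: "V1 \<inter> V2 = {}"
    and g1: "grabs E V1 F1 r1 f1" and g2: "grabs E V2 F2 r2 f2"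
  shows "grabs E (V1 \<union> V2) (link F1 r1 F2 r2) r2 (\<lambda>s. 2 * (f1 ^^ Suc t) (f2 s) + 2 * t + 1)"
  unfolding grabs_def
proof (intro allI impI)
  fix s C L \<D>
  let ?V = "V1 \<union> V2" and ?F = "link F1 r1 F2 r2"
  note s2 = g2[unfolded grabs_def, THEN spec, of s]
  note s1 = grabs_many[OF g1, of "Suc t" "f2 s"]
  assume br: "linked_bramble E C L \<D>" and big: "unhit E \<D> (2 * (f1 ^^ Suc t) (f2 s) + 2 * t + 1)"
    from bramble_new_hub[OF this] obtain l R \<A> where
      h: "l \<in> L" "R \<subseteq> C" "conn_in E R" "l \<in> E `` R"
      "linked_bramble E (C - (E `` {l} \<union> R \<union> E `` R)) (E `` R \<inter> C) \<A>" "unhit E \<A> ((f1 ^^ Suc t) (f2 s))"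
      and ref: "\<forall>A\<in>\<A>. \<exists>D\<in>\<D>. D \<subseteq> A"
      by (elim exE conjE)
    define C1 where "C1 = C - (E `` {l} \<union> R \<union> E `` R)"
    define W where "W = E `` R \<inter> C"
    from s1[rule_format, OF h(5,6)] obtain ls Hs C2 \<B> where
      C2: "C2 \<subseteq> C1" and
      ls: "\<forall>i<Suc t. ls i \<in> W \<and> prong E V1 F1 r1 C1 (ls i) (Hs i) \<and> C2 \<inter> prong_zone E V1 (ls i) (Hs i) = {}" and
      far: "\<forall>j<Suc t. \<forall>i<j. \<Union>(Hs j ` V1) \<inter> prong_zone E V1 (ls i) (Hs i) = {}" and
      B: "linked_bramble E C2 W \<B>" "unhit E \<B> (f2 s)" and refB: "\<forall>D\<in>\<B>. \<exists>A\<in>\<A>. A \<subseteq> D"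
      unfolding C1_def[symmetric] W_def[symmetric] by (elim exE conjE)
    from s2[rule_format, OF B] obtain lb Hb \<B>' where
      lb: "lb \<in> W" and pb: "prong E V2 F2 r2 C2 lb Hb" and
      B': "linked_bramble E (C2 - prong_zone E V2 lb Hb) W \<B>'" "unhit E \<B>' s" and
      refB': "\<forall>D\<in>\<B>'. \<exists>A\<in>\<B>. A \<subseteq> D"
      by (elim bexE exE conjE)
    obtain a where a: "a < Suc t" "lb \<notin> E `` \<Union>(Hs a ` V1)"
    proof (rule nbhd_misses_one[of "\<lambda>i. \<Union>(Hs i ` V1)" lb])
      fix i j assume "j < Suc t" "i < j"
      with far have "\<Union>(Hs j ` V1) \<inter> prong_zone E V1 (ls i) (Hs i) = {}" by blast
      then show "\<Union>(Hs j ` V1) \<inter> (\<Union>(Hs i ` V1) \<union> E `` \<Union>(Hs i ` V1)) = {}"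
        unfolding prong_zone_def by blast
    qed
    define la where "la = ls a"
    define Ha where "Ha = Hs a"
    have la: "la \<in> W" and pa: "prong E V1 F1 r1 C1 la Ha" and zone: "C2 \<inter> prong_zone E V1 la Ha = {}"
      using ls[rule_format, OF a(1)] by (auto simp: la_def Ha_def)
    have lbHa: "lb \<notin> E `` Ha v" if "v \<in> V1" for v using a(2) that by (auto simp: Ha_def)
    have HbC2: "Hb v \<subseteq> C2" if "v \<in> V2" for v using prongD(2)[OF pb that] .
    have HaC1: "Ha v \<subseteq> C1" if "v \<in> V1" for v using prongD(2)[OF pa that] .
    define H where "H = (\<lambda>v. if v \<in> V1 then Ha v else if v = r2 then insert la (insert lb R) \<union> Hb r2 else Hb v)"
    have r: "r1 \<in> V1" "r2 \<in> V2" "r2 \<notin> V1" using rooted_tree_root[OF t1] rooted_tree_root[OF t2] V by auto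
    have "minor_model E ?V ?F H" unfolding H_def
    proof (rule join_prongs[OF h(3) _ _ pa pb t1 t2 V])
      show "la \<in> E `` R" "lb \<in> E `` R" using la lb by (auto simp: W_def)
      show "(C1 \<union> C2) \<inter> (R \<union> E `` R) = {}" using C2 by (auto simp: C1_def)
      show "Ha u \<inter> (Hb v \<union> E `` Hb v) = {}" if "u \<in> V1" "v \<in> V2" for u v
      proof -
        have "Hb v \<inter> (Ha u \<union> E `` Ha u) = {}"
          using HbC2[OF that(2)] zone that(1) unfolding prong_zone_def by blast
        then show ?thesis using E_sym by blast
      qed
      show "la \<notin> E `` Hb v" if "v \<in> V2" for v
      proof -
        have "Hb v \<inter> E `` {la} = {}" using HbC2[OF that] zone unfolding prong_zone_def by blast
        then show ?thesis using E_sym by blast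
      qed
      show "lb \<notin> E `` Ha v" if "v \<in> V1" for v by (rule lbHa[OF that])
    qed
    moreover have "H v \<subseteq> C \<and> (l \<in> E `` H v \<longleftrightarrow> v = r2)" if v: "v \<in> ?V" for v
    proof (cases "v = r2")
      case True
      have "R \<subseteq> H v" using True r by (auto simp: H_def)
      then have "l \<in> E `` H v" using h(4) by blast
      moreover have "Hb r2 \<subseteq> C" using HbC2[OF r(2)] C2 by (auto simp: C1_def)
      then have "H v \<subseteq> C" using True r la lb h(2) by (simp add: H_def W_def)
      ultimately show ?thesis using True by simp
    next
      case False
      then have "H v \<subseteq> C1" using v HaC1[of v] HbC2[of v] C2 by (auto simp: H_def)
      then have "H v \<subseteq> C" "H v \<inter> E `` {l} = {}" by (auto simp: C1_def)
      then show ?thesis using False E_sym by blast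
    qed
    ultimately have P: "prong E ?V ?F r2 C l H" by (simp add: prong_def)
    \<comment> \<open>The landing set changed to the neighbourhood of \<open>R\<close> on the way;
      since the final members contain original ones, contact with the original \<open>L\<close>
      survives.\<close>
    have "linked_bramble E (C - prong_zone E ?V l H) L \<B>'"
    proof (rule linked_bramble_refine[OF br])
      show "finite (C - prong_zone E ?V l H)" "L \<inter> (C - prong_zone E ?V l H) = {}"
        using linked_brambleD(1,2)[OF br] by auto
      fix D assume D: "D \<in> \<B>'"
      obtain D0 where D0: "D0 \<in> \<D>" "D0 \<subseteq> D" using bspec[OF refB' D] refB ref by (meson order_trans)
      have "E `` D0 \<inter> L \<noteq> {}" using linked_brambleD(5)[OF br D0(1)] .
      then have 1: "E `` D \<inter> L \<noteq> {}" using D0(2) by blast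
      have "D \<subseteq> C2 - prong_zone E V2 lb Hb" by (rule linked_brambleD(3)[OF B'(1) D])
      then have D2: "D \<subseteq> C2" "D \<inter> prong_zone E V2 lb Hb = {}" "D \<inter> prong_zone E V1 la Ha = {}" using zone by auto
      then have D1: "D \<subseteq> C" "D \<inter> (E `` {l} \<union> R \<union> E `` R) = {}" using C2 by (auto simp: C1_def)
      have "la \<in> E `` R" "lb \<in> E `` R" using la lb by (auto simp: W_def)
      then have Dl: "D \<inter> {la, lb} = {}" using D1(2) by blast
      \<comment> \<open>\<open>U\<close> contains all hubs of \<open>H\<close>. A remaining member
        avoids \<open>U\<close> and its neighbourhood piece by piece: the models and the neighbours
        of \<open>la\<close> and \<open>lb\<close> because of the two zones, and \<open>R\<close>
        with its neighbours because the member lies in \<open>C1\<close>.\<close>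
      define U where "U = \<Union>(Ha ` V1) \<union> \<Union>(Hb ` V2) \<union> (R \<union> {la, lb})"
      have "E `` U = E `` \<Union>(Ha ` V1) \<union> E `` \<Union>(Hb ` V2) \<union> (E `` R \<union> (E `` {la} \<union> E `` {lb}))"
        unfolding U_def by blast
      moreover note D2(2,3) D1(2) Dl
      ultimately have DU: "D \<inter> (U \<union> E `` U) = {}"
        unfolding U_def prong_zone_def by (simp only: Int_Un_distrib Un_empty simp_thms)
      have HU: "\<Union>(H ` ?V) \<subseteq> U" using r by (auto simp: H_def U_def split: if_splits)
      then have "E `` \<Union>(H ` ?V) \<subseteq> E `` U" by (rule Image_mono[OF order_refl])
      then have "D \<inter> prong_zone E ?V l H = {}"
        using DU HU D1(2) unfolding prong_zone_def by blast
      then show "D \<subseteq> C - prong_zone E ?V l H \<and> conn_in E D \<and> E `` D \<inter> L \<noteq> {} \<and> (\<exists>D'\<in>\<D>. D' \<subseteq> D)"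
        using D1(1) 1 D0 linked_brambleD(4)[OF B'(1) D] by blast
    qed
    moreover have "\<exists>D'\<in>\<D>. D' \<subseteq> D" if "D \<in> \<B>'" for D
      using bspec[OF refB' that] refB ref by (meson order_trans)
    ultimately show "\<exists>l\<in>L. \<exists>H \<D>'. prong E ?V ?F r2 C l H \<and>
        linked_bramble E (C - prong_zone E ?V l H) L \<D>' \<and>
        unhit E \<D>' s \<and> (\<forall>D'\<in>\<D>'. \<exists>D\<in>\<D>. D \<subseteq> D')"
      using P h(1) B'(2) by (intro bexI[of _ l] exI[of _ H] exI[of _ \<B>']) auto
qed

end

lemma rooted_tree_grabs:
  "rooted_tree V F r \<Longrightarrow> \<exists>f. \<forall>E :: ('a \<times> 'a) set. star_bounded E t \<longrightarrow> grabs E V F r f"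
proof (induction rule: rooted_tree.induct)
  case (single r)
  show ?case by (intro exI allI impI, rule star_bounded.grabs_single)
next
  case (join V1 F1 r1 V2 F2 r2)
  then obtain f1 f2 where "\<forall>E :: ('a \<times> 'a) set. star_bounded E t \<longrightarrow> grabs E V1 F1 r1 f1"
    "\<forall>E :: ('a \<times> 'a) set. star_bounded E t \<longrightarrow> grabs E V2 F2 r2 f2" by (elim exE)
  then have "star_bounded E t \<Longrightarrow> grabs E (V1 \<union> V2) (link F1 r1 F2 r2) r2
      (\<lambda>s. 2 * (f1 ^^ Suc t) (f2 s) + 2 * t + 1)" for E :: "('a \<times> 'a) set"
    using join.hyps by (intro star_bounded.grabs_join) simp_all
  then show ?case by blast
qed

section \<open>Path-decompositions as lists of bags\<close>

text \<open>The last conjunct is the interval property, which replaces connectedness of the set of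
  bags containing a vertex.\<close>

definition path_dec :: "('a \<times> 'a) set \<Rightarrow> 'a set \<Rightarrow> 'a set list \<Rightarrow> bool" where
  "path_dec E X Bs \<longleftrightarrow> Bs \<noteq> [] \<and> \<Union>(set Bs) = X \<and>
     (\<forall>u\<in>X. \<forall>v\<in>X. (u, v) \<in> E \<longrightarrow> (\<exists>B\<in>set Bs. u \<in> B \<and> v \<in> B)) \<and>
     (\<forall>l<length Bs. \<forall>j\<le>l. \<forall>i\<le>j. Bs ! i \<inter> Bs ! l \<subseteq> Bs ! j)"

definition has_pd :: "('a \<times> 'a) set \<Rightarrow> 'a set \<Rightarrow> nat \<Rightarrow> bool" where
  "has_pd E X k \<longleftrightarrow> (\<exists>Bs. path_dec E X Bs \<and> (\<forall>B\<in>set Bs. alpha_le E B k))"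

lemma path_dec_single: "path_dec E X [X]"
  by (auto simp: path_dec_def)

lemma path_decD:
  assumes "path_dec E X Bs"
  shows "Bs \<noteq> []" "\<Union>(set Bs) = X"
    "\<And>u v. u \<in> X \<Longrightarrow> v \<in> X \<Longrightarrow> (u, v) \<in> E \<Longrightarrow> \<exists>B\<in>set Bs. u \<in> B \<and> v \<in> B"
    "\<And>i j l. i \<le> j \<Longrightarrow> j \<le> l \<Longrightarrow> l < length Bs \<Longrightarrow> Bs ! i \<inter> Bs ! l \<subseteq> Bs ! j"
  using assms by (auto simp: path_dec_def)

lemma path_decI:
  assumes "Bs \<noteq> []" "\<Union>(set Bs) = X"
    "\<And>u v. u \<in> X \<Longrightarrow> v \<in> X \<Longrightarrow> (u, v) \<in> E \<Longrightarrow> \<exists>B\<in>set Bs. u \<in> B \<and> v \<in> B"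
    "\<And>i j l. i \<le> j \<Longrightarrow> j \<le> l \<Longrightarrow> l < length Bs \<Longrightarrow> Bs ! i \<inter> Bs ! l \<subseteq> Bs ! j"
  shows "path_dec E X Bs"
  using assms by (auto simp: path_dec_def)

text \<open>Serves two purposes: \<open>T = {}\<close> restricts all bags to \<open>S\<close>, and
  \<open>S = UNIV\<close> adds \<open>T\<close> to all bags.\<close>

lemma path_dec_map:
  assumes pd: "path_dec E X Bs" and f: "\<And>B. f B = B \<inter> S \<union> T"
  shows "path_dec E (X \<inter> S \<union> T) (map f Bs)"
proof (rule path_decI)
  note pd = path_decD[OF pd]
  show "map f Bs \<noteq> []" using pd(1) by simp
  show "\<Union>(set (map f Bs)) = X \<inter> S \<union> T" using pd(1,2) by (auto simp: f)
  fix u v assume uv: "u \<in> X \<inter> S \<union> T" "v \<in> X \<inter> S \<union> T" "(u, v) \<in> E"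
  obtain B1 B2 where B: "B1 \<in> set Bs" "u \<in> f B1" "B2 \<in> set Bs" "v \<in> f B2"
    using uv pd(1,2) f by (cases Bs) auto
  show "\<exists>B\<in>set (map f Bs). u \<in> B \<and> v \<in> B"
  proof (cases "u \<in> T \<or> v \<in> T")
    case True
    then show ?thesis using B by (auto simp: f)
  next
    case False
    then have uX: "u \<in> X" "v \<in> X" "u \<in> S" "v \<in> S" using uv by auto
    with pd(3)[OF uX(1,2) uv(3)] show ?thesis by (auto simp: f)
  qed
next
  fix i j l assume "i \<le> j" "j \<le> l" "l < length (map f Bs)"
  with path_decD(4)[OF pd, of i j l] show "map f Bs ! i \<inter> map f Bs ! l \<subseteq> map f Bs ! j"
    by (auto simp: f)
qed

text \<open>A shared vertex lies in both bags at the junction, so its two intervals merge into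
  one.\<close>

lemma path_dec_append:
  assumes pd1: "path_dec E X1 Bs1" and pd2: "path_dec E X2 Bs2"
    and overlap: "X1 \<inter> X2 \<subseteq> last Bs1 \<inter> hd Bs2"
    and noedge: "\<And>u v. u \<in> X1 - X2 \<Longrightarrow> v \<in> X2 - X1 \<Longrightarrow> (u, v) \<notin> E \<and> (v, u) \<notin> E"
  shows "path_dec E (X1 \<union> X2) (Bs1 @ Bs2)"
proof (rule path_decI)
  note d1 = path_decD[OF pd1] and d2 = path_decD[OF pd2]
  show "Bs1 @ Bs2 \<noteq> []" "\<Union>(set (Bs1 @ Bs2)) = X1 \<union> X2" using d1 d2 by auto
  fix u v assume uv: "u \<in> X1 \<union> X2" "v \<in> X1 \<union> X2" "(u, v) \<in> E"
  then have "u \<in> X1 \<and> v \<in> X1 \<or> u \<in> X2 \<and> v \<in> X2" using noedge by blast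
  then show "\<exists>B\<in>set (Bs1 @ Bs2). u \<in> B \<and> v \<in> B" using d1(3)[of u v] d2(3)[of u v] uv(3) by auto
next
  note d1 = path_decD[OF pd1] and d2 = path_decD[OF pd2]
  fix i j l assume ij: "i \<le> j" "j \<le> l" "l < length (Bs1 @ Bs2)"
  let ?n = "length Bs1"
  consider "l < ?n" | "i \<ge> ?n" | "i < ?n" "l \<ge> ?n" by linarith
  then show "(Bs1 @ Bs2) ! i \<inter> (Bs1 @ Bs2) ! l \<subseteq> (Bs1 @ Bs2) ! j"
  proof cases
    case 1
    then show ?thesis using d1(4)[OF ij(1,2)] ij by (simp add: nth_append)
  next
    case 2
    then show ?thesis using d2(4)[of "i - ?n" "j - ?n" "l - ?n"] ij by (simp add: nth_append)
  next
    case 3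
    have "Bs1 ! i \<in> set Bs1" "Bs2 ! (l - ?n) \<in> set Bs2" using 3 ij by auto
    then have il: "Bs1 ! i \<subseteq> X1" "Bs2 ! (l - ?n) \<subseteq> X2" unfolding d1(2)[symmetric] d2(2)[symmetric] by blast+
    have m: "Bs1 ! i \<inter> Bs2 ! (l - ?n) \<subseteq> last Bs1 \<inter> hd Bs2" using il overlap by blast
    show ?thesis
    proof (cases "j < ?n")
      case True
      have "Bs1 ! i \<inter> last Bs1 \<subseteq> Bs1 ! j"
        using d1(4)[of i j "?n - 1"] ij True d1(1) by (simp add: last_conv_nth)
      with m show ?thesis using 3 True by (auto simp: nth_append)
    next
      case False
      have "hd Bs2 \<inter> Bs2 ! (l - ?n) \<subseteq> Bs2 ! (j - ?n)"
        using d2(4)[of 0 "j - ?n" "l - ?n"] ij False d2(1) by (simp add: hd_conv_nth)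
      with m show ?thesis using 3 False by (auto simp: nth_append)
    qed
  qed
qed

lemma has_pd_mono: "has_pd E X k \<Longrightarrow> k \<le> l \<Longrightarrow> has_pd E X l"
  unfolding has_pd_def using alpha_le_mono by blast

lemma has_pd_subset:
  assumes "has_pd E X k" "Y \<subseteq> X"
  shows "has_pd E Y k"
proof -
  obtain Bs where Bs: "path_dec E X Bs" "\<forall>B\<in>set Bs. alpha_le E B k" using assms by (auto simp: has_pd_def)
  have "path_dec E (X \<inter> Y \<union> {}) (map (\<lambda>B. B \<inter> Y) Bs)" by (rule path_dec_map[OF Bs(1)]) auto
  moreover have "X \<inter> Y \<union> {} = Y" using assms by auto
  moreover have "\<forall>B\<in>set (map (\<lambda>B. B \<inter> Y) Bs). alpha_le E B k"
    using Bs(2) by (auto intro: alpha_le_mono[OF _ Int_lower1 order_refl])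
  ultimately show ?thesis unfolding has_pd_def by metis
qed

text \<open>With \<open>T\<close> added to every bag, decompositions of anticomplete pieces can be
  placed in a row: any two pieces overlap in \<open>T\<close> only.\<close>

lemma path_dec_components:
  assumes "finite \<C>" "\<And>C. C \<in> \<C> \<Longrightarrow> has_pd E C k" "alpha_le E T j"
    and "\<And>C C' x y. C \<in> \<C> \<Longrightarrow> C' \<in> \<C> \<Longrightarrow> C \<noteq> C' \<Longrightarrow> x \<in> C \<Longrightarrow> y \<in> C' \<Longrightarrow> x \<noteq> y \<and> (x, y) \<notin> E"
  shows "\<exists>Bs. path_dec E (T \<union> \<Union>\<C>) Bs \<and> (\<forall>B\<in>set Bs. T \<subseteq> B \<and> alpha_le E B (j + k))"
  using assms
proof (induction \<C> rule: finite_induct)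
  case empty
  then show ?case using path_dec_single[of E T] alpha_le_mono[of E T j T "j + k"] by (intro exI[of _ "[T]"]) auto
next
  case (insert C \<C>)
  have "\<exists>Bs. path_dec E (T \<union> \<Union>\<C>) Bs \<and> (\<forall>B\<in>set Bs. T \<subseteq> B \<and> alpha_le E B (j + k))"
  proof (rule insert.IH)
    show "has_pd E D k" if "D \<in> \<C>" for D using insert.prems(1) that by simp
    show "alpha_le E T j" by (rule insert.prems(2))
    show "x \<noteq> y \<and> (x, y) \<notin> E" if "D \<in> \<C>" "D' \<in> \<C>" "D \<noteq> D'" "x \<in> D" "y \<in> D'" for D D' x y
      using insert.prems(3)[of D D' x y] that by simp
  qed
  then obtain Bs where Bs: "path_dec E (T \<union> \<Union>\<C>) Bs" "\<forall>B\<in>set Bs. T \<subseteq> B \<and> alpha_le E B (j + k)"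
    by blast
  obtain Cs where Cs: "path_dec E C Cs" "\<forall>B\<in>set Cs. alpha_le E B k"
    using insert.prems(1)[of C] by (auto simp: has_pd_def)
  define Ds where "Ds = map (\<lambda>B. B \<inter> UNIV \<union> T) Cs"
  have D1: "path_dec E (C \<union> T) Ds" using path_dec_map[OF Cs(1), of _ UNIV T] unfolding Ds_def by simp
  have D2: "\<forall>B\<in>set Ds. T \<subseteq> B \<and> alpha_le E B (j + k)"
    using Cs(2) alpha_le_Un[OF _ insert.prems(2)] unfolding Ds_def by (auto simp: add.commute[of j])
  have ne: "Ds \<noteq> []" "Bs \<noteq> []" using path_decD(1)[OF D1] path_decD(1)[OF Bs(1)] by auto
  have cl: "x \<noteq> y \<and> (x, y) \<notin> E \<and> (y, x) \<notin> E" if xy: "x \<in> C" "y \<in> \<Union>\<C>" for x y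
  proof -
    obtain C' where C': "C' \<in> \<C>" "y \<in> C'" using xy by auto
    then have "C \<noteq> C'" using insert.hyps by auto
    then show ?thesis using insert.prems(3)[of C C' x y] insert.prems(3)[of C' C y x] xy C' by auto
  qed
  have "path_dec E ((C \<union> T) \<union> (T \<union> \<Union>\<C>)) (Ds @ Bs)"
  proof (rule path_dec_append[OF D1 Bs(1)])
    have "(C \<union> T) \<inter> (T \<union> \<Union>\<C>) \<subseteq> T" using cl by blast
    then show "(C \<union> T) \<inter> (T \<union> \<Union>\<C>) \<subseteq> last Ds \<inter> hd Bs"
      using D2 Bs(2) last_in_set[OF ne(1)] hd_in_set[OF ne(2)] by blast
    show "(u, v) \<notin> E \<and> (v, u) \<notin> E"
      if "u \<in> (C \<union> T) - (T \<union> \<Union>\<C>)" "v \<in> (T \<union> \<Union>\<C>) - (C \<union> T)" for u v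
      using that cl by blast
  qed
  moreover have "(C \<union> T) \<union> (T \<union> \<Union>\<C>) = T \<union> \<Union>(insert C \<C>)" by auto
  ultimately show ?case using D2 Bs(2) by (intro exI[of _ "Ds @ Bs"]) auto
qed

section \<open>Connected components of a vertex set\<close>

definition components :: "('a \<times> 'a) set \<Rightarrow> 'a set \<Rightarrow> 'a set set" where
  "components E X = comp_of E X ` X"

lemma Union_components: "\<Union>(components E X) = X"
  using comp_of_subset[of E X] comp_of_self[of _ X E] by (auto simp: components_def)

lemma componentsD:
  assumes "C \<in> components E X"
  shows "C \<subseteq> X" "conn_in E C"
  using assms comp_of_subset[of E X] conn_in_comp_of[of _ X E] by (auto simp: components_def)

lemma component_maximal:
  assumes "C \<in> components E X" "conn_in E S" "S \<subseteq> X" "S \<inter> C \<noteq> {}"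
  shows "S \<subseteq> C"
  using assms comp_of_maximal[of _ X E S] by (auto simp: components_def)

lemma (in ugraph) components_separated:
  assumes "C \<in> components E X" "C' \<in> components E X" "C \<noteq> C'" "x \<in> C" "y \<in> C'"
  shows "x \<noteq> y \<and> (x, y) \<notin> E"
proof -
  obtain a b where ab: "a \<in> X" "C = comp_of E X a" "b \<in> X" "C' = comp_of E X b"
    using assms by (auto simp: components_def)
  have "comp_of E X x = C" "comp_of E X y = C'" using comp_of_eq assms ab by metis+
  moreover have "x \<in> X" "y \<in> X" using componentsD assms by blast+
  ultimately show ?thesis
    using assms comp_of_closed[of x X x y] comp_of_self[of x X E] comp_of_eq[of x X y E] by auto
qed

lemma (in ugraph) component_exit:
  assumes "C \<in> components E X" "conn_in E S" "C \<subseteq> S" "\<not> S \<subseteq> X"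
  obtains y z where "y \<in> C" "z \<in> S" "z \<notin> X" "(y, z) \<in> E"
proof -
  obtain x where x: "x \<in> X" "C = comp_of E X x" using assms(1) by (auto simp: components_def)
  from comp_of_exit[OF x(1) assms(2) assms(3)[unfolded x(2)] assms(4)] that x(2) show ?thesis by metis
qed

section \<open>Rooted trees in graphs without good path-decompositions\<close>

definition forces :: "('a \<times> 'a) set \<Rightarrow> 'b set \<Rightarrow> ('b \<times> 'b) set \<Rightarrow> 'b \<Rightarrow> nat \<Rightarrow> bool" where
  "forces E V F r K \<longleftrightarrow> (\<forall>X x. finite X \<longrightarrow> conn_in E X \<longrightarrow> x \<in> X \<longrightarrow> \<not> has_pd E X K \<longrightarrow>
     (\<exists>H. minor_model E V F H \<and> (\<forall>v\<in>V. H v \<subseteq> X) \<and> x \<in> H r))"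

lemma finite_components: "finite X \<Longrightarrow> finite (components E X)"
  by (simp add: components_def)

text \<open>The good components come first, with \<open>T\<close> in all their bags; the list for
  the exceptional \<open>C0\<close> is appended, glued along \<open>S\<close>. Having
  \<open>T\<close> in the first bag lets the result be glued in turn to a larger decomposition. The
  assumption on \<open>C0\<close> is conditional, so that \<open>C0 = {}\<close> handles the case
  without exception.\<close>

lemma assemble_path_dec:
  assumes fin: "finite \<C>" and T: "alpha_le E T j"
    and pd: "\<And>C. C \<in> \<C> \<Longrightarrow> C \<noteq> C0 \<Longrightarrow> has_pd E C k"
    and sep: "\<And>C C' x y. C \<in> \<C> \<Longrightarrow> C' \<in> \<C> \<Longrightarrow> C \<noteq> C' \<Longrightarrow> x \<in> C \<Longrightarrow> y \<in> C' \<Longrightarrow> x \<noteq> y \<and> (x, y) \<notin> E"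
    and C0: "C0 \<in> \<C> \<Longrightarrow> path_dec E (C0 \<union> S) Cs \<and> S \<subseteq> hd Cs \<and> (\<forall>B\<in>set Cs. alpha_le E B (j + k)) \<and>
      S \<subseteq> T \<and> C0 \<inter> T = {} \<and> (\<forall>x\<in>C0. \<forall>y\<in>T - S. (x, y) \<notin> E \<and> (y, x) \<notin> E)"
  shows "\<exists>Bs. path_dec E (T \<union> \<Union>\<C>) Bs \<and> T \<subseteq> hd Bs \<and> (\<forall>B\<in>set Bs. alpha_le E B (j + k))"
proof -
  have "\<exists>Bs. path_dec E (T \<union> \<Union>(\<C> - {C0})) Bs \<and> (\<forall>B\<in>set Bs. T \<subseteq> B \<and> alpha_le E B (j + k))"
  proof (rule path_dec_components)
    show "finite (\<C> - {C0})" using fin by simp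
    show "alpha_le E T j" by (rule T)
    show "has_pd E C k" if "C \<in> \<C> - {C0}" for C using pd[of C] that by simp
    show "x \<noteq> y \<and> (x, y) \<notin> E"
      if "C \<in> \<C> - {C0}" "C' \<in> \<C> - {C0}" "C \<noteq> C'" "x \<in> C" "y \<in> C'" for C C' x y
      using sep[of C C' x y] that by simp
  qed
  then obtain Bs where Bs: "path_dec E (T \<union> \<Union>(\<C> - {C0})) Bs" "\<forall>B\<in>set Bs. T \<subseteq> B \<and> alpha_le E B (j + k)"
    by blast
  have ne: "Bs \<noteq> []" by (rule path_decD(1)[OF Bs(1)])
  then have hd: "T \<subseteq> hd Bs" "T \<subseteq> last Bs" using Bs(2) by auto
  show ?thesis
  proof (cases "C0 \<in> \<C>")
    case False
    then have "\<C> - {C0} = \<C>" by simp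
    with Bs hd show ?thesis by (intro exI[of _ Bs]) auto
  next
    case True
    note C0 = C0[OF True]
    have sep0: "x \<noteq> y \<and> (x, y) \<notin> E \<and> (y, x) \<notin> E" if "x \<in> C0" "y \<in> \<Union>(\<C> - {C0})" for x y
      using that sep[of C0 _ x y] sep[of _ C0 y x] True by blast
    have "path_dec E ((T \<union> \<Union>(\<C> - {C0})) \<union> (C0 \<union> S)) (Bs @ Cs)"
    proof (rule path_dec_append[OF Bs(1)])
      show "path_dec E (C0 \<union> S) Cs" using C0 by blast
      have "(T \<union> \<Union>(\<C> - {C0})) \<inter> (C0 \<union> S) \<subseteq> S" using C0 sep0 by blast
      then show "(T \<union> \<Union>(\<C> - {C0})) \<inter> (C0 \<union> S) \<subseteq> last Bs \<inter> hd Cs" using C0 hd by blast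
      show "(u, v) \<notin> E \<and> (v, u) \<notin> E"
        if uv: "u \<in> (T \<union> \<Union>(\<C> - {C0})) - (C0 \<union> S)" "v \<in> (C0 \<union> S) - (T \<union> \<Union>(\<C> - {C0}))" for u v
      proof -
        have v: "v \<in> C0" using uv C0 by blast
        consider "u \<in> T - S" | "u \<in> \<Union>(\<C> - {C0})" using uv(1) by blast
        then show ?thesis by cases (use C0 v sep0[of v u] in blast)+
      qed
    qed
    moreover have "(T \<union> \<Union>(\<C> - {C0})) \<union> (C0 \<union> S) = T \<union> \<Union>\<C>" using True C0 by blast
    moreover have "T \<subseteq> hd (Bs @ Cs)" using hd ne by simp
    ultimately show ?thesis using Bs(2) C0 by (intro exI[of _ "Bs @ Cs"]) auto
  qed
qed

section \<open>Models from sets without good path-decompositions\<close>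

context star_bounded begin

text \<open>Putting the neighbours of \<open>l\<close> into every bag costs \<open>t\<close>, so
  some component \<open>C\<close> outside them has no decomposition of width \<open>K\<close>. A
  vertex \<open>z\<close> next to \<open>C\<close> and to \<open>l\<close> is prescribed for the
  root hub of a model in \<open>insert z C\<close>. It is the only neighbour of \<open>l\<close>
  there, so \<open>l\<close> sees the root hub alone.\<close>

lemma forces_prong:
  assumes f: "forces E V F r K" and r: "r \<in> V" and D: "finite D" "conn_in E D" "\<not> has_pd E D (t + K)"
    and l: "l \<in> E `` D"
  shows "\<exists>H. prong E V F r D l H"
proof -
  let ?\<C> = "components E (D - E `` {l})"
  have "\<exists>C\<in>?\<C>. \<not> has_pd E C K"
  proof (rule ccontr)
    assume "\<not> ?thesis"
    then have "\<exists>Bs. path_dec E (D \<inter> E `` {l} \<union> \<Union>?\<C>) Bs \<and> (\<forall>B\<in>set Bs. D \<inter> E `` {l} \<subseteq> B \<and> alpha_le E B (t + K))"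
      using components_separated[of _ "D - E `` {l}"] alpha_le_mono[OF alpha_nbhd Int_lower2 order_refl] D(1)
      by (intro path_dec_components finite_components) auto
    moreover have "D \<inter> E `` {l} \<union> \<Union>?\<C> = D" unfolding Union_components by blast
    ultimately have "has_pd E D (t + K)" unfolding has_pd_def by metis
    with D(3) show False by simp
  qed
  then obtain C where C: "C \<in> ?\<C>" "\<not> has_pd E C K" by blast
  note CD = componentsD[OF C(1)]
  obtain d where d: "d \<in> D" "(d, l) \<in> E" using l by blast
  have "C \<subseteq> D" "\<not> D \<subseteq> D - E `` {l}" using CD(1) d E_sym by blast+
  from component_exit[OF C(1) D(2) this] obtain y z where yz: "y \<in> C" "z \<in> D" "z \<notin> D - E `` {l}" "(y, z) \<in> E"
    by metis
  have X: "conn_in E (insert z C)" using conn_in_insert[OF CD(2) yz(4,1)] .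
  have "finite (insert z C)" using CD(1) D(1) by (meson Diff_subset finite_insert finite_subset)
  moreover have "\<not> has_pd E (insert z C) K" using has_pd_subset[of E "insert z C" K C] C(2) by blast
  ultimately obtain H where H: "minor_model E V F H" "\<forall>v\<in>V. H v \<subseteq> insert z C" "z \<in> H r"
    using f X unfolding forces_def by blast
  have "H v \<subseteq> D \<and> (l \<in> E `` H v \<longleftrightarrow> v = r)" if v: "v \<in> V" for v
  proof -
    have sub: "H v \<subseteq> D" using H(2) v CD(1) yz(2) by blast
    have zl: "(z, l) \<in> E" using yz(2,3) E_sym by blast
    have "l \<notin> E `` H v" if "v \<noteq> r"
    proof -
      have "H v \<inter> H r = {}" using H(1) v r that by (simp add: minor_model_def)
      then have "H v \<subseteq> C" using H(2,3) v by blast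
      then show ?thesis using CD(1) E_sym by blast
    qed
    then show ?thesis using sub zl H(3) by blast
  qed
  then show ?thesis using H(1) unfolding prong_def by blast
qed

text \<open>\<open>Z\<close> is the central hub. If one vertex bordering on \<open>Z\<close> sees
  both \<open>D1\<close> and \<open>D2\<close>, it serves as both landing vertices; otherwise each
  landing vertex sees only its own side. In both cases no landing vertex sees a non-root hub of the
  other model.\<close>

lemma fork:
  assumes t1: "rooted_tree V1 F1 r1" and t2: "rooted_tree V2 F2 r2" and V: "V1 \<inter> V2 = {}"
    and f1: "forces E V1 F1 r1 K1" and f2: "forces E V2 F2 r2 K2" and k: "t + K1 \<le> k" "t + K2 \<le> k"
    and X: "finite X" and Z: "Z \<subseteq> X" "conn_in E Z" "x \<in> Z"
    and D1: "D1 \<subseteq> X" "conn_in E D1" "\<not> has_pd E D1 k" "D1 \<inter> (Z \<union> E `` Z) = {}" "X \<inter> E `` Z \<inter> E `` D1 \<noteq> {}"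
    and D2: "D2 \<subseteq> X" "conn_in E D2" "\<not> has_pd E D2 k" "D2 \<inter> (Z \<union> E `` Z) = {}" "X \<inter> E `` Z \<inter> E `` D2 \<noteq> {}"
    and D12: "D1 \<inter> (D2 \<union> E `` D2) = {}"
  shows "\<exists>H. minor_model E (V1 \<union> V2) (link F1 r1 F2 r2) H \<and>
    (\<forall>v\<in>V1 \<union> V2. H v \<subseteq> X) \<and> x \<in> H r2"
proof -
  obtain la lb where l: "la \<in> X" "la \<in> E `` Z" "la \<in> E `` D1" "lb \<in> X" "lb \<in> E `` Z" "lb \<in> E `` D2"
    and alt: "la = lb \<or> la \<notin> E `` D2 \<and> lb \<notin> E `` D1"
  proof (cases "X \<inter> E `` Z \<inter> E `` D1 \<inter> E `` D2 = {}")
    case True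
    obtain a b where "a \<in> X \<inter> E `` Z \<inter> E `` D1" "b \<in> X \<inter> E `` Z \<inter> E `` D2" using D1(5) D2(5) by blast
    with True show ?thesis by (intro that[of a b]) blast+
  next
    case False
    then obtain a where "a \<in> X \<inter> E `` Z \<inter> E `` D1 \<inter> E `` D2" by blast
    then show ?thesis by (intro that[of a a]) blast+
  qed
  have r: "r1 \<in> V1" "r2 \<in> V2" using rooted_tree_root t1 t2 by metis+
  have "\<not> has_pd E D1 (t + K1)" "\<not> has_pd E D2 (t + K2)" using D1(3) D2(3) k has_pd_mono by metis+
  then obtain Ha Hb where pa: "prong E V1 F1 r1 D1 la Ha" and pb: "prong E V2 F2 r2 D2 lb Hb"
    using forces_prong[OF f1 r(1) _ D1(2) _ l(3)] forces_prong[OF f2 r(2) _ D2(2) _ l(6)]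
      finite_subset[OF D1(1) X] finite_subset[OF D2(1) X] by metis
  note paD = prongD[OF pa] and pbD = prongD[OF pb]
  define H where "H = (\<lambda>v. if v \<in> V1 then Ha v else if v = r2 then insert la (insert lb Z) \<union> Hb r2 else Hb v)"
  have "minor_model E (V1 \<union> V2) (link F1 r1 F2 r2) H" unfolding H_def
  proof (rule join_prongs[OF Z(2) l(2,5) pa pb t1 t2 V])
    show "(D1 \<union> D2) \<inter> (Z \<union> E `` Z) = {}" using D1(4) D2(4) by blast
    show "Ha u \<inter> (Hb v \<union> E `` Hb v) = {}" if "u \<in> V1" "v \<in> V2" for u v
      using D12 paD(2)[OF that(1)] pbD(2)[OF that(2)] by blast
    show "la \<notin> E `` Hb v" if "v \<in> V2" "v \<noteq> r2" for v
      using alt pbD(2,3)[OF that(1)] that(2) by blast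
    show "lb \<notin> E `` Ha v" if "v \<in> V1" "v \<noteq> r1" for v
      using alt paD(2,3)[OF that(1)] that(2) by blast
  qed
  moreover have "\<forall>v\<in>V1 \<union> V2. H v \<subseteq> X"
  proof
    fix v assume v: "v \<in> V1 \<union> V2"
    have "Ha v \<subseteq> X" if "v \<in> V1" using paD(2)[OF that] D1(1) by blast
    moreover have "Hb v \<subseteq> X" if "v \<in> V2" using pbD(2)[OF that] D2(1) by blast
    moreover have "insert la (insert lb Z) \<subseteq> X" using l Z(1) by blast
    ultimately show "H v \<subseteq> X" using v V r by (auto simp: H_def)
  qed
  moreover have "r2 \<notin> V1" using r V by blast
  then have "x \<in> H r2" using Z(3) by (simp add: H_def)
  ultimately show ?thesis by blast
qed

text \<open>The root hub absorbs \<open>Z\<close> together with the landing vertex, and with them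
  the prescribed vertex \<open>x\<close>.\<close>

lemma prong_to_rooted:
  assumes p: "prong E V F r C l H" and r: "r \<in> V"
    and X: "C \<subseteq> X" "Z \<subseteq> X" "l \<in> X" and Z: "conn_in E Z" "x \<in> Z" "l \<in> E `` Z" "C \<inter> (Z \<union> E `` Z) = {}"
  shows "\<exists>H. minor_model E V F H \<and> (\<forall>v\<in>V. H v \<subseteq> X) \<and> x \<in> H r"
proof -
  note pD = prongD[OF p]
  let ?S = "insert l Z"
  define H' where "H' = H(r := ?S \<union> H r)"
  obtain z where z: "z \<in> Z" "(z, l) \<in> E" using Z(3) by blast
  have cS: "conn_in E ?S" using conn_in_insert[OF Z(1) z(2,1)] .
  have "l \<in> E `` H r" using pD(3)[OF r] by simp
  then obtain y where y: "y \<in> H r" "(l, y) \<in> E" using E_sym by blast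
  have "minor_model E V F H'"
  proof (rule minor_model_enlarge[OF pD(1) r])
    show "conn_in E (?S \<union> H r)"
      using pD(1) r cS y by (intro conn_in_touch[of ?S _ l y]) (auto simp: minor_model_def)
    fix v assume v: "v \<in> V" "v \<noteq> r"
    have "H v \<inter> (Z \<union> E `` Z) = {}" using pD(2)[OF v(1)] Z(4) by blast
    moreover have "H v \<inter> E `` {l} = {}" using pD(3)[OF v(1)] v(2) E_sym by blast
    moreover have "l \<notin> H v" using pD(2)[OF v(1)] Z(3,4) by blast
    ultimately show "(?S \<union> E `` ?S) \<inter> H v = {}" by blast
  qed (simp add: H'_def)
  moreover have "\<forall>v\<in>V. H' v \<subseteq> X" using pD(2) X r by (auto simp: H'_def)
  moreover have "x \<in> H' r" using Z(2) by (simp add: H'_def)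
  ultimately show ?thesis by blast
qed

end

section \<open>Removing hitting sets, and the induction on the tree\<close>

context star_bounded begin

text \<open>Vertices hitting the bramble irredundantly can be reached from the hub \<open>Z\<close> while avoiding the
  components \<open>\<R>\<close> that contain no landing vertex.\<close>

lemma hitting_set_reached:
  assumes Z: "Z \<subseteq> X" "conn_in E Z" "x \<in> Z"
    and C: "C \<subseteq> X" "C \<inter> (Z \<union> E `` Z) = {}"
    and \<R>: "\<R> \<subseteq> components E (C - Y)" "\<And>R. R \<in> \<R> \<Longrightarrow> E `` R \<inter> (X \<inter> E `` Z) = {}"
    and D: "D \<subseteq> C" "conn_in E D" "E `` D \<inter> (X \<inter> E `` Z) \<noteq> {}" "D \<inter> Y = {y}"
  shows "y \<in> E `` comp_of E (X - (\<Union>\<R> \<union> E `` \<Union>\<R>)) x"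
proof -
  define N where "N = \<Union>\<R> \<union> E `` \<Union>\<R>"
  define Zs where "Zs = comp_of E (X - N) x"
  have UC: "\<Union>\<R> \<subseteq> C - Y" using \<R>(1) componentsD(1)[of _ E "C - Y"] by blast
  have "Z \<inter> N = {}" using UC C(2) E_sym unfolding N_def by blast
  then have xN: "x \<in> X - N" using Z by blast
  have ZZs: "Z \<subseteq> Zs" unfolding Zs_def
    using comp_of_maximal[OF xN Z(2) _ Z(3) comp_of_self[OF xN]] Z(1) \<open>Z \<inter> N = {}\<close> by blast
  obtain d w where d: "d \<in> D" "(d, w) \<in> E" and w: "w \<in> X" "w \<in> E `` Z" using D(3) by blast
  obtain z where z: "z \<in> Z" "(z, w) \<in> E" using w(2) by blast
  have "w \<notin> \<Union>\<R>" using UC C(2) w(2) by blast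
  moreover have "w \<notin> E `` \<Union>\<R>"
  proof
    assume "w \<in> E `` \<Union>\<R>"
    then obtain R where "R \<in> \<R>" "w \<in> E `` R" by blast
    with \<R>(2)[of R] w show False by blast
  qed
  ultimately have wN: "w \<in> X - N" using w(1) unfolding N_def by blast
  have wZs: "w \<in> Zs" unfolding Zs_def
    by (rule comp_of_closed[OF xN _ z(2) wN]) (use ZZs z(1) in \<open>auto simp: Zs_def\<close>)
  show ?thesis
  proof (cases "d = y")
    case True
    then have "y \<in> E `` Zs" using wZs d(2) E_sym by blast
    then show ?thesis unfolding Zs_def N_def .
  next
    case False
    then have dD: "d \<in> D - {y}" using d(1) by blast
    \<comment> \<open>Inside \<open>D\<close>, the component of \<open>d\<close> without
      \<open>y\<close> leads from the landing vertex \<open>w\<close> to a neighbour of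
      \<open>y\<close>. It lies in \<open>C - Y\<close>, because \<open>y\<close> is the only vertex
      of \<open>Y\<close> in \<open>D\<close>.\<close>
    define A where "A = comp_of E (D - {y}) d"
    have "A \<subseteq> D" "\<not> D \<subseteq> D - {y}" using D(4) comp_of_subset[of E "D - {y}" d] unfolding A_def by blast+
    then obtain a u where au: "a \<in> A" "u \<in> D" "u \<notin> D - {y}" "(a, u) \<in> E"
      using comp_of_exit[OF dD D(2)] unfolding A_def by metis
    then have ay: "(a, y) \<in> E" by blast
    have cA: "conn_in E A" "d \<in> A" unfolding A_def by (rule conn_in_comp_of[OF dD], rule comp_of_self[OF dD])
    have AC: "A \<subseteq> C - Y" using comp_of_subset[of E "D - {y}" d] D(1,4) unfolding A_def by blast
    \<comment> \<open>If \<open>A\<close> met a member of \<open>\<R>\<close>, it would lie inside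
      it, and that member would see the landing vertex \<open>w\<close>.\<close>
    have no: "A \<inter> R = {}" if R: "R \<in> \<R>" for R
    proof (rule ccontr)
      assume "A \<inter> R \<noteq> {}"
      then have "A \<subseteq> R" using component_maximal[of R E "C - Y" A] \<R>(1) R cA(1) AC by blast
      then have "w \<in> E `` R" using cA(2) d(2) by blast
      then show False using \<R>(2)[OF R] w by blast
    qed
    have "A \<inter> E `` R = {}" if R: "R \<in> \<R>" for R
    proof (rule ccontr)
      assume "A \<inter> E `` R \<noteq> {}"
      then obtain b c where bc: "b \<in> A" "c \<in> R" "(c, b) \<in> E" by blast
      have Rc: "R \<in> components E (C - Y)" using R \<R>(1) by blast
      have "conn_in E (insert b R)" using conn_in_insert[OF componentsD(2)[OF Rc] bc(3,2)] .
      moreover have "insert b R \<subseteq> C - Y" using componentsD(1)[OF Rc] bc(1) AC by blast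
      ultimately have "b \<in> R" using component_maximal[OF Rc] bc(2) by blast
      then show False using no[OF R] bc(1) by blast
    qed
    then have AN: "A \<inter> N = {}" using no unfolding N_def by blast
    have "conn_in E (insert w A)" using conn_in_insert[OF cA(1) d(2) cA(2)] .
    moreover have "insert w A \<subseteq> X - N" using wN AC AN C(1) by blast
    ultimately have "insert w A \<subseteq> Zs"
      using comp_of_maximal[OF xN, of E "insert w A" w] wZs unfolding Zs_def by simp
    then have "y \<in> E `` Zs" using au(1) ay by blast
    then show ?thesis unfolding Zs_def N_def .
  qed
qed

text \<open>Induction on the size of the side \<open>C\<close>. The hub \<open>Z\<close> is replaced
  at each level, but it always contains \<open>x\<close>, the vertex that the excluded model would
  have in its root hub. Edges leaving \<open>C\<close> end in the neighbourhood of \<open>Z\<close>;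
  the boundary \<open>S\<close> must fill into the first bag to allow gluing.\<close>

lemma side_path_dec:
  assumes t1: "rooted_tree V1 F1 r1" and t2: "rooted_tree V2 F2 r2" and V: "V1 \<inter> V2 = {}"
    and f1: "forces E V1 F1 r1 K1" and f2: "forces E V2 F2 r2 K2" and k: "t + K1 \<le> k" "t + K2 \<le> k"
    and g: "\<forall>C L \<D>. linked_bramble E C L \<D> \<longrightarrow> unhit E \<D> s \<longrightarrow>
      (\<exists>l\<in>L. \<exists>H. prong E (V1 \<union> V2) (link F1 r1 F2 r2) r2 C l H)"
    and X: "finite X"
    and no: "\<nexists>H. minor_model E (V1 \<union> V2) (link F1 r1 F2 r2) H \<and>
      (\<forall>v\<in>V1 \<union> V2. H v \<subseteq> X) \<and> x \<in> H r2"
    and conn: "conn_in E X"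
    and Z: "Z \<subseteq> X" "conn_in E Z" "x \<in> Z"
    and C: "C \<subseteq> X" "conn_in E C" "C \<inter> (Z \<union> E `` Z) = {}" "X \<inter> E `` C \<subseteq> C \<union> E `` Z"
    and S: "S = X \<inter> E `` C - C" "alpha_le E S s"
  shows "\<exists>Bs. path_dec E (C \<union> S) Bs \<and> S \<subseteq> hd Bs \<and> (\<forall>B\<in>set Bs. alpha_le E B (2 * s + k))"
  using Z C S
proof (induction "card C" arbitrary: Z C S rule: less_induct)
  case less
  note Z = less.prems(1-3) and C = less.prems(4-7) and S = less.prems(8,9)
  note fork = fork[OF t1 t2 V f1 f2 k X]
  define L where "L = X \<inter> E `` Z"
  have finC: "finite C" using C(1) X finite_subset by blast
  have LC: "L \<inter> C = {}" using C(3) unfolding L_def by blast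
  show ?case
  proof (cases "has_pd E C k")
    case True
    have "\<exists>Bs. path_dec E (S \<union> \<Union>{C}) Bs \<and> (\<forall>B\<in>set Bs. S \<subseteq> B \<and> alpha_le E B (s + k))"
      by (rule path_dec_components) (use True S(2) in auto)
    then obtain Bs where Bs: "path_dec E (S \<union> C) Bs" "\<forall>B\<in>set Bs. S \<subseteq> B \<and> alpha_le E B (s + k)" by auto
    have "S \<subseteq> hd Bs" using Bs(2) path_decD(1)[OF Bs(1)] by simp
    moreover have "\<forall>B\<in>set Bs. alpha_le E B (2 * s + k)"
      using Bs(2) alpha_le_mono[OF _ order_refl, of E _ "s + k" "2 * s + k"] by simp
    ultimately show ?thesis using Bs(1) by (intro exI[of _ Bs]) (simp add: Un_commute)
  next
    case False
    \<comment> \<open>The rich subsets of \<open>C\<close> within reach of \<open>Z\<close>. Two of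
      them that do not touch would yield the excluded model by \<open>fork\<close>, and an order
      above \<open>s\<close> would yield it by a prong.\<close>
    define \<D> where "\<D> = {D. D \<subseteq> C \<and> conn_in E D \<and> \<not> has_pd E D k \<and> E `` D \<inter> L \<noteq> {}}"
    have "linked_bramble E C L \<D>" unfolding linked_bramble_def
    proof (intro conjI ballI)
      fix D D' assume D: "D \<in> \<D>" "D' \<in> \<D>"
      show "conn_in E (D \<union> D')"
      proof (rule ccontr)
        assume nc: "\<not> conn_in E (D \<union> D')"
        have c: "conn_in E D" "conn_in E D'" using D by (auto simp: \<D>_def)
        have "D \<inter> D' = {}" using conn_in_Un[OF c] nc by blast
        moreover have "D \<inter> E `` D' = {}" using conn_in_touch[OF c] nc E_sym by blast
        ultimately have "D \<inter> (D' \<union> E `` D') = {}" by blast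
        moreover have "D \<subseteq> X" "D' \<subseteq> X" "D \<inter> (Z \<union> E `` Z) = {}" "D' \<inter> (Z \<union> E `` Z) = {}"
          using D C(1,3) by (auto simp: \<D>_def)
        moreover have "X \<inter> E `` Z \<inter> E `` D \<noteq> {}" "X \<inter> E `` Z \<inter> E `` D' \<noteq> {}"
          using D by (auto simp: \<D>_def L_def)
        ultimately obtain H where "minor_model E (V1 \<union> V2) (link F1 r1 F2 r2) H"
          "\<forall>v\<in>V1 \<union> V2. H v \<subseteq> X" "x \<in> H r2"
          using fork[OF Z, of D D'] D by (auto simp: \<D>_def)
        then show False using no by blast
      qed
    qed (use finC LC in \<open>auto simp: \<D>_def\<close>)
    moreover have "\<not> (\<exists>l\<in>L. \<exists>H. prong E (V1 \<union> V2) (link F1 r1 F2 r2) r2 C l H)"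
    proof
      assume "\<exists>l\<in>L. \<exists>H. prong E (V1 \<union> V2) (link F1 r1 F2 r2) r2 C l H"
      then obtain l H where l: "l \<in> L" and p: "prong E (V1 \<union> V2) (link F1 r1 F2 r2) r2 C l H"
        by blast
      have "r2 \<in> V1 \<union> V2" "l \<in> X" "l \<in> E `` Z" using l rooted_tree_root[OF t2] by (auto simp: L_def)
      from prong_to_rooted[OF p this(1) C(1) Z(1) this(2) Z(2,3) this(3) C(3)] no show False by blast
    qed
    ultimately have "\<not> unhit E \<D> s" using g by blast
    then obtain Y0 where Y0: "alpha_le E Y0 s" "\<And>D. D \<in> \<D> \<Longrightarrow> D \<inter> Y0 \<noteq> {}" by (erule not_unhitE)
    \<comment> \<open>A hitting set of least cardinality inside \<open>C\<close>: minimality gives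
      each of its vertices a private member of the bramble, meeting \<open>Y\<close> in that vertex
      only.\<close>
    define P where "P Y \<longleftrightarrow> Y \<subseteq> C \<and> alpha_le E Y s \<and> (\<forall>D\<in>\<D>. D \<inter> Y \<noteq> {})" for Y
    have "P (Y0 \<inter> C)" unfolding P_def
    proof (intro conjI ballI)
      show "alpha_le E (Y0 \<inter> C) s" by (rule alpha_le_mono[OF Y0(1)]) auto
      fix D assume D: "D \<in> \<D>"
      then have "D \<subseteq> C" by (simp add: \<D>_def)
      with Y0(2)[OF D] show "D \<inter> (Y0 \<inter> C) \<noteq> {}" by blast
    qed simp
    then obtain Y where PY: "P Y" and minY: "\<And>Y'. P Y' \<Longrightarrow> card Y \<le> card Y'"
      using ex_has_least_nat[of P "Y0 \<inter> C" card] by blast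
    have Y: "Y \<subseteq> C" "alpha_le E Y s" "\<And>D. D \<in> \<D> \<Longrightarrow> D \<inter> Y \<noteq> {}" using PY by (auto simp: P_def)
    have finY: "finite Y" using Y(1) finC finite_subset by blast
    have priv: "\<exists>D\<in>\<D>. D \<inter> Y = {y}" if y: "y \<in> Y" for y
    proof -
      have "card (Y - {y}) < card Y" using finY y by (rule card_Diff1_less)
      then have "\<not> P (Y - {y})" using minY by fastforce
      moreover have "alpha_le E (Y - {y}) s" by (rule alpha_le_mono[OF Y(2)]) auto
      ultimately obtain D where "D \<in> \<D>" "D \<inter> (Y - {y}) = {}" using Y(1) unfolding P_def by blast
      with Y(3)[of D] show ?thesis by blast
    qed
    \<comment> \<open>\<open>X\<close> is connected and \<open>x\<close> lies outside
      \<open>C\<close>, so \<open>C\<close> has a landing vertex and is itself a member of the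
      bramble. Hence \<open>Y\<close> is nonempty, which makes the recursion strictly
      smaller.\<close>
    have "E `` C \<inter> L \<noteq> {}"
    proof -
      obtain c where c: "c \<in> C" using conn_in_nonempty[OF C(2)] by blast
      have "x \<in> X" "x \<notin> C" "c \<in> X" using Z(1,3) C(1,3) c by blast+
      then obtain a b where ab: "a \<in> X" "a \<in> C" "b \<in> X" "b \<notin> C" "(a, b) \<in> E"
        using conn_in_cut'[OF conn, of c C x] c by metis
      then have "b \<in> E `` Z" using C(4) by blast
      then show ?thesis using ab unfolding L_def by blast
    qed
    then have "C \<in> \<D>" using C(2) False unfolding \<D>_def by blast
    then have "Y \<noteq> {}" using Y(3) by blast
    define \<C> where "\<C> = components E (C - Y)"
    \<comment> \<open>A rich component attached to \<open>L\<close> would be a member of the bramble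
      missed by \<open>Y\<close>.\<close>
    have rich: "E `` R \<inter> L = {}" if R: "R \<in> \<C>" "\<not> has_pd E R k" for R
    proof (rule ccontr)
      assume "E `` R \<inter> L \<noteq> {}"
      then have "R \<in> \<D>" using R componentsD[of R E "C - Y"] unfolding \<C>_def \<D>_def by blast
      then show False using Y(3)[of R] componentsD(1)[of R E "C - Y"] R(1) unfolding \<C>_def by blast
    qed
    have exitY: "Y \<inter> E `` R \<noteq> {}" if R: "R \<in> \<C>" for R
    proof -
      have "R \<subseteq> C" "\<not> C \<subseteq> C - Y" using R componentsD(1)[of R E "C - Y"] Y(1) \<open>Y \<noteq> {}\<close> unfolding \<C>_def by blast+
      from component_exit[OF R[unfolded \<C>_def] C(2) this] obtain a b
        where "a \<in> R" "b \<in> C" "b \<notin> C - Y" "(a, b) \<in> E" by metis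
      then show ?thesis by blast
    qed
    \<comment> \<open>The hub is regrown from \<open>x\<close> outside the given rich components and
      their neighbours. Vertices of \<open>Y\<close> next to such a component are excluded from the
      hub but border on it, so they can serve as landing vertices towards the component.\<close>
    have reach: "Y \<subseteq> E `` comp_of E (X - (\<Union>\<R> \<union> E `` \<Union>\<R>)) x"
      if \<R>: "\<R> \<subseteq> \<C>" "\<And>R. R \<in> \<R> \<Longrightarrow> \<not> has_pd E R k" for \<R>
    proof
      fix y assume "y \<in> Y"
      then obtain D where D: "D \<in> \<D>" "D \<inter> Y = {y}" using priv by blast
      show "y \<in> E `` comp_of E (X - (\<Union>\<R> \<union> E `` \<Union>\<R>)) x"
      proof (rule hitting_set_reached[OF Z C(1,3)])
        show "\<R> \<subseteq> components E (C - Y)" using \<R>(1) unfolding \<C>_def .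
        show "E `` R \<inter> (X \<inter> E `` Z) = {}" if "R \<in> \<R>" for R
          using rich[of R] \<R> that unfolding L_def by blast
        show "D \<subseteq> C" "conn_in E D" "E `` D \<inter> (X \<inter> E `` Z) \<noteq> {}" "D \<inter> Y = {y}"
          using D unfolding \<D>_def L_def by blast+
      qed
    qed
    have hub: "comp_of E (X - (\<Union>\<R> \<union> E `` \<Union>\<R>)) x \<subseteq> X \<and> conn_in E (comp_of E (X - (\<Union>\<R> \<union> E `` \<Union>\<R>)) x) \<and>
      x \<in> comp_of E (X - (\<Union>\<R> \<union> E `` \<Union>\<R>)) x \<and>
      R \<inter> (comp_of E (X - (\<Union>\<R> \<union> E `` \<Union>\<R>)) x \<union> E `` comp_of E (X - (\<Union>\<R> \<union> E `` \<Union>\<R>)) x) = {}"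
      if \<R>: "\<R> \<subseteq> \<C>" and R: "R \<in> \<R>" for \<R> R
    proof -
      have "\<Union>\<R> \<subseteq> C" using \<R> componentsD(1)[of _ E "C - Y"] unfolding \<C>_def by blast
      then have "x \<in> X - (\<Union>\<R> \<union> E `` \<Union>\<R>)" using Z C(3) E_sym by blast
      note xs = comp_of_self[OF this] conn_in_comp_of[OF this, of E]
      have sub: "comp_of E (X - (\<Union>\<R> \<union> E `` \<Union>\<R>)) x \<subseteq> X - (\<Union>\<R> \<union> E `` \<Union>\<R>)" by (rule comp_of_subset)
      then have "R \<inter> (comp_of E (X - (\<Union>\<R> \<union> E `` \<Union>\<R>)) x \<union> E `` comp_of E (X - (\<Union>\<R> \<union> E `` \<Union>\<R>)) x) = {}"
        using R E_sym by blast
      with sub xs show ?thesis by blast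
    qed
    have RX: "R \<subseteq> X" "conn_in E R" if "R \<in> \<C>" for R
      using componentsD[of R E "C - Y"] that C(1) unfolding \<C>_def by blast+
    \<comment> \<open>Two rich components both border on \<open>Y\<close>, hence on the
      neighbourhood of the hub regrown for this pair, and \<open>fork\<close> applies with that
      hub.\<close>
    have unique: "R = R'" if R: "R \<in> \<C>" "\<not> has_pd E R k" and R': "R' \<in> \<C>" "\<not> has_pd E R' k" for R R'
    proof (rule ccontr)
      assume ne: "R \<noteq> R'"
      let ?\<R> = "{R, R'}"
      let ?Z = "comp_of E (X - (\<Union>?\<R> \<union> E `` \<Union>?\<R>)) x"
      have sub: "?\<R> \<subseteq> \<C>" using R R' by blast
      have YZ: "Y \<subseteq> X \<inter> E `` ?Z" using reach[OF sub] R R' Y(1) C(1) by blast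
      have sepR: "R \<inter> (R' \<union> E `` R') = {}"
        using components_separated[of R' "C - Y" R] components_separated[of R "C - Y" R'] ne R(1) R'(1)
        unfolding \<C>_def by blast
      have touch: "X \<inter> E `` ?Z \<inter> E `` R \<noteq> {}" "X \<inter> E `` ?Z \<inter> E `` R' \<noteq> {}"
        using exitY[OF R(1)] exitY[OF R'(1)] YZ by blast+
      have inR: "R \<in> ?\<R>" "R' \<in> ?\<R>" by simp_all
      note h = hub[OF sub inR(1)] and h' = hub[OF sub inR(2)]
      have "\<exists>H. minor_model E (V1 \<union> V2) (link F1 r1 F2 r2) H \<and>
        (\<forall>v\<in>V1 \<union> V2. H v \<subseteq> X) \<and> x \<in> H r2"
        by (rule fork[OF h[THEN conjunct1] h[THEN conjunct2, THEN conjunct1]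
              h[THEN conjunct2, THEN conjunct2, THEN conjunct1]
              RX[OF R(1)] R(2) h[THEN conjunct2, THEN conjunct2, THEN conjunct2] touch(1)
              RX[OF R'(1)] R'(2) h'[THEN conjunct2, THEN conjunct2, THEN conjunct2] touch(2) sepR])
      then show False using no by blast
    qed
    have CS: "C \<union> S = (S \<union> Y) \<union> \<Union>\<C>" using Y(1) unfolding \<C>_def Union_components by blast
    have alphaT: "alpha_le E (S \<union> Y) (2 * s)"
      using alpha_le_Un[OF S(2) Y(2)] by (simp add: mult_2)
    have sep: "u \<noteq> v \<and> (u, v) \<notin> E" if "A \<in> \<C>" "B \<in> \<C>" "A \<noteq> B" "u \<in> A" "v \<in> B" for A B u v
      using components_separated[of A "C - Y" B u v] that unfolding \<C>_def by blast
    have fin\<C>: "finite \<C>" unfolding \<C>_def using finC by (simp add: finite_components)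
    have "\<exists>Bs. path_dec E ((S \<union> Y) \<union> \<Union>\<C>) Bs \<and> S \<union> Y \<subseteq> hd Bs \<and> (\<forall>B\<in>set Bs. alpha_le E B (2 * s + k))"
    proof (cases "\<exists>R\<in>\<C>. \<not> has_pd E R k")
      case False
      \<comment> \<open>Without a rich component the exceptional piece is taken to be
        \<open>{}\<close>, which is never a component.\<close>
      have "{} \<notin> \<C>" using RX(2) by fastforce
      show ?thesis
        by (rule assemble_path_dec[OF fin\<C> alphaT _ sep, of "{}"]) (use False \<open>{} \<notin> \<C>\<close> in blast)+
    next
      case True
      then obtain R where R: "R \<in> \<C>" "\<not> has_pd E R k" by blast
      let ?Z = "comp_of E (X - (\<Union>{R} \<union> E `` \<Union>{R})) x"
      have sub: "{R} \<subseteq> \<C>" using R by blast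
      have YZ: "Y \<subseteq> E `` ?Z" using reach[OF sub] R by blast
      have RC: "R \<subseteq> C - Y" using componentsD(1)[of R E "C - Y"] R(1) unfolding \<C>_def by blast
      \<comment> \<open>An edge from \<open>R\<close> that leaves \<open>C\<close> would end in
        \<open>L\<close>, contrary to \<open>rich\<close>; so \<open>R\<close> can be left only
        through \<open>Y\<close>.\<close>
      have nbr: "X \<inter> E `` R \<subseteq> R \<union> Y"
      proof
        fix z assume z: "z \<in> X \<inter> E `` R"
        then obtain c where c: "c \<in> R" "(c, z) \<in> E" by blast
        have "z \<in> C"
        proof (rule ccontr)
          assume "z \<notin> C"
          then have "z \<in> E `` Z" using C(4) z c RC by blast
          then show False using rich[OF R] z unfolding L_def by blast
        qed
        show "z \<in> R \<union> Y"
        proof (rule ccontr)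
          assume "z \<notin> R \<union> Y"
          moreover have "conn_in E (insert z R)" using conn_in_insert[OF RX(2)[OF R(1)] c(2,1)] .
          ultimately show False
            using component_maximal[of R E "C - Y" "insert z R"] R(1) RC \<open>z \<in> C\<close> c(1) unfolding \<C>_def by blast
        qed
      qed
      \<comment> \<open>The new boundary lies in \<open>Y\<close> and inherits nothing from
        \<open>S\<close>, so the next level again starts with independence number at most
        \<open>s\<close>.\<close>
      define S' where "S' = X \<inter> E `` R - R"
      have S'Y: "S' \<subseteq> Y" using nbr unfolding S'_def by blast
      have "card R < card C" using RC Y(1) \<open>Y \<noteq> {}\<close> finC by (intro psubset_card_mono) blast+
      then have "\<exists>Bs. path_dec E (R \<union> S') Bs \<and> S' \<subseteq> hd Bs \<and> (\<forall>B\<in>set Bs. alpha_le E B (2 * s + k))"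
      proof (rule less.hyps)
        show "?Z \<subseteq> X" "conn_in E ?Z" "x \<in> ?Z" "R \<inter> (?Z \<union> E `` ?Z) = {}" using hub[OF sub, of R] by blast+
        show "R \<subseteq> X" "conn_in E R" using RX R by blast+
        show "X \<inter> E `` R \<subseteq> R \<union> E `` ?Z" using nbr YZ by blast
        show "S' = X \<inter> E `` R - R" by (rule S'_def)
        show "alpha_le E S' s" by (rule alpha_le_mono[OF Y(2) S'Y order_refl])
      qed
      then obtain Cs where Cs: "path_dec E (R \<union> S') Cs" "S' \<subseteq> hd Cs" "\<forall>B\<in>set Cs. alpha_le E B (2 * s + k)"
        by blast
      show ?thesis
      proof (rule assemble_path_dec[where ?C0.0 = R and S = S' and Cs = Cs and k = k, OF fin\<C> alphaT _ sep])
        show "has_pd E A k" if "A \<in> \<C>" "A \<noteq> R" for A using unique[OF that(1) _ R] that(2) by blast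
        have RT: "R \<inter> (S \<union> Y) = {}" using RC S(1) by blast
        have "\<forall>a\<in>R. \<forall>b\<in>(S \<union> Y) - S'. (a, b) \<notin> E \<and> (b, a) \<notin> E"
        proof (intro ballI)
          fix a b assume ab: "a \<in> R" "b \<in> (S \<union> Y) - S'"
          then have "b \<in> X" "b \<notin> R" using S(1) Y(1) C(1) RT by blast+
          then have "(a, b) \<notin> E" using ab unfolding S'_def by blast
          then show "(a, b) \<notin> E \<and> (b, a) \<notin> E" using E_sym by blast
        qed
        then show "path_dec E (R \<union> S') Cs \<and> S' \<subseteq> hd Cs \<and> (\<forall>B\<in>set Cs. alpha_le E B (2 * s + k)) \<and>
          S' \<subseteq> S \<union> Y \<and> R \<inter> (S \<union> Y) = {} \<and> (\<forall>a\<in>R. \<forall>b\<in>S \<union> Y - S'. (a, b) \<notin> E \<and> (b, a) \<notin> E)"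
          using Cs S'Y RT by blast
      qed
    qed
    then show ?thesis unfolding CS by blast
  qed
qed

lemma forces_single: "forces E {r} {} r 0"
  unfolding forces_def
proof (intro allI impI)
  fix X x assume "conn_in E X" "x \<in> X"
  then show "\<exists>H. minor_model E {r} {} H \<and> (\<forall>v\<in>{r}. H v \<subseteq> X) \<and> x \<in> H r"
    by (intro exI[of _ "\<lambda>_. X"]) (simp add: minor_model_def)
qed

text \<open>The side decomposition starts from the hub \<open>{x}\<close>, with the closed
  neighbourhood of \<open>x\<close> as separator. In the maximum, \<open>f 0\<close> is an order at
  which a bramble yields a model, with leftover order 0 sufficing, and \<open>Suc t\<close> pays for
  the separator. The summand \<open>t\<close> next to \<open>K1\<close> and \<open>K2\<close> is
  what \<open>forces_prong\<close> loses.\<close>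

lemma forces_join:
  assumes t1: "rooted_tree V1 F1 r1" and t2: "rooted_tree V2 F2 r2" and V: "V1 \<inter> V2 = {}"
    and f1: "forces E V1 F1 r1 K1" and f2: "forces E V2 F2 r2 K2"
    and gr: "grabs E (V1 \<union> V2) (link F1 r1 F2 r2) r2 f"
  shows "forces E (V1 \<union> V2) (link F1 r1 F2 r2) r2
    (2 * max (f 0) (Suc t) + max (t + K1) (t + K2))"
proof -
  let ?V = "V1 \<union> V2" and ?F = "link F1 r1 F2 r2"
  note s0 = gr[unfolded grabs_def, THEN spec, of 0]
  define s where "s = max (f 0) (Suc t)"
  define k where "k = max (t + K1) (t + K2)"
  have k: "t + K1 \<le> k" "t + K2 \<le> k" by (auto simp: k_def)
  have g: "\<forall>C L \<D>. linked_bramble E C L \<D> \<longrightarrow> unhit E \<D> s \<longrightarrow> (\<exists>l\<in>L. \<exists>H. prong E ?V ?F r2 C l H)"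
  proof (intro allI impI)
    fix C L \<D> assume lb: "linked_bramble E C L \<D>" and un: "unhit E \<D> s"
    have "unhit E \<D> (f 0)" unfolding unhit_def
    proof (intro allI impI)
      fix Y assume "alpha_le E Y (f 0)"
      then have "alpha_le E Y s" by (rule alpha_le_mono) (auto simp: s_def)
      with un show "\<exists>D\<in>\<D>. D \<inter> Y = {}" by (rule unhitD)
    qed
    from s0[rule_format, OF lb this] show "\<exists>l\<in>L. \<exists>H. prong E ?V ?F r2 C l H" by (elim bexE exE conjE) blast
  qed
  have "forces E ?V ?F r2 (2 * s + k)" unfolding forces_def
  proof (intro allI impI, rule ccontr)
    fix X x assume X: "finite X" and conn: "conn_in E X" and x: "x \<in> X" and bad: "\<not> has_pd E X (2 * s + k)"
      and no: "\<nexists>H. minor_model E ?V ?F H \<and> (\<forall>v\<in>?V. H v \<subseteq> X) \<and> x \<in> H r2"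
    define T where "T = X \<inter> insert x (E `` {x})"
    define \<C> where "\<C> = components E (X - T)"
    have Z: "{x} \<subseteq> X" "conn_in E {x}" "x \<in> {x}" using x by simp_all
    have RX: "R \<subseteq> X" "conn_in E R" "R \<inter> ({x} \<union> E `` {x}) = {}" if "R \<in> \<C>" for R
      using componentsD[of R E "X - T"] that unfolding \<C>_def T_def by blast+
    have exit: "X \<inter> E `` {x} \<inter> E `` R \<noteq> {}" if R: "R \<in> \<C>" for R
    proof -
      have "\<not> X \<subseteq> X - T" using x unfolding T_def by blast
      from component_exit[OF R[unfolded \<C>_def] conn RX(1)[OF R] this] obtain a b
        where ab: "a \<in> R" "b \<in> X" "b \<notin> X - T" "(a, b) \<in> E" by metis
      have "b \<noteq> x" using RX(3)[OF R] ab(1,4) E_sym by blast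
      then show ?thesis using ab unfolding T_def by blast
    qed
    have sep: "u \<noteq> v \<and> (u, v) \<notin> E" if "A \<in> \<C>" "B \<in> \<C>" "A \<noteq> B" "u \<in> A" "v \<in> B" for A B u v
      using components_separated[of A "X - T" B u v] that unfolding \<C>_def by blast
    have unique: "R = R'" if R: "R \<in> \<C>" "\<not> has_pd E R k" and R': "R' \<in> \<C>" "\<not> has_pd E R' k" for R R'
    proof (rule ccontr)
      assume ne: "R \<noteq> R'"
      have "R \<inter> (R' \<union> E `` R') = {}" using sep[OF R(1) R'(1) ne] sep[OF R'(1) R(1)] ne by blast
      from fork[OF t1 t2 V f1 f2 k X Z RX(1,2)[OF R(1)] R(2) RX(3)[OF R(1)] exit[OF R(1)]
          RX(1,2)[OF R'(1)] R'(2) RX(3)[OF R'(1)] exit[OF R'(1)] this] no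
      show False by blast
    qed
    have "alpha_le E T (Suc t)" by (rule alpha_le_mono[OF alpha_closed_nbhd[of x]]) (auto simp: T_def)
    then have alphaT: "alpha_le E T (2 * s)" by (rule alpha_le_mono) (simp_all add: s_def mult_2 max_def)
    have fin\<C>: "finite \<C>" unfolding \<C>_def using X by (simp add: finite_components)
    have "\<exists>Bs. path_dec E (T \<union> \<Union>\<C>) Bs \<and> T \<subseteq> hd Bs \<and> (\<forall>B\<in>set Bs. alpha_le E B (2 * s + k))"
    proof (cases "\<exists>R\<in>\<C>. \<not> has_pd E R k")
      case False
      have "{} \<notin> \<C>" using RX(2) by fastforce
      show ?thesis
        by (rule assemble_path_dec[OF fin\<C> alphaT _ sep, of "{}"]) (use False \<open>{} \<notin> \<C>\<close> in blast)+
    next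
      case True
      then obtain R where R: "R \<in> \<C>" "\<not> has_pd E R k" by blast
      define S where "S = X \<inter> E `` R - R"
      have nbr: "X \<inter> E `` R \<subseteq> R \<union> E `` {x}"
      proof
        fix z assume z: "z \<in> X \<inter> E `` R"
        then obtain c where c: "c \<in> R" "(c, z) \<in> E" by blast
        show "z \<in> R \<union> E `` {x}"
        proof (rule ccontr)
          assume nz: "z \<notin> R \<union> E `` {x}"
          have "z \<noteq> x" using RX(3)[OF R(1)] c E_sym by blast
          then have "insert z R \<subseteq> X - T" using nz z componentsD(1)[of R E "X - T"] R(1) unfolding \<C>_def T_def by blast
          moreover have "conn_in E (insert z R)" using conn_in_insert[OF RX(2)[OF R(1)] c(2,1)] .
          ultimately show False
            using component_maximal[of R E "X - T" "insert z R"] R(1) c(1) nz unfolding \<C>_def by blast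
        qed
      qed
      have "S \<subseteq> E `` {x}" using nbr unfolding S_def by blast
      then have "alpha_le E S t" by (rule alpha_le_mono[OF alpha_nbhd _ order_refl])
      then have "alpha_le E S s" by (rule alpha_le_mono) (auto simp: s_def)
      from side_path_dec[OF t1 t2 V f1 f2 k g X no conn Z RX[OF R(1)] nbr S_def this]
      obtain Cs where Cs: "path_dec E (R \<union> S) Cs" "S \<subseteq> hd Cs" "\<forall>B\<in>set Cs. alpha_le E B (2 * s + k)"
        by blast
      show ?thesis
      proof (rule assemble_path_dec[where ?C0.0 = R and S = S and Cs = Cs and k = k, OF fin\<C> alphaT _ sep])
        show "has_pd E A k" if "A \<in> \<C>" "A \<noteq> R" for A using unique[OF that(1) _ R] that(2) by blast
        have RT: "R \<inter> T = {}" using componentsD(1)[of R E "X - T"] R(1) unfolding \<C>_def by blast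
        have "S \<subseteq> T" using \<open>S \<subseteq> E `` {x}\<close> unfolding S_def T_def by blast
        moreover have "\<forall>a\<in>R. \<forall>b\<in>T - S. (a, b) \<notin> E \<and> (b, a) \<notin> E"
        proof (intro ballI)
          fix a b assume ab: "a \<in> R" "b \<in> T - S"
          then have "b \<in> X" "b \<notin> R" using RT unfolding T_def by blast+
          then have "(a, b) \<notin> E" using ab unfolding S_def by blast
          then show "(a, b) \<notin> E \<and> (b, a) \<notin> E" using E_sym by blast
        qed
        ultimately show "path_dec E (R \<union> S) Cs \<and> S \<subseteq> hd Cs \<and> (\<forall>B\<in>set Cs. alpha_le E B (2 * s + k)) \<and>
          S \<subseteq> T \<and> R \<inter> T = {} \<and> (\<forall>a\<in>R. \<forall>b\<in>T - S. (a, b) \<notin> E \<and> (b, a) \<notin> E)"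
          using Cs RT by blast
      qed
    qed
    moreover have "T \<union> \<Union>\<C> = X" unfolding \<C>_def Union_components T_def by blast
    ultimately have "has_pd E X (2 * s + k)" unfolding has_pd_def by metis
    with bad show False by simp
  qed
  then show ?thesis unfolding s_def k_def .
qed

end

theorem rooted_tree_forces:
  "rooted_tree V F r \<Longrightarrow> \<exists>K. \<forall>E :: ('a \<times> 'a) set. star_bounded E t \<longrightarrow> forces E V F r K"
proof (induction rule: rooted_tree.induct)
  case (single r)
  show ?case by (intro exI allI impI, rule star_bounded.forces_single)
next
  case (join V1 F1 r1 V2 F2 r2)
  then obtain K1 K2 where K: "\<forall>E :: ('a \<times> 'a) set. star_bounded E t \<longrightarrow> forces E V1 F1 r1 K1"
    "\<forall>E :: ('a \<times> 'a) set. star_bounded E t \<longrightarrow> forces E V2 F2 r2 K2" by (elim exE)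
  obtain f where "\<forall>E :: ('a \<times> 'a) set. star_bounded E t \<longrightarrow>
      grabs E (V1 \<union> V2) (link F1 r1 F2 r2) r2 f"
    using rooted_tree_grabs[where t = t, OF rooted_tree.join[OF join.hyps(1,2,3)]] by (elim exE)
  with K join.hyps show ?case
    by (intro exI[of _ "2 * max (f 0) (Suc t) + max (t + K1) (t + K2)"] allI impI star_bounded.forces_join) auto
qed

section \<open>Forests and rooted trees\<close>

text \<open>A form of acyclicity that mediates between cycles given as arc lists and the inductive
  \<open>rooted_tree\<close>: every nonempty vertex set contains a vertex with at most one neighbour
  in it.\<close>

definition one_degenerate :: "'b set \<Rightarrow> ('b \<times> 'b) set \<Rightarrow> bool" where
  "one_degenerate V F \<longleftrightarrow> (\<forall>W\<subseteq>V. W \<noteq> {} \<longrightarrow> (\<exists>w\<in>W. \<exists>u. \<forall>v\<in>W. (w, v) \<in> F \<longrightarrow> v = u))"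

lemma pair_graph_iff:
  "pair_graph G \<longleftrightarrow> finite (pverts G) \<and> parcs G \<subseteq> pverts G \<times> pverts G \<and> sym (parcs G) \<and> irrefl (parcs G)"
proof
  assume "pair_graph G"
  then interpret pair_graph G .
  show "finite (pverts G) \<and> parcs G \<subseteq> pverts G \<times> pverts G \<and> sym (parcs G) \<and> irrefl (parcs G)"
    using pair_finite_verts arc_fst_in_verts arc_snd_in_verts arcs_symmetric no_loops'
    by (force intro: symI simp: irrefl_def)
next
  assume a: "finite (pverts G) \<and> parcs G \<subseteq> pverts G \<times> pverts G \<and> sym (parcs G) \<and> irrefl (parcs G)"
  then have "finite (parcs G)" by (meson finite_SigmaI finite_subset)
  with a show "pair_graph G"
    by unfold_locales (auto simp: symmetric_def irrefl_def)
qed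

lemma pair_graph_ugraph: "pair_graph G \<Longrightarrow> ugraph (parcs G)"
  by (simp add: pair_graph_iff ugraph_def)

lemma pawalk_verts_props:
  assumes "pcas u p v" "set p \<subseteq> F"
  shows "length (pawalk_verts u p) = Suc (length p)" "pawalk_verts u p ! 0 = u"
    "pawalk_verts u p ! length p = v"
    "\<And>j. j < length p \<Longrightarrow> (pawalk_verts u p ! j, pawalk_verts u p ! Suc j) \<in> F"
  using assms
proof (induction p arbitrary: u)
  case (Cons e p)
  { case 1 then show ?case using Cons.IH(1)[of "snd e"] by simp }
  { case 2 then show ?case by simp }
  { case 3 then show ?case using Cons.IH(3)[of "snd e"] by simp }
  { case (4 j)
    then have e: "fst e = u" "pcas (snd e) p v" "set p \<subseteq> F" "e \<in> F" by auto
    show ?case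
    proof (cases j)
      case 0
      then show ?thesis using e Cons.IH(2)[OF e(2,3)] by (cases e) auto
    next
      case (Suc i)
      then show ?thesis using Cons.IH(4)[OF _ e(2,3), of i] 4 by simp
    qed }
qed auto

lemma pawalk_zip:
  assumes "vs \<noteq> []"
  shows "pcas (hd vs) (zip vs (tl vs)) (last vs)" "pawalk_verts (hd vs) (zip vs (tl vs)) = vs"
  using assms
proof (induction vs)
  case (Cons v vs)
  { case 1 then show ?case using Cons.IH(1) by (cases vs) auto }
  { case 2 then show ?case using Cons.IH(2) by (cases vs) auto }
qed auto

text \<open>In the vertex set of a cycle of length at least three, predecessor and successor of each
  vertex are two distinct neighbours.\<close>

lemma one_degenerate_forest:
  assumes G: "pair_graph F" and d: "one_degenerate (pverts F) (parcs F)"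
  shows "forest_graph F"
  unfolding forest_graph_def
proof (intro conjI G notI)
  interpret pair_graph F by (rule G)
  assume "\<exists>p. pre_digraph.cycle (with_proj F) p \<and> 3 \<le> length p"
  then obtain p u where p: "awalk u p u" "distinct (tl (pawalk_verts u p))" "3 \<le> length p"
    unfolding cycle_def by auto
  define vs where "vs = pawalk_verts u p"
  define n where "n = length p"
  have pc: "pcas u p u" "set p \<subseteq> parcs F" using p(1) by (auto simp: awalk_def)
  note vs = pawalk_verts_props[OF pc, folded vs_def n_def]
  have n: "n \<ge> 3" using p(3) by (simp add: n_def)
  have inj: "vs ! i \<noteq> vs ! j" if "1 \<le> i" "i \<le> n" "1 \<le> j" "j \<le> n" "i \<noteq> j" for i j
  proof -
    have "tl vs ! (i - 1) \<noteq> tl vs ! (j - 1)"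
      using p(2)[folded vs_def] that vs(1) by (subst nth_eq_iff_index_eq) auto
    then show ?thesis using that vs(1) by (simp add: nth_tl)
  qed
  \<comment> \<open>Indices start at 1 because \<open>vs ! 0\<close> and \<open>vs ! n\<close> are
    the same vertex.\<close>
  define W where "W = (!) vs ` {1..n}"
  have edge: "(vs ! j, vs ! Suc j) \<in> parcs F" "(vs ! Suc j, vs ! j) \<in> parcs F" if "j < n" for j
    using vs(4)[OF that] arcs_symmetric by blast+
  have inW: "vs ! j \<in> W" if "j \<le> n" for j
  proof (cases "j = 0")
    case True
    then have "vs ! j = vs ! n" using vs(2,3) by simp
    then show ?thesis using n unfolding W_def by (intro image_eqI[of _ _ n]) auto
  next
    case False
    then show ?thesis using that unfolding W_def by auto
  qed
  have "W \<subseteq> pverts F"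
  proof
    fix w assume "w \<in> W"
    then obtain i where i: "w = vs ! i" "1 \<le> i" "i \<le> n" unfolding W_def by auto
    then have "(vs ! (i - 1), vs ! i) \<in> parcs F" using edge(1)[of "i - 1"] by simp
    then show "w \<in> pverts F" using i(1) in_arcsD2 by blast
  qed
  moreover have "W \<noteq> {}" using inW[of 0] by auto
  ultimately have "\<exists>w\<in>W. \<exists>x. \<forall>v\<in>W. (w, v) \<in> parcs F \<longrightarrow> v = x"
    using d by (simp add: one_degenerate_def)
  then obtain w x where w: "w \<in> W" and x: "\<And>v. v \<in> W \<Longrightarrow> (w, v) \<in> parcs F \<Longrightarrow> v = x"
    by blast
  obtain i where i: "w = vs ! i" "1 \<le> i" "i \<le> n" using w unfolding W_def by auto
  have prev: "vs ! (i - 1) = x" using x[OF inW[of "i - 1"]] edge(2)[of "i - 1"] i by simp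
  show False
  proof (cases "i = n")
    case True
    have "vs ! 1 = x" using x[OF inW[of 1]] edge(1)[of 0] i vs(2,3) n True by simp
    moreover have "1 \<le> n - 1" "n - 1 \<noteq> 1" using n by linarith+
    ultimately show False using prev inj[of "n - 1" 1] n True by auto
  next
    case False
    then have nxt: "vs ! Suc i = x" using x[OF inW[of "Suc i"]] edge(1)[of i] i by simp
    show False
    proof (cases "i = 1")
      case True
      then have "vs ! n = x" using prev vs(2,3) by simp
      moreover have "n \<noteq> Suc i" using n True by linarith
      ultimately show False using nxt inj[of n "Suc i"] n True by auto
    next
      case i1: False
      then have "1 \<le> i - 1" "i - 1 \<le> n" "i - 1 \<noteq> Suc i" "Suc i \<le> n" using i False by linarith+
      then show False using prev nxt inj[of "i - 1" "Suc i"] by simp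
    qed
  qed
qed

text \<open>Take a longest path in a set where no vertex has at most one neighbour. Its first vertex
  has a neighbour other than the second vertex; by maximality this neighbour is on the path and
  closes a cycle.\<close>

lemma forest_one_degenerate:
  assumes f: "forest_graph F"
  shows "one_degenerate (pverts F) (parcs F)"
  unfolding one_degenerate_def
proof (intro allI impI, rule ccontr)
  have G: "pair_graph F" using f by (simp add: forest_graph_def)
  interpret pair_graph F by (rule G)
  fix W assume W: "W \<subseteq> pverts F" "W \<noteq> {}"
    and "\<not> (\<exists>w\<in>W. \<exists>u. \<forall>v\<in>W. (w, v) \<in> parcs F \<longrightarrow> v = u)"
  then have two: "\<exists>v\<in>W. (w, v) \<in> parcs F \<and> v \<noteq> u" if "w \<in> W" for w u using that by blast
  define P where "P us \<longleftrightarrow> us \<noteq> [] \<and> distinct us \<and> set us \<subseteq> W \<and> set (zip us (tl us)) \<subseteq> parcs F" for us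
  have finW: "finite W" using W(1) pair_finite_verts finite_subset by blast
  obtain w0 where "w0 \<in> W" using W by blast
  then have "P [w0]" by (simp add: P_def)
  moreover have "\<forall>us. P us \<longrightarrow> length us < Suc (card W)"
  proof (intro allI impI)
    fix us assume "P us"
    then have "length us = card (set us)" "set us \<subseteq> W" by (simp_all add: P_def distinct_card)
    then show "length us < Suc (card W)" using card_mono[OF finW] by (simp add: less_Suc_eq_le)
  qed
  ultimately obtain us where us: "P us" and max: "\<And>vs. P vs \<Longrightarrow> length vs \<le> length us"
    using ex_has_greatest_nat[of P "[w0]" length "Suc (card W)"] by (metis less_imp_le)
  define x where "x = hd us"
  have x: "x \<in> W" "us = x # tl us" using us by (auto simp: P_def x_def)
  \<comment> \<open>On a one-vertex path there is no successor to avoid, and \<open>x\<close> is a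
    harmless default since \<open>y\<close> differs from \<open>x\<close> anyway.\<close>
  define u where "u = (if tl us = [] then x else hd (tl us))"
  obtain y where y: "y \<in> W" "(x, y) \<in> parcs F" "y \<noteq> u" using two[OF x(1)] by blast
  have yx: "(y, x) \<in> parcs F" "y \<noteq> x" using y(2) arcs_symmetric no_loops' by blast+
  have "y \<in> set us"
  proof (rule ccontr)
    assume "y \<notin> set us"
    moreover have "zip (y # us) us = (y, x) # zip us (tl us)" using x(2) by (metis zip_Cons_Cons)
    ultimately have "P (y # us)" using us y(1) yx(1) by (simp add: P_def)
    from max[OF this] show False by simp
  qed
  then obtain i where i: "i < length us" "us ! i = y" by (auto simp: in_set_conv_nth)
  have i2: "i \<ge> 2"
  proof (rule ccontr)
    assume "\<not> ?thesis"
    then consider "i = 0" | "i = 1" by linarith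
    then show False
    proof cases
      case 1
      then show False using i yx(2) x(2) by (metis nth_Cons_0)
    next
      case 2
      then have "tl us \<noteq> []" "y = hd (tl us)" using i x(2) by (metis One_nat_def length_Cons less_Suc_eq list.size(3) less_irrefl_nat, metis One_nat_def hd_conv_nth i length_Cons less_irrefl_nat list.size(3) nth_Cons_Suc)
      then show False using y(3) by (simp add: u_def)
    qed
  qed
  define c where "c = take (Suc i) us"
  have us': "us \<noteq> []" "distinct us" using us by (auto simp: P_def)
  have c: "c \<noteq> []" "distinct c" "hd c = x" "length c = Suc i"
    using i us' by (simp_all add: c_def x_def)
  then have c': "last c = y" using i by (simp add: last_conv_nth) (simp add: c_def)
  define p where "p = zip (c @ [x]) (tl (c @ [x]))"
  have hdl: "hd (c @ [x]) = x" "last (c @ [x]) = x" using c by auto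
  have "pcas x p x" "pawalk_verts x p = c @ [x]"
    using pawalk_zip[of "c @ [x]"] unfolding hdl p_def by auto
  moreover have "set p \<subseteq> parcs F"
  proof
    fix e assume "e \<in> set p"
    then obtain j where j: "j < Suc i" "e = ((c @ [x]) ! j, (c @ [x]) ! Suc j)"
      using c(4) by (auto simp: p_def set_zip nth_tl)
    show "e \<in> parcs F"
    proof (cases "j = i")
      case True
      then have "e = (y, x)" using j c c' by (auto simp: nth_append last_conv_nth)
      then show ?thesis using yx by simp
    next
      case False
      then have "e = (us ! j, us ! Suc j)" using j c i by (auto simp: nth_append c_def)
      moreover have "(us ! j, us ! Suc j) \<in> set (zip us (tl us))"
        using j False i by (auto simp: set_zip nth_tl intro!: exI[of _ j])
      ultimately show ?thesis using us by (auto simp: P_def)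
    qed
  qed
  moreover have "distinct (tl (c @ [x]))" using c(1,2,3) by (cases c) auto
  moreover have "length p = Suc i" using c(4) by (simp add: p_def)
  moreover have "x \<in> pverts F" using x(1) W(1) by blast
  ultimately have "cycle p \<and> 3 \<le> length p"
    using i2 unfolding cycle_def awalk_def by (auto intro!: exI[of _ x])
  then show False using f unfolding forest_graph_def by blast
qed

section \<open>Rooted trees are forests, and forests embed in rooted trees\<close>

lemma rooted_tree_irrefl: "rooted_tree V F r \<Longrightarrow> irrefl F"
  by (induction rule: rooted_tree.induct) (auto simp: irrefl_def dest: rooted_tree_root)

text \<open>Demanding a vertex other than the root makes the induction work: a join adds an edge
  between the two roots only, so other vertices keep their neighbours. If \<open>W\<close> meets
  \<open>V1\<close> just in \<open>r1\<close>, then \<open>r1\<close> itself qualifies, with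
  \<open>r2\<close> as its only possible neighbour.\<close>

lemma rooted_tree_one_degenerate:
  "rooted_tree V F r \<Longrightarrow> W \<subseteq> V \<Longrightarrow> W \<noteq> {} \<Longrightarrow> W \<noteq> {r} \<Longrightarrow>
    \<exists>w\<in>W. w \<noteq> r \<and> (\<exists>u. \<forall>v\<in>W. (w, v) \<in> F \<longrightarrow> v = u)"
proof (induction arbitrary: W rule: rooted_tree.induct)
  case (single r)
  then show ?case by (metis subset_singletonD)
next
  case (join V1 F1 r1 V2 F2 r2)
  note F1 = rooted_tree_edges[OF join.hyps(1)] and F2 = rooted_tree_edges[OF join.hyps(2)]
  note r = rooted_tree_root[OF join.hyps(1)] rooted_tree_root[OF join.hyps(2)]
  show ?case
  proof (cases "W \<inter> V2 \<subseteq> {r2}")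
    case False
    then have W2: "W \<inter> V2 \<noteq> {}" "W \<inter> V2 \<noteq> {r2}" by auto
    from join.IH(2)[OF Int_lower2 W2] obtain w u
      where w: "w \<in> W \<inter> V2" "w \<noteq> r2" "\<forall>v\<in>W \<inter> V2. (w, v) \<in> F2 \<longrightarrow> v = u"
      by (elim bexE conjE exE)
    have "v = u" if "v \<in> W" "(w, v) \<in> link F1 r1 F2 r2" for v
    proof -
      have "w \<notin> V1" using IntD2[OF w(1)] join.hyps(3) by blast
      then have "(w, v) \<in> F2" using that(2) w(2) F1 r by auto
      then show ?thesis using w(3) that(1) F2 by auto
    qed
    then show ?thesis using w(1,2) by blast
  next
    case W2: True
    have W1: "W \<inter> V1 \<noteq> {}" using W2 join.prems by blast
    show ?thesis
    proof (cases "W \<inter> V1 = {r1}")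
      case True
      have "v = r2" if "v \<in> W" "(r1, v) \<in> link F1 r1 F2 r2" for v
      proof (cases "v \<in> V1")
        case v: True
        then have "v = r1" using that(1) True by blast
        then have "(r1, r1) \<in> link F1 r1 F2 r2" using that(2) by simp
        then show ?thesis using rooted_tree_irrefl[OF rooted_tree.join[OF join.hyps]] by (auto simp: irrefl_def)
      next
        case False
        then show ?thesis using that(1) W2 join.prems(1) by blast
      qed
      moreover have "r1 \<noteq> r2" using r join.hyps(3) by blast
      ultimately show ?thesis using True by blast
    next
      case False
      from join.IH(1)[OF Int_lower2 W1 False] obtain w u
        where w: "w \<in> W \<inter> V1" "w \<noteq> r1" "\<forall>v\<in>W \<inter> V1. (w, v) \<in> F1 \<longrightarrow> v = u"
        by (elim bexE conjE exE)
      have "w \<notin> V2" using w(1) join.hyps(3) by blast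
      have "v = u" if "v \<in> W" "(w, v) \<in> link F1 r1 F2 r2" for v
      proof -
        have "(w, v) \<in> F1" using that(2) w(2) F2 r \<open>w \<notin> V2\<close> by auto
        then show ?thesis using w(3) that(1) F1 by auto
      qed
      moreover have "w \<noteq> r2" using \<open>w \<notin> V2\<close> r by blast
      ultimately show ?thesis using w(1) by blast
    qed
  qed
qed


lemma rooted_tree_forest:
  assumes "rooted_tree V F r"
  shows "forest_graph \<lparr>pverts = V, parcs = F\<rparr>"
proof (rule one_degenerate_forest)
  show "pair_graph \<lparr>pverts = V, parcs = F\<rparr>"
    using rooted_tree_finite[OF assms] rooted_tree_edges[OF assms] rooted_tree_sym[OF assms]
      rooted_tree_irrefl[OF assms] by (simp add: pair_graph_iff)
  have "\<exists>w\<in>W. \<exists>u. \<forall>v\<in>W. (w, v) \<in> F \<longrightarrow> v = u" if W: "W \<subseteq> V" "W \<noteq> {}" for W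
  proof (cases "W = {r}")
    case False
    from rooted_tree_one_degenerate[OF assms W False] show ?thesis by (elim bexE conjE) (rule bexI)
  qed auto
  then show "one_degenerate (pverts \<lparr>pverts = V, parcs = F\<rparr>) (parcs \<lparr>pverts = V, parcs = F\<rparr>)"
    by (simp add: one_degenerate_def)
qed

lemma rooted_tree_add_leaf:
  "rooted_tree V F r \<Longrightarrow> u \<in> V \<Longrightarrow> v \<notin> V \<Longrightarrow> rooted_tree (insert v V) (F \<union> {(v, u), (u, v)}) r"
proof (induction rule: rooted_tree.induct)
  case (single r)
  then have "rooted_tree ({v} \<union> {r}) ({} \<union> {} \<union> {(v, r), (r, v)}) r"
    by (intro rooted_tree.intros) auto
  then show ?case using single by (simp add: insert_commute)
next
  case (join V1 F1 r1 V2 F2 r2)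
  show ?case
  proof (cases "u \<in> V1")
    case True
    then have "rooted_tree (insert v V1 \<union> V2) ((F1 \<union> {(v, u), (u, v)}) \<union> F2 \<union> {(r1, r2), (r2, r1)}) r2"
      using join.IH(1) join.hyps join.prems by (intro rooted_tree.join) auto
    moreover have "insert v V1 \<union> V2 = insert v (V1 \<union> V2)"
      "(F1 \<union> {(v, u), (u, v)}) \<union> F2 \<union> {(r1, r2), (r2, r1)} =
        link F1 r1 F2 r2 \<union> {(v, u), (u, v)}" by auto
    ultimately show ?thesis by metis
  next
    case False
    then have "rooted_tree (V1 \<union> insert v V2) (F1 \<union> (F2 \<union> {(v, u), (u, v)}) \<union> {(r1, r2), (r2, r1)}) r2"
      using join.IH(2) join.hyps join.prems by (intro rooted_tree.join) auto
    moreover have "V1 \<union> insert v V2 = insert v (V1 \<union> V2)"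
      "F1 \<union> (F2 \<union> {(v, u), (u, v)}) \<union> {(r1, r2), (r2, r1)} =
        link F1 r1 F2 r2 \<union> {(v, u), (u, v)}" by auto
    ultimately show ?thesis by metis
  qed
qed

text \<open>An isolated vertex of the forest is hung below an auxiliary vertex \<open>z\<close>, which keeps the forest an
  induced subgraph.\<close>

lemma forest_in_rooted_tree:
  fixes V :: "nat set"
  assumes "finite V" "one_degenerate V F" "F \<subseteq> V \<times> V" "sym F" "irrefl F" "finite A" "A \<inter> V = {}"
  shows "\<exists>V' F' r. rooted_tree V' F' r \<and> V \<subseteq> V' \<and> A \<inter> V' = {} \<and> F = F' \<inter> V \<times> V"
  using assms
proof (induction "card V" arbitrary: V F A rule: less_induct)
  case less
  show ?case
  proof (cases "V = {}")
    case True
    obtain z where "z \<notin> A" using less.prems(6) ex_new_if_finite infinite_UNIV_nat by blast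
    then show ?thesis using True less.prems(3) by (intro exI[of _ "{z}"] exI[of _ "{}"] exI[of _ z]) (auto intro: rooted_tree.single)
  next
    case False
    then obtain w u where w: "w \<in> V" and u: "\<forall>v\<in>V. (w, v) \<in> F \<longrightarrow> v = u"
      using less.prems(2) unfolding one_degenerate_def by (metis order_refl)
    \<comment> \<open>Adding \<open>w\<close> to the forbidden names keeps the inductively built
      tree from using \<open>w\<close>, so that \<open>w\<close> can be attached to it
      afterwards.\<close>
    let ?V = "V - {w}" and ?F = "F \<inter> (V - {w}) \<times> (V - {w})" and ?A = "insert w A"
    have "\<exists>V' F' r. rooted_tree V' F' r \<and> ?V \<subseteq> V' \<and> ?A \<inter> V' = {} \<and> ?F = F' \<inter> ?V \<times> ?V"
    proof (rule less.hyps)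
      show "card ?V < card V" using less.prems(1) w by (rule card_Diff1_less)
      show "one_degenerate ?V ?F" unfolding one_degenerate_def
      proof (intro allI impI)
        fix W assume W: "W \<subseteq> ?V" "W \<noteq> {}"
        then have "W \<subseteq> V" by blast
        with W(2) less.prems(2) obtain a b where "a \<in> W" "\<forall>v\<in>W. (a, v) \<in> F \<longrightarrow> v = b"
          unfolding one_degenerate_def by meson
        then show "\<exists>w\<in>W. \<exists>u. \<forall>v\<in>W. (w, v) \<in> ?F \<longrightarrow> v = u" by blast
      qed
      show "sym ?F" "irrefl ?F" using less.prems(4,5) by (auto simp: sym_def irrefl_def)
    qed (use less.prems in auto)
    then obtain V' F' r where T: "rooted_tree V' F' r" "?V \<subseteq> V'" "?A \<inter> V' = {}" "?F = F' \<inter> ?V \<times> ?V"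
      by (elim exE conjE)
    note edges = rooted_tree_edges[OF T(1)]
    have wV': "w \<notin> V'" using T(3) by blast
    show ?thesis
    proof (cases "\<exists>v. (w, v) \<in> F")
      case True
      then have wu: "(w, u) \<in> F" "u \<in> V" using u less.prems(3) by blast+
      then have "u \<noteq> w" "(u, w) \<in> F" using less.prems(4,5) by (auto simp: sym_def irrefl_def)
      then have uV': "u \<in> V'" using T(2) wu(2) by blast
      have "F = (F' \<union> {(w, u), (u, w)}) \<inter> V \<times> V"
      proof (intro equalityI subrelI)
        fix a b assume ab: "(a, b) \<in> F"
        then have abV: "a \<in> V" "b \<in> V" "(b, a) \<in> F" using less.prems(3,4) by (auto simp: sym_def)
        show "(a, b) \<in> (F' \<union> {(w, u), (u, w)}) \<inter> V \<times> V"
        proof (cases "a = w \<or> b = w")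
          case True
          then show ?thesis using u ab abV by blast
        next
          case False
          then have "(a, b) \<in> ?F" using ab abV by blast
          then show ?thesis using T(4) abV by blast
        qed
      next
        fix a b assume ab: "(a, b) \<in> (F' \<union> {(w, u), (u, w)}) \<inter> V \<times> V"
        show "(a, b) \<in> F"
        proof (cases "(a, b) \<in> F'")
          case True
          then have "a \<noteq> w" "b \<noteq> w" using edges wV' by blast+
          then have "(a, b) \<in> F' \<inter> ?V \<times> ?V" using True ab by blast
          then show ?thesis using T(4) by blast
        next
          case False
          then show ?thesis using ab wu(1) \<open>(u, w) \<in> F\<close> by blast
        qed
      qed
      moreover have "V \<subseteq> insert w V'" "A \<inter> insert w V' = {}" using T(2,3) less.prems(7) w by blast+
      ultimately show ?thesis using rooted_tree_add_leaf[OF T(1) uV' wV'] by blast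
    next
      case False
      have "finite (insert w (V' \<union> A \<union> V))" using rooted_tree_finite[OF T(1)] less.prems by simp
      then obtain z where z: "z \<notin> insert w (V' \<union> A \<union> V)" using ex_new_if_finite infinite_UNIV_nat by blast
      have T1: "rooted_tree (insert z V') (F' \<union> {(z, r), (r, z)}) r"
        by (rule rooted_tree_add_leaf[OF T(1) rooted_tree_root[OF T(1)]]) (use z in blast)
      have T2: "rooted_tree (insert w (insert z V')) (F' \<union> {(z, r), (r, z)} \<union> {(w, z), (z, w)}) r"
        by (rule rooted_tree_add_leaf[OF T1]) (use z wV' in auto)
      have now: "(v, w) \<notin> F" "(w, v) \<notin> F" for v using False less.prems(4) by (auto simp: sym_def)
      have "F = ?F" using less.prems(3) now by auto
      also have "\<dots> = F' \<inter> V \<times> V" using T(4) edges wV' by blast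
      also have "\<dots> = (F' \<union> {(z, r), (r, z)} \<union> {(w, z), (z, w)}) \<inter> V \<times> V" using z by blast
      finally have "F = (F' \<union> {(z, r), (r, z)} \<union> {(w, z), (z, w)}) \<inter> V \<times> V" .
      moreover have "V \<subseteq> insert w (insert z V')" "A \<inter> insert w (insert z V') = {}"
        using T(2,3) less.prems(7) w z by blast+
      ultimately show ?thesis using T2 by blast
    qed
  qed
qed

section \<open>Induced minors and models\<close>

text \<open>Arcs are pairs of vertices, so the arc map of an isomorphism is forced by its vertex
  map.\<close>

lemma digraph_iso_pair_iff:
  fixes G :: "'a pair_pre_digraph" and F :: "'b pair_pre_digraph"
  assumes wf: "parcs G \<subseteq> pverts G \<times> pverts G"
  shows "digraph_iso (with_proj G) (with_proj F) \<longleftrightarrow>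
    (\<exists>f. inj_on f (pverts G) \<and> pverts F = f ` pverts G \<and> parcs F = map_prod f f ` parcs G)"
proof
  assume "digraph_iso (with_proj G) (with_proj F)"
  then obtain h where h: "pre_digraph.digraph_isomorphism (with_proj G) h" "with_proj F = app_iso h (with_proj G)"
    unfolding digraph_iso_def by blast
  have F: "pverts F = iso_verts h ` pverts G" "parcs F = iso_arcs h ` parcs G" "iso_tail h = fst" "iso_head h = snd"
    using arg_cong[OF h(2), of verts] arg_cong[OF h(2), of arcs] arg_cong[OF h(2), of tail] arg_cong[OF h(2), of head]
    by simp_all
  have "iso_arcs h a = map_prod (iso_verts h) (iso_verts h) a" if "a \<in> parcs G" for a
    using h(1) that F(3,4) unfolding pre_digraph.digraph_isomorphism_def
    by (auto simp: map_prod_def prod_eq_iff split: prod.splits)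
  then have "parcs F = map_prod (iso_verts h) (iso_verts h) ` parcs G" unfolding F(2) by (intro image_cong) auto
  moreover have "inj_on (iso_verts h) (pverts G)" using h(1) by (simp add: pre_digraph.digraph_isomorphism_def)
  ultimately show "\<exists>f. inj_on f (pverts G) \<and> pverts F = f ` pverts G \<and> parcs F = map_prod f f ` parcs G"
    using F(1) by blast
next
  assume "\<exists>f. inj_on f (pverts G) \<and> pverts F = f ` pverts G \<and> parcs F = map_prod f f ` parcs G"
  then obtain f where f: "inj_on f (pverts G)" "pverts F = f ` pverts G" "parcs F = map_prod f f ` parcs G" by blast
  define h where "h = \<lparr>iso_verts = f, iso_arcs = map_prod f f, iso_head = snd :: 'b \<times> 'b \<Rightarrow> 'b, iso_tail = fst\<rparr>"
  have "pair_wf_digraph G" using wf by unfold_locales auto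
  then have "wf_digraph (with_proj G)" by (simp add: wf_digraph_wp_iff)
  moreover have "inj_on (map_prod f f) (parcs G)"
    by (rule inj_on_subset[OF map_prod_inj_on[OF f(1) f(1)] wf])
  ultimately have "pre_digraph.digraph_isomorphism (with_proj G) h"
    using f(1) by (simp add: pre_digraph.digraph_isomorphism_def h_def)
  moreover have "with_proj F = app_iso h (with_proj G)"
    by (rule pre_digraph.equality) (simp_all add: h_def f)
  ultimately show "digraph_iso (with_proj G) (with_proj F)" unfolding digraph_iso_def by blast
qed

lemma induced_subgraph_pair_iff:
  assumes "parcs G \<subseteq> pverts G \<times> pverts G"
  shows "induced_subgraph (with_proj H) (with_proj G) \<longleftrightarrow>
    pverts H \<subseteq> pverts G \<and> parcs H = Restr (parcs G) (pverts H)"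
proof -
  have eq: "{e \<in> parcs G. fst e \<in> pverts H \<and> snd e \<in> pverts H} = Restr (parcs G) (pverts H)" by auto
  have wfG: "pair_wf_digraph G"
    using assms by (intro pair_wf_digraph.intro) (auto dest: subsetD)
  have wfH: "pair_wf_digraph H" if "parcs H = Restr (parcs G) (pverts H)"
    unfolding pair_wf_digraph_def that by simp
  show ?thesis
    unfolding induced_subgraph_def subgraph_def compatible_def wf_digraph_wp_iff
    using wfG wfH by (simp add: eq) blast
qed

text \<open>Names the renaming that is local to \<open>contract_edge\<close>, so that its preimages
  can be spoken of.\<close>

definition merge :: "'a \<Rightarrow> 'a \<Rightarrow> 'a \<Rightarrow> 'a" where
  "merge u v x = (if x = v then u else x)"

lemma contract_edge_simps:
  "pverts (contract_edge G u v) = merge u v ` pverts G"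
  "parcs (contract_edge G u v) =
    {(merge u v x, merge u v y) | x y. (x, y) \<in> parcs G \<and> merge u v x \<noteq> merge u v y}"
  by (auto simp: contract_edge_def merge_def Let_def)

lemma contract_edge_wf:
  assumes "parcs G \<subseteq> pverts G \<times> pverts G"
  shows "parcs (contract_edge G u v) \<subseteq> pverts (contract_edge G u v) \<times> pverts (contract_edge G u v)"
  using assms by (auto simp: contract_edge_simps)

lemma contract_edge_irrefl: "irrefl (parcs (contract_edge G u v))"
  by (auto simp: contract_edge_simps irrefl_def)

lemma contract_edge_sym:
  assumes "sym (parcs G)"
  shows "sym (parcs (contract_edge G u v))"
proof (rule symI)
  fix a b assume "(a, b) \<in> parcs (contract_edge G u v)"
  then obtain x y where "a = merge u v x" "b = merge u v y" "(x, y) \<in> parcs G" "a \<noteq> b"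
    by (auto simp: contract_edge_simps)
  then have "(y, x) \<in> parcs G" using assms by (auto dest: symD)
  with \<open>a = merge u v x\<close> \<open>b = merge u v y\<close> \<open>a \<noteq> b\<close> show "(b, a) \<in> parcs (contract_edge G u v)" 
    by (simp only: contract_edge_simps, intro CollectI exI[of _ y] exI[of _ x] conjI) simp_all
qed

text \<open>Contracting an edge unites the hubs of its ends, and the union is connected because of
  that edge. In general the new hub of a vertex is the union of the hubs of its preimages under
  \<open>merge\<close>.\<close>

lemma contracts_to_model:
  assumes "contracts_to G G'" "pair_graph G"
  shows "parcs G' \<subseteq> pverts G' \<times> pverts G' \<and> irrefl (parcs G') \<and>
    (\<exists>H. minor_model (parcs G) (pverts G') (parcs G') H \<and> (\<forall>v\<in>pverts G'. H v \<subseteq> pverts G))"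
  using assms
proof (induction rule: contracts_to.induct)
  case (refl G)
  have "minor_model (parcs G) (pverts G) (parcs G) (\<lambda>v. {v})" by (auto simp: minor_model_def)
  then show ?case using refl by (auto simp: pair_graph_iff intro!: exI[of _ "\<lambda>v. {v}"])
next
  case (step G G' u v)
  interpret ugraph "parcs G" by (rule pair_graph_ugraph[OF step.prems])
  obtain H where wf: "parcs G' \<subseteq> pverts G' \<times> pverts G'" "irrefl (parcs G')"
    and H: "minor_model (parcs G) (pverts G') (parcs G') H" "\<forall>v\<in>pverts G'. H v \<subseteq> pverts G"
    using step.IH[OF step.prems] by blast
  have uv: "u \<in> pverts G'" "v \<in> pverts G'" "u \<noteq> v" using step.hyps(2) wf by (auto simp: irrefl_def)
  define K where "K x = (if x = u then H u \<union> H v else H x)" for x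
  let ?G = "contract_edge G' u v"
  have V: "pverts ?G = pverts G' - {v}" using uv by (auto simp: contract_edge_simps merge_def)
  have adj: "(x, y) \<in> parcs G' \<longleftrightarrow> (\<exists>a\<in>H x. \<exists>b\<in>H y. (a, b) \<in> parcs G)" if "x \<in> pverts G'" "y \<in> pverts G'" "x \<noteq> y" for x y
    using H(1) that by (simp add: minor_model_def)
  have K: "K x = \<Union>(H ` {x' \<in> pverts G'. merge u v x' = x})" if "x \<in> pverts ?G" for x
    using that uv unfolding V by (auto simp: K_def merge_def split: if_splits)
  have "minor_model (parcs G) (pverts ?G) (parcs ?G) K" unfolding minor_model_def
  proof (intro conjI ballI impI)
    fix x assume x: "x \<in> pverts ?G"
    show "conn_in (parcs G) (K x)"
    proof (cases "x = u")
      case True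
      obtain a b where "a \<in> H u" "b \<in> H v" "(a, b) \<in> parcs G" using adj[OF uv] step.hyps(2) by blast
      then show ?thesis using True H(1) uv conn_in_touch[of "H u" "H v" a b] by (auto simp: K_def minor_model_def)
    next
      case False
      then show ?thesis using H(1) x unfolding V by (auto simp: K_def minor_model_def)
    qed
  next
    fix x y assume xy: "x \<in> pverts ?G" "y \<in> pverts ?G" "x \<noteq> y"
    show "K x \<inter> K y = {}"
    proof -
      have "H x' \<inter> H y' = {}" if "x' \<in> pverts G'" "merge u v x' = x" "y' \<in> pverts G'" "merge u v y' = y" for x' y'
      proof -
        have "x' \<noteq> y'" using that xy(3) by blast
        then show ?thesis using H(1) that by (simp add: minor_model_def)
      qed
      then show ?thesis unfolding K[OF xy(1)] K[OF xy(2)] by blast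
    qed
    show "(x, y) \<in> parcs ?G \<longleftrightarrow> (\<exists>a\<in>K x. \<exists>b\<in>K y. (a, b) \<in> parcs G)"
    proof
      assume "(x, y) \<in> parcs ?G"
      then obtain x' y' where xy': "x = merge u v x'" "y = merge u v y'" "(x', y') \<in> parcs G'" "merge u v x' \<noteq> merge u v y'"
        by (auto simp: contract_edge_simps)
      then have "x' \<in> pverts G'" "y' \<in> pverts G'" "x' \<noteq> y'" using wf(1) by auto
      with adj xy'(3) obtain a b where "a \<in> H x'" "b \<in> H y'" "(a, b) \<in> parcs G" by blast
      moreover have "H x' \<subseteq> K x" "H y' \<subseteq> K y"
        using \<open>x' \<in> pverts G'\<close> \<open>y' \<in> pverts G'\<close> xy'(1,2) unfolding K[OF xy(1)] K[OF xy(2)] by blast+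
      ultimately show "\<exists>a\<in>K x. \<exists>b\<in>K y. (a, b) \<in> parcs G" by blast
    next
      assume "\<exists>a\<in>K x. \<exists>b\<in>K y. (a, b) \<in> parcs G"
      then obtain a b x' y' where ab: "a \<in> H x'" "b \<in> H y'" "(a, b) \<in> parcs G"
        and xy': "x' \<in> pverts G'" "merge u v x' = x" "y' \<in> pverts G'" "merge u v y' = y"
        unfolding K[OF xy(1)] K[OF xy(2)] by blast
      have "x' \<noteq> y'" using xy' xy(3) by auto
      then have "(x', y') \<in> parcs G'" using adj xy' ab by blast
      then show "(x, y) \<in> parcs ?G" unfolding contract_edge_simps using xy' xy(3) by blast
    qed
  qed
  moreover have "\<forall>x\<in>pverts ?G. K x \<subseteq> pverts G" using H(2) uv unfolding V by (auto simp: K_def)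
  ultimately show ?case by (intro conjI exI[of _ K] contract_edge_wf[OF wf(1)] contract_edge_irrefl)
qed

lemma induced_minor_model:
  fixes G :: "'a pair_pre_digraph" and F :: "'b pair_pre_digraph"
  assumes G: "pair_graph G" and m: "induced_minor F G"
  shows "\<exists>H. minor_model (parcs G) (pverts F) (parcs F) H \<and> (\<forall>v\<in>pverts F. H v \<subseteq> pverts G)"
proof -
  obtain G' G'' where G': "induced_subgraph (with_proj G') (with_proj G)" and c: "contracts_to G' G''"
    and iso: "digraph_iso (with_proj G'') (with_proj F)"
    using m unfolding induced_minor_def by blast
  have sub: "pverts G' \<subseteq> pverts G" "parcs G' = Restr (parcs G) (pverts G')"
    using G' induced_subgraph_pair_iff G by (auto simp: pair_graph_iff)
  have "pair_graph G'" using G finite_subset[OF sub(1)] unfolding pair_graph_iff sub(2)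
    by (auto simp: sym_def irrefl_def)
  from contracts_to_model[OF c this] obtain H where wf: "parcs G'' \<subseteq> pverts G'' \<times> pverts G''" "irrefl (parcs G'')"
    and H: "minor_model (parcs G') (pverts G'') (parcs G'') H" "\<forall>v\<in>pverts G''. H v \<subseteq> pverts G'" by blast
  obtain f where f: "inj_on f (pverts G'')" "pverts F = f ` pverts G''" "parcs F = map_prod f f ` parcs G''"
    using iso unfolding digraph_iso_pair_iff[OF wf(1)] by (elim exE conjE)
  define g where "g = the_inv_into (pverts G'') f"
  have g: "g (f x) = x" if "x \<in> pverts G''" for x using that f(1) by (simp add: g_def the_inv_into_f_f)
  have fedge: "(f x, f y) \<in> parcs F \<longleftrightarrow> (x, y) \<in> parcs G''" if "x \<in> pverts G''" "y \<in> pverts G''" for x y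
  proof
    assume "(f x, f y) \<in> parcs F"
    then obtain x' y' where e: "(x', y') \<in> parcs G''" "f x = f x'" "f y = f y'" unfolding f(3) by auto
    then have "x' \<in> pverts G''" "y' \<in> pverts G''" using wf(1) by auto
    with e show "(x, y) \<in> parcs G''" using inj_onD[OF f(1)] that by metis
  next
    assume "(x, y) \<in> parcs G''"
    then show "(f x, f y) \<in> parcs F" unfolding f(3) by (rule rev_image_eqI) simp
  qed
  have "minor_model (parcs G) (pverts F) (parcs F) (H \<circ> g)" unfolding minor_model_def
  proof (intro conjI ballI impI)
    fix v assume "v \<in> pverts F"
    then obtain x where x: "x \<in> pverts G''" "v = f x" using f(2) by blast
    have "conn_in (parcs G') (H x)" using H(1) x by (simp add: minor_model_def)
    then have "conn_in (parcs G) (H x)" by (rule conn_in_mono_edges) (use sub(2) in blast)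
    then show "conn_in (parcs G) ((H \<circ> g) v)" using x g by simp
  next
    fix v w assume vw: "v \<in> pverts F" "w \<in> pverts F" "v \<noteq> w"
    then obtain x y where x: "x \<in> pverts G''" "v = f x" "y \<in> pverts G''" "w = f y" using f(2) by blast
    have "x \<noteq> y" using x vw by blast
    then have "H x \<inter> H y = {}" "(x, y) \<in> parcs G'' \<longleftrightarrow> (\<exists>a\<in>H x. \<exists>b\<in>H y. (a, b) \<in> parcs G')"
      using H(1) x by (auto simp: minor_model_def)
    moreover have "(\<exists>a\<in>H x. \<exists>b\<in>H y. (a, b) \<in> parcs G') \<longleftrightarrow> (\<exists>a\<in>H x. \<exists>b\<in>H y. (a, b) \<in> parcs G)"
      using H(2) x sub(2) by blast
    ultimately show "(H \<circ> g) v \<inter> (H \<circ> g) w = {}"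
      "(v, w) \<in> parcs F \<longleftrightarrow> (\<exists>a\<in>(H \<circ> g) v. \<exists>b\<in>(H \<circ> g) w. (a, b) \<in> parcs G)"
      using x g fedge by simp_all
  qed
  moreover have "\<forall>v\<in>pverts F. (H \<circ> g) v \<subseteq> pverts G" using H(2) f(2) g sub(1) by fastforce
  ultimately show ?thesis by blast
qed

text \<open>Contracting an edge inside a hub keeps a model spanning, so contraction continues until every hub
  is a single vertex.\<close>

lemma spanning_model_contracts:
  fixes G :: "'a pair_pre_digraph" and F :: "'b pair_pre_digraph"
  assumes F: "pair_graph F" and c: "contracts_to G0 G" and G: "pair_graph G"
    and m: "minor_model (parcs G) (pverts F) (parcs F) H" and span: "\<Union>(H ` pverts F) = pverts G"
  shows "\<exists>G'. contracts_to G0 G' \<and> digraph_iso (with_proj G') (with_proj F)"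
  using c G m span
proof (induction "card (pverts G)" arbitrary: G H rule: less_induct)
  case less
  note G = less.prems(2) and m = less.prems(3) and span = less.prems(4)
  have Gp: "finite (pverts G)" "parcs G \<subseteq> pverts G \<times> pverts G" "sym (parcs G)" "irrefl (parcs G)"
    using G by (auto simp: pair_graph_iff)
  have disj: "H x \<inter> H y = {}" if "x \<in> pverts F" "y \<in> pverts F" "x \<noteq> y" for x y
    using m that by (simp add: minor_model_def)
  have adj: "(x, y) \<in> parcs F \<longleftrightarrow> (\<exists>a\<in>H x. \<exists>b\<in>H y. (a, b) \<in> parcs G)"
    if "x \<in> pverts F" "y \<in> pverts F" "x \<noteq> y" for x y
    using m that by (simp add: minor_model_def)
  have conn: "conn_in (parcs G) (H x)" if "x \<in> pverts F" for x using m that by (simp add: minor_model_def)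
  show ?case
  proof (cases "\<forall>x\<in>pverts F. \<exists>a. H x = {a}")
    case True
    then obtain h where h: "\<And>x. x \<in> pverts F \<Longrightarrow> H x = {h x}" by metis
    have hinj: "inj_on h (pverts F)" using disj h by (fastforce simp: inj_on_def)
    have hV: "pverts G = h ` pverts F" using span h by auto
    have hadj: "(h x, h y) \<in> parcs G \<longleftrightarrow> (x, y) \<in> parcs F" if "x \<in> pverts F" "y \<in> pverts F" for x y
    proof (cases "x = y")
      case True
      then show ?thesis using Gp(4) F by (auto simp: irrefl_def pair_graph_iff)
    next
      case False
      then show ?thesis using adj[OF that] h that by simp
    qed
    define g where "g = the_inv_into (pverts F) h"
    have g: "g (h x) = x" if "x \<in> pverts F" for x using that hinj by (simp add: g_def the_inv_into_f_f)
    have "inj_on g (pverts G)" using g unfolding hV by (auto intro!: inj_onI)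
    moreover have "pverts F = g ` pverts G" using g unfolding hV by force
    moreover have "parcs F = map_prod g g ` parcs G"
    proof (intro equalityI subsetI)
      fix e assume e: "e \<in> parcs F"
      obtain x y where xy: "e = (x, y)" by (cases e)
      then have "x \<in> pverts F" "y \<in> pverts F" using e F by (auto simp: pair_graph_iff)
      then show "e \<in> map_prod g g ` parcs G"
        using e xy g hadj by (intro image_eqI[of _ _ "(h x, h y)"]) auto
    next
      fix e assume "e \<in> map_prod g g ` parcs G"
      then obtain a b where ab: "(a, b) \<in> parcs G" "e = (g a, g b)" by auto
      then obtain x y where xy: "x \<in> pverts F" "y \<in> pverts F" "a = h x" "b = h y" using Gp(2) hV by blast
      then show "e \<in> parcs F" using ab g hadj by simp
    qed
    ultimately have "digraph_iso (with_proj G) (with_proj F)"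
      by (subst digraph_iso_pair_iff[OF Gp(2)]) (intro exI[of _ g] conjI)
    then show ?thesis using less.prems(1) by blast
  next
    case False
    then obtain z where z: "z \<in> pverts F" "\<nexists>a. H z = {a}" by blast
    obtain a where a: "a \<in> H z" using conn_in_nonempty[OF conn[OF z(1)]] by blast
    then have "{a} \<subseteq> H z" "{a} \<noteq> {}" "{a} \<noteq> H z" using z(2) by auto
    from conn_in_cut[OF conn[OF z(1)] this] obtain b where b: "b \<in> H z" "b \<noteq> a" "(a, b) \<in> parcs G" by blast
    let ?G = "contract_edge G a b" and ?r = "merge a b"
    have ab: "a \<in> pverts G" "b \<in> pverts G" using b(3) Gp(2) by auto
    have V: "pverts ?G = pverts G - {b}" using ab b(2) by (auto simp: contract_edge_simps merge_def)
    \<comment> \<open>Both ends of the contracted edge lie in the hub of \<open>z\<close>, so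
      vertices of different hubs are never identified.\<close>
    have mergeH: "u = v" if "u \<in> pverts F" "v \<in> pverts F" "x \<in> H u" "y \<in> H v" "?r x = ?r y" for u v x y
    proof (rule ccontr)
      assume ne: "u \<noteq> v"
      have "x \<noteq> y" using disj[OF that(1,2) ne] that(3,4) by blast
      then have "x \<in> H z" "y \<in> H z" using that(5) a b by (auto simp: merge_def split: if_splits)
      then have "u = z" "v = z" using disj that(1-4) z(1) by blast+
      with ne show False by simp
    qed
    define K where "K v = ?r ` H v" for v
    have "\<exists>G'. contracts_to G0 G' \<and> digraph_iso (with_proj G') (with_proj F)"
    proof (rule less.hyps)
      show "card (pverts ?G) < card (pverts G)" unfolding V using Gp(1) ab(2) by (rule card_Diff1_less)
      show "contracts_to G0 ?G" by (rule contracts_to.step[OF less.prems(1) b(3)])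
      show "pair_graph ?G" unfolding pair_graph_iff
        by (intro conjI contract_edge_wf contract_edge_sym contract_edge_irrefl) (simp_all add: Gp V)
      show "\<Union>(K ` pverts F) = pverts ?G" unfolding contract_edge_simps K_def span[symmetric] by blast
      show "minor_model (parcs ?G) (pverts F) (parcs F) K" unfolding minor_model_def
      proof (intro conjI ballI impI)
        fix v assume "v \<in> pverts F"
        then show "conn_in (parcs ?G) (K v)" unfolding K_def
          by (intro conn_in_image[OF conn]) (auto simp: contract_edge_simps)
      next
        fix u v assume uv: "u \<in> pverts F" "v \<in> pverts F" "u \<noteq> v"
        show disjK: "K u \<inter> K v = {}" using mergeH[OF uv(1,2)] uv(3) unfolding K_def by blast
        show "(u, v) \<in> parcs F \<longleftrightarrow> (\<exists>x\<in>K u. \<exists>y\<in>K v. (x, y) \<in> parcs ?G)"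
        proof
          assume "(u, v) \<in> parcs F"
          then obtain x y where xy: "x \<in> H u" "y \<in> H v" "(x, y) \<in> parcs G" using adj[OF uv] by blast
          have "?r x \<noteq> ?r y" using mergeH[OF uv(1,2) xy(1,2)] uv(3) by blast
          then have "(?r x, ?r y) \<in> parcs ?G" using xy(3) unfolding contract_edge_simps by blast
          then show "\<exists>x\<in>K u. \<exists>y\<in>K v. (x, y) \<in> parcs ?G" using xy unfolding K_def by blast
        next
          assume "\<exists>x\<in>K u. \<exists>y\<in>K v. (x, y) \<in> parcs ?G"
          then obtain x y where xy: "x \<in> K u" "y \<in> K v" "(x, y) \<in> parcs ?G" by blast
          then obtain x' y' where xy': "x = ?r x'" "y = ?r y'" "(x', y') \<in> parcs G"
            by (auto simp: contract_edge_simps)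
          then obtain u' v' where uv': "u' \<in> pverts F" "x' \<in> H u'" "v' \<in> pverts F" "y' \<in> H v'"
            using Gp(2) span by blast
          have "u' = u" "v' = v" using mergeH uv' uv xy(1,2) xy'(1,2) unfolding K_def by blast+
          then show "(u, v) \<in> parcs F" using adj[OF uv] uv' xy'(3) by blast
        qed
      qed
    qed
    then show ?thesis .
  qed
qed

text \<open>The model becomes spanning in the subgraph induced by the union of its hubs.\<close>

lemma model_induced_minor:
  fixes G :: "'a pair_pre_digraph" and F :: "'b pair_pre_digraph"
  assumes G: "pair_graph G" and F: "pair_graph F"
    and m: "minor_model (parcs G) (pverts F) (parcs F) H" and sub: "\<forall>v\<in>pverts F. H v \<subseteq> pverts G"
  shows "induced_minor F G"
proof -
  define M where "M = \<Union>(H ` pverts F)"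
  define G' where "G' = \<lparr>pverts = M, parcs = Restr (parcs G) M\<rparr>"
  have M: "M \<subseteq> pverts G" using sub by (auto simp: M_def)
  have sub': "induced_subgraph (with_proj G') (with_proj G)"
    using G M by (subst induced_subgraph_pair_iff) (auto simp: pair_graph_iff G'_def)
  have G': "pair_graph G'"
    using G finite_subset[OF M] by (auto simp: pair_graph_iff G'_def sym_def irrefl_def)
  have "minor_model (parcs G') (pverts F) (parcs F) H" unfolding minor_model_def
  proof (intro conjI ballI impI)
    fix v assume v: "v \<in> pverts F"
    have "conn_in (Restr (parcs G) (H v)) (H v)" using m v by (simp add: conn_in_Restr minor_model_def)
    then show "conn_in (parcs G') (H v)" by (rule conn_in_mono_edges) (use v in \<open>auto simp: G'_def M_def\<close>)
  next
    fix u v assume uv: "u \<in> pverts F" "v \<in> pverts F" "u \<noteq> v"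
    then show "H u \<inter> H v = {}" using m by (simp add: minor_model_def)
    have "H u \<subseteq> M" "H v \<subseteq> M" using uv by (auto simp: M_def)
    then have "(\<exists>x\<in>H u. \<exists>y\<in>H v. (x, y) \<in> parcs G') \<longleftrightarrow> (\<exists>x\<in>H u. \<exists>y\<in>H v. (x, y) \<in> parcs G)"
      by (auto simp: G'_def)
    then show "(u, v) \<in> parcs F \<longleftrightarrow> (\<exists>x\<in>H u. \<exists>y\<in>H v. (x, y) \<in> parcs G')"
      using m uv by (simp add: minor_model_def)
  qed
  moreover have "\<Union>(H ` pverts F) = pverts G'" by (simp add: G'_def M_def)
  ultimately show ?thesis
    using spanning_model_contracts[OF F contracts_to.refl G'] sub' unfolding induced_minor_def by blast
qed

section \<open>Trees that force large independent sets in a bag\<close>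

text \<open>The independent set is required to lie in the hubs: for a copy inside a larger tree,
  this makes it anticomplete to all hubs not adjacent to the copy.\<close>

definition forces_wide :: "('a \<times> 'a) set \<Rightarrow> 'b set \<Rightarrow> ('b \<times> 'b) set \<Rightarrow> nat \<Rightarrow> bool" where
  "forces_wide E V F k \<longleftrightarrow> (\<forall>X Bs H. path_dec E X Bs \<longrightarrow> minor_model E V F H \<longrightarrow> (\<forall>v\<in>V. H v \<subseteq> X) \<longrightarrow>
     (\<exists>B\<in>set Bs. \<exists>I\<subseteq>B \<inter> \<Union>(H ` V). finite I \<and> indep E I \<and> card I = k))"

lemma forces_wideD:
  assumes "forces_wide E V F k" "path_dec E X Bs" "minor_model E V F H" "\<forall>v\<in>V. H v \<subseteq> X"
  obtains j I where "j < length Bs" "I \<subseteq> Bs ! j" "I \<subseteq> \<Union>(H ` V)" "finite I" "indep E I" "card I = k"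
proof -
  obtain B I where "B \<in> set Bs" "I \<subseteq> B \<inter> \<Union>(H ` V)" "finite I" "indep E I" "card I = k"
    using assms unfolding forces_wide_def by metis
  then show ?thesis using that unfolding in_set_conv_nth by blast
qed

text \<open>If \<open>Q\<close> missed bag \<open>j\<close>, its vertices occurring before
  \<open>j\<close> would never occur later. An edge of \<open>Q\<close> lies in a single bag and
  could not join these vertices to the rest of \<open>Q\<close>.\<close>

lemma path_dec_between:
  assumes pd: "path_dec E X Bs" and Q: "conn_in E Q" "Q \<subseteq> X"
    and ij: "i \<le> j" "j \<le> l" "l < length Bs" and meet: "Q \<inter> Bs ! i \<noteq> {}" "Q \<inter> Bs ! l \<noteq> {}"
  shows "Q \<inter> Bs ! j \<noteq> {}"
proof
  assume empty: "Q \<inter> Bs ! j = {}"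
  note pd = path_decD[OF pd]
  define S where "S = (\<Union>m<j. Bs ! m)"
  obtain a b where ab: "a \<in> Q" "a \<in> Bs ! i" "b \<in> Q" "b \<in> Bs ! l" using meet by blast
  have far: "x \<notin> Bs ! n" if "x \<in> Q" "x \<in> S" "j \<le> n" "n < length Bs" for x n
  proof
    assume n: "x \<in> Bs ! n"
    obtain m where m: "m < j" "x \<in> Bs ! m" using \<open>x \<in> S\<close> by (auto simp: S_def)
    have "x \<in> Bs ! j" using pd(4)[of m j n] m n that by auto
    then show False using empty that by blast
  qed
  have "i \<noteq> j" using ab empty by blast
  then have "a \<in> S" using ab ij by (auto simp: S_def)
  moreover have "b \<notin> S" using far[OF ab(3) _ ij(2,3)] ab(4) by blast
  ultimately obtain x y where xy: "x \<in> Q" "x \<in> S" "y \<in> Q" "y \<notin> S" "(x, y) \<in> E"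
    using conn_in_cut'[OF Q(1) ab(1) _ ab(3)] by metis
  then obtain B where "B \<in> set Bs" "x \<in> B" "y \<in> B" using pd(3)[of x y] Q(2) by blast
  then obtain n where n: "n < length Bs" "x \<in> Bs ! n" "y \<in> Bs ! n" by (metis in_set_conv_nth)
  have "\<not> n < j" using n(3) xy(4) by (auto simp: S_def)
  then show False using far[OF xy(1,2) _ n(1)] n(2) by simp
qed

lemma (in ugraph) hub_union_connected:
  assumes "rooted_tree V F r" "\<And>v. v \<in> V \<Longrightarrow> conn_in E (H v)"
    and "\<And>u v. (u, v) \<in> F \<Longrightarrow> \<exists>x\<in>H u. \<exists>y\<in>H v. (x, y) \<in> E"
  shows "conn_in E (\<Union>(H ` V))"
  using assms
proof (induction rule: rooted_tree.induct)
  case (single r)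
  then show ?case by simp
next
  case (join V1 F1 r1 V2 F2 r2)
  have "conn_in E (\<Union>(H ` V1))" by (rule join.IH(1)) (simp_all add: join.prems)
  moreover have "conn_in E (\<Union>(H ` V2))" by (rule join.IH(2)) (simp_all add: join.prems)
  moreover obtain x y where xy: "x \<in> H r1" "y \<in> H r2" "(x, y) \<in> E" using join.prems(2)[of r1 r2] by auto
  moreover have "x \<in> \<Union>(H ` V1)" "y \<in> \<Union>(H ` V2)"
    using xy rooted_tree_root[OF join.hyps(1)] rooted_tree_root[OF join.hyps(2)] by auto
  ultimately have "conn_in E (\<Union>(H ` V1) \<union> \<Union>(H ` V2))" by (intro conn_in_touch)
  then show ?case by (simp add: image_Un)
qed

lemma three_sorted:
  fixes b :: "nat \<Rightarrow> nat"
  obtains p q s where "{p, q, s} = {0, 1, 2}" "b p \<le> b q" "b q \<le> b s"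
proof -
  consider "b 0 \<le> b 1" "b 1 \<le> b 2" | "b 0 \<le> b 2" "b 2 \<le> b 1" | "b 1 \<le> b 0" "b 0 \<le> b 2"
    | "b 1 \<le> b 2" "b 2 \<le> b 0" | "b 2 \<le> b 0" "b 0 \<le> b 1" | "b 2 \<le> b 1" "b 1 \<le> b 0" by linarith
  then show ?thesis
  proof cases
    case 1 show ?thesis by (rule that[of 0 1 2]) (use 1 in auto)
  next
    case 2 show ?thesis by (rule that[of 0 2 1]) (use 2 in auto)
  next
    case 3 show ?thesis by (rule that[of 1 0 2]) (use 3 in auto)
  next
    case 4 show ?thesis by (rule that[of 1 2 0]) (use 4 in auto)
  next
    case 5 show ?thesis by (rule that[of 2 0 1]) (use 5 in auto)
  next
    case 6 show ?thesis by (rule that[of 2 1 0]) (use 6 in auto)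
  qed
qed

text \<open>A construction able to avoid any finite set of names can be repeated on disjoint vertex
  sets; \<open>c\<close> packs its remaining data, such as edges and root.\<close>

lemma disjoint_family_extend:
  fixes P :: "nat set \<Rightarrow> 'c \<Rightarrow> bool"
  assumes "\<forall>A. finite A \<longrightarrow> (\<exists>V c. P V c \<and> finite V \<and> V \<inter> A = {})" "finite A"
  shows "\<exists>V c. \<forall>q<(n::nat). P (V q) (c q) \<and> finite (V q) \<and> V q \<inter> A = {} \<and> (\<forall>p<q. V p \<inter> V q = {})"
proof (induction n)
  case (Suc n)
  then obtain V c where V: "\<forall>q<n. P (V q) (c q) \<and> finite (V q) \<and> V q \<inter> A = {} \<and> (\<forall>p<q. V p \<inter> V q = {})"
    by (elim exE)
  have "finite (A \<union> (\<Union>q<n. V q))" using V assms(2) by simp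
  from assms(1)[rule_format, OF this] obtain V' c' where V': "P V' c'" "finite V'" "V' \<inter> (A \<union> (\<Union>q<n. V q)) = {}"
    by (elim exE conjE)
  have "\<forall>q<Suc n. P ((V(n := V')) q) ((c(n := c')) q) \<and> finite ((V(n := V')) q) \<and> (V(n := V')) q \<inter> A = {} \<and>
      (\<forall>p<q. (V(n := V')) p \<inter> (V(n := V')) q = {})"
  proof (intro allI impI)
    fix q assume "q < Suc n"
    then consider "q < n" | "q = n" by linarith
    then show "P ((V(n := V')) q) ((c(n := c')) q) \<and> finite ((V(n := V')) q) \<and> (V(n := V')) q \<inter> A = {} \<and>
      (\<forall>p<q. (V(n := V')) p \<inter> (V(n := V')) q = {})"
    proof cases
      case 1
      then show ?thesis using V by auto
    next
      case 2
      then show ?thesis using V' by auto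
    qed
  qed
  then show ?case by (intro exI)
qed simp

text \<open>Three copies of the previous tree hang from a new root \<open>c\<close>, copy \<open>q\<close> through a new vertex \<open>a q\<close>.
  The path decomposition orders the three bags found in the copies; the rest of the tree, without the middle
  copy and its \<open>a q\<close>, is connected and far from that copy, yet meets the middle bag.\<close>

lemma forces_wide_step:
  fixes V :: "nat \<Rightarrow> 'b set" and F :: "nat \<Rightarrow> ('b \<times> 'b) set" and r a :: "nat \<Rightarrow> 'b" and c :: 'b and Q :: "nat set"
  defines "SV \<equiv> \<lambda>Q. {c} \<union> (\<Union>q\<in>Q. V q \<union> {a q})"
    and "SF \<equiv> \<lambda>Q. \<Union>q\<in>Q. F q \<union> {} \<union> {(r q, a q), (a q, r q)} \<union> {(a q, c), (c, a q)}"
  assumes Q: "Q = {0, 1, 2}"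
    and tree: "\<And>q. q \<in> Q \<Longrightarrow> rooted_tree (V q) (F q) (r q)"
    and disj: "\<And>p q. p \<in> Q \<Longrightarrow> q \<in> Q \<Longrightarrow> p \<noteq> q \<Longrightarrow> V p \<inter> V q = {}"
    and new: "\<And>p q. p \<in> Q \<Longrightarrow> q \<in> Q \<Longrightarrow> a p \<notin> V q" "\<And>q. q \<in> Q \<Longrightarrow> c \<notin> V q" "c \<notin> a ` Q" "inj_on a Q"
  shows "rooted_tree (SV Q) (SF Q) c"
    and "ugraph E \<Longrightarrow> 0 < k \<Longrightarrow> (\<And>q. q \<in> Q \<Longrightarrow> forces_wide E (V q) (F q) k) \<Longrightarrow> forces_wide E (SV Q) (SF Q) (Suc k)"
proof -
  have "finite Q" by (simp add: Q)
  \<comment> \<open>Proved for every subset of the copies, because the tree without the middle copy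
    is needed as well.\<close>
  have rooted: "rooted_tree (SV R) (SF R) c" if "R \<subseteq> Q" for R
    using finite_subset[OF that \<open>finite Q\<close>] that
  proof (induction R rule: finite_induct)
    case empty
    then show ?case by (simp add: SV_def SF_def rooted_tree.single)
  next
    case (insert q R)
    then have q: "q \<in> Q" "R \<subseteq> Q" by auto
    have tq: "rooted_tree (V q \<union> {a q}) (F q \<union> {} \<union> {(r q, a q), (a q, r q)}) (a q)"
      by (rule rooted_tree.join[OF tree[OF q(1)] rooted_tree.single]) (use new(1) q in auto)
    have apart: "(V q \<union> {a q}) \<inter> SV R = {}"
    proof -
      have "V q \<inter> V p = {} \<and> a q \<noteq> a p \<and> a q \<notin> V p \<and> a p \<notin> V q" if "p \<in> R" for p
      proof -
        have p: "p \<in> Q" "p \<noteq> q" using that insert.hyps(2) q(2) by auto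
        then have "a q \<noteq> a p" using inj_onD[OF new(4), of q p] q(1) by auto
        then show ?thesis using disj[of q p] new(1)[of p q] new(1)[of q p] p q(1) by auto
      qed
      moreover have "c \<notin> V q" "c \<noteq> a q" using new(2,3) q(1) by auto
      ultimately show ?thesis unfolding SV_def by blast
    qed
    have "rooted_tree ((V q \<union> {a q}) \<union> SV R)
        ((F q \<union> {} \<union> {(r q, a q), (a q, r q)}) \<union> SF R \<union> {(a q, c), (c, a q)}) c"
      by (rule rooted_tree.join[OF tq insert.IH[OF q(2)] apart])
    moreover have "(V q \<union> {a q}) \<union> SV R = SV (insert q R)" by (auto simp: SV_def)
    moreover have "(F q \<union> {} \<union> {(r q, a q), (a q, r q)}) \<union> SF R \<union> {(a q, c), (c, a q)} = SF (insert q R)"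
      unfolding SF_def by blast
    ultimately show ?case by (simp only:)
  qed
  then show "rooted_tree (SV Q) (SF Q) c" by blast
  assume "ugraph E" and k: "0 < k" and wide: "\<And>q. q \<in> Q \<Longrightarrow> forces_wide E (V q) (F q) k"
  interpret ugraph E by fact
  have edges: "F q \<subseteq> V q \<times> V q" "r q \<in> V q" if "q \<in> Q" for q
    using rooted_tree_edges[OF tree[OF that]] rooted_tree_root[OF tree[OF that]] by auto
  have own: "(u, v) \<in> SF Q \<longleftrightarrow> (u, v) \<in> F q" if q: "q \<in> Q" and uv: "u \<in> V q" "v \<in> V q" for q u v
  proof
    assume "(u, v) \<in> SF Q"
    then obtain p where p: "p \<in> Q" "(u, v) \<in> F p \<union> {} \<union> {(r p, a p), (a p, r p)} \<union> {(a p, c), (c, a p)}"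
      by (auto simp: SF_def)
    then have "(u, v) \<in> F p" using new(1)[OF p(1) q] new(2)[OF q] uv by auto
    moreover from this have "p = q" using edges(1)[OF p(1)] disj[OF p(1) q] uv by auto
    ultimately show "(u, v) \<in> F q" by simp
  next
    assume "(u, v) \<in> F q"
    then show "(u, v) \<in> SF Q" using q by (auto simp: SF_def)
  qed
  \<comment> \<open>The only edge leaving copy \<open>q\<close> goes to \<open>a q\<close>, which is
    left out together with the copy. Without this subdividing vertex, \<open>c\<close> would be
    adjacent to the copy.\<close>
  have far: "u \<noteq> v \<and> (u, v) \<notin> SF Q" if q: "q \<in> Q" and u: "u \<in> V q" and v: "v \<in> SV (Q - {q})" for q u v
  proof -
    consider "v = c" | p where "p \<in> Q" "p \<noteq> q" "v \<in> V p" | p where "p \<in> Q" "p \<noteq> q" "v = a p"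
      using v by (auto simp: SV_def)
    then have ne: "u \<noteq> v \<and> v \<notin> V q \<and> v \<noteq> a q"
    proof cases
      case 1
      then show ?thesis using new(2)[OF q] new(3) u q by auto
    next
      case (2 p)
      then show ?thesis using disj[OF 2(1) q 2(2)] new(1)[OF q 2(1)] u by auto
    next
      case (3 p)
      then show ?thesis using inj_onD[OF new(4), of p q] new(1)[OF 3(1) q] u q by auto
    qed
    have "(u, v) \<notin> SF Q"
    proof
      assume "(u, v) \<in> SF Q"
      then obtain p where p: "p \<in> Q" "(u, v) \<in> F p \<union> {} \<union> {(r p, a p), (a p, r p)} \<union> {(a p, c), (c, a p)}"
        by (auto simp: SF_def)
      have "u \<noteq> a p" "u \<noteq> c" using new(1)[OF p(1) q] new(2)[OF q] u by auto
      then have "u \<in> V p" "v \<in> V p \<or> v = a p" using p(2) edges[OF p(1)] by auto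
      then show False using disj[OF p(1) q] u ne by (cases "p = q") auto
    qed
    with ne show ?thesis by simp
  qed
  show "forces_wide E (SV Q) (SF Q) (Suc k)" unfolding forces_wide_def
  proof (intro allI impI)
    fix X Bs H assume pd: "path_dec E X Bs" and m: "minor_model E (SV Q) (SF Q) H" and sub: "\<forall>v\<in>SV Q. H v \<subseteq> X"
    have VS: "V q \<subseteq> SV Q" if "q \<in> Q" for q using that by (auto simp: SV_def)
    have adj: "(u, v) \<in> SF Q \<longleftrightarrow> (\<exists>x\<in>H u. \<exists>y\<in>H v. (x, y) \<in> E)" "H u \<inter> H v = {}"
      if "u \<in> SV Q" "v \<in> SV Q" "u \<noteq> v" for u v using m that by (simp_all add: minor_model_def)
    have "\<exists>j I. j < length Bs \<and> I \<subseteq> Bs ! j \<and> I \<subseteq> \<Union>(H ` V q) \<and> finite I \<and> indep E I \<and> card I = k" if q: "q \<in> Q" for q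
    proof -
      have "minor_model E (V q) (F q) H" unfolding minor_model_def
      proof (intro conjI ballI impI)
        fix v assume "v \<in> V q"
        then show "conn_in E (H v)" using m VS[OF q] by (auto simp: minor_model_def)
      next
        fix u v assume uv: "u \<in> V q" "v \<in> V q" "u \<noteq> v"
        then have S: "u \<in> SV Q" "v \<in> SV Q" using VS[OF q] by auto
        show "H u \<inter> H v = {}" "(u, v) \<in> F q \<longleftrightarrow> (\<exists>x\<in>H u. \<exists>y\<in>H v. (x, y) \<in> E)"
          using adj[OF S uv(3)] own[OF q uv(1,2)] by simp_all
      qed
      moreover have "\<forall>v\<in>V q. H v \<subseteq> X" using sub VS[OF q] by blast
      ultimately show ?thesis by (rule forces_wideD[OF wide[OF q] pd]) blast
    qed
    then obtain j I where jI: "\<And>q. q \<in> Q \<Longrightarrow> j q < length Bs \<and> I q \<subseteq> Bs ! j q \<and> I q \<subseteq> \<Union>(H ` V q) \<and>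
        finite (I q) \<and> indep E (I q) \<and> card (I q) = k" by metis
    obtain p q s where pqs: "{p, q, s} = Q" "j p \<le> j q" "j q \<le> j s" using three_sorted[of j] Q by metis
    have "card {p, q, s} = 3" unfolding pqs(1) Q by simp
    then have ne: "p \<noteq> q" "s \<noteq> q" by (auto simp: card_insert_if split: if_splits)
    have q: "q \<in> Q" and ps: "p \<in> Q - {q}" "s \<in> Q - {q}" using pqs(1) ne by auto
    define W where "W = \<Union>(H ` SV (Q - {q}))"
    have SR: "SV (Q - {q}) \<subseteq> SV Q" "SF (Q - {q}) \<subseteq> SF Q" unfolding SV_def SF_def by blast+
    have T: "rooted_tree (SV (Q - {q})) (SF (Q - {q})) c" by (rule rooted) blast
    have "conn_in E W" unfolding W_def
    proof (rule hub_union_connected[OF T])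
      fix v assume "v \<in> SV (Q - {q})"
      then show "conn_in E (H v)" using m SR(1) by (auto simp: minor_model_def)
    next
      fix u v assume uv: "(u, v) \<in> SF (Q - {q})"
      then have "u \<in> SV Q" "v \<in> SV Q" "u \<noteq> v"
        using rooted_tree_edges[OF T] rooted_tree_irrefl[OF T] SR(1) by (auto simp: irrefl_def)
      then show "\<exists>x\<in>H u. \<exists>y\<in>H v. (x, y) \<in> E" using adj(1) uv SR(2) by blast
    qed
    moreover have "W \<subseteq> X" using sub SR(1) unfolding W_def by blast
    moreover have meets: "W \<inter> Bs ! j p' \<noteq> {}" if "p' \<in> Q - {q}" for p'
    proof -
      have p': "p' \<in> Q" using that by simp
      \<comment> \<open>Here \<open>0 < k\<close> matters: a nonempty independent set certifies that
        the bag meets the copy.\<close>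
      have "I p' \<noteq> {}" using jI[OF p'] k by auto
      moreover have "V p' \<subseteq> SV (Q - {q})" using that by (auto simp: SV_def)
      ultimately show ?thesis using jI[OF p'] unfolding W_def by blast
    qed
    ultimately have "W \<inter> Bs ! j q \<noteq> {}"
      using jI[of s] ps(2) by (intro path_dec_between[OF pd _ _ pqs(2,3) _ meets[OF ps(1)] meets[OF ps(2)]]) auto
    then obtain w v where w: "w \<in> Bs ! j q" "w \<in> H v" "v \<in> SV (Q - {q})" by (auto simp: W_def)
    have apart: "x \<noteq> w \<and> (x, w) \<notin> E" if x: "x \<in> I q" for x
    proof -
      obtain u where u: "u \<in> V q" "x \<in> H u" using jI[OF q] x by blast
      have "u \<in> SV Q" "v \<in> SV Q" "u \<noteq> v" "(u, v) \<notin> SF Q"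
        using u w(3) VS[OF q] SR(1) far[OF q u(1) w(3)] by auto
      then show ?thesis using adj[of u v] u(2) w(2) by blast
    qed
    have "indep E (insert w (I q))"
      using jI[OF q] apart E_irrefl E_sym[of w] unfolding indep_def by blast
    moreover have "card (insert w (I q)) = Suc k" using jI[OF q] apart by (subst card_insert_disjoint) auto
    moreover have "insert w (I q) \<subseteq> \<Union>(H ` SV Q)" using jI[OF q] VS[OF q] w SR(1) by blast
    moreover have "Bs ! j q \<in> set Bs" using jI[OF q] by simp
    ultimately show "\<exists>B\<in>set Bs. \<exists>I\<subseteq>B \<inter> \<Union>(H ` SV Q). finite I \<and> indep E I \<and> card I = Suc k"
      using jI[OF q] w(1) by (intro bexI[of _ "Bs ! j q"] exI[of _ "insert w (I q)"]) auto
  qed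
qed

lemma forces_wide_tree:
  assumes "finite A"
  shows "\<exists>V F r. rooted_tree V F r \<and> (V :: nat set) \<inter> A = {} \<and>
    (\<forall>E :: ('a \<times> 'a) set. ugraph E \<longrightarrow> forces_wide E V F (Suc k))"
  using assms
proof (induction k arbitrary: A)
  case 0
  obtain r where r: "r \<notin> A" using ex_new_if_finite[OF infinite_UNIV_nat 0] by blast
  have "forces_wide E {r} {} (Suc 0)" if "ugraph E" for E :: "('a \<times> 'a) set" unfolding forces_wide_def
  proof (intro allI impI)
    fix X Bs H assume pd: "path_dec E X Bs" and m: "minor_model E {r} {} H" and sub: "\<forall>v\<in>{r}. H v \<subseteq> X"
    have "conn_in E (H r)" using m by (simp add: minor_model_def)
    then obtain x where x: "x \<in> H r" using conn_in_nonempty by blast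
    then obtain B where B: "B \<in> set Bs" "x \<in> B" using path_decD(2)[OF pd] sub by blast
    show "\<exists>B\<in>set Bs. \<exists>I\<subseteq>B \<inter> \<Union>(H ` {r}). finite I \<and> indep E I \<and> card I = Suc 0"
      using x B ugraph.E_irrefl[OF that] by (intro bexI[of _ B] exI[of _ "{x}"]) (auto simp: indep_def)
  qed
  then show ?case using r rooted_tree.single[of r] by (intro exI[of _ "{r}"] exI[of _ "{}"] exI[of _ r]) auto
next
  case (Suc k)
  define P where "P V c \<longleftrightarrow> rooted_tree V (fst c) (snd c) \<and>
    (\<forall>E :: ('a \<times> 'a) set. ugraph E \<longrightarrow> forces_wide E V (fst c) (Suc k))" for V :: "nat set" and c
  have "\<exists>V c. P V c \<and> finite V \<and> V \<inter> A' = {}" if A': "finite A'" for A' :: "nat set"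
  proof -
    from Suc.IH[OF A'] obtain V F r where V: "rooted_tree V F r" "V \<inter> A' = {}"
      "\<forall>E :: ('a \<times> 'a) set. ugraph E \<longrightarrow> forces_wide E V F (Suc k)" by (elim exE conjE) (rule that)
    then show ?thesis using rooted_tree_finite[OF V(1)] by (intro exI[of _ V] exI[of _ "(F, r)"]) (simp add: P_def)
  qed
  then have "\<forall>A'. finite A' \<longrightarrow> (\<exists>V c. P V c \<and> finite V \<and> V \<inter> A' = {})" by simp
  from disjoint_family_extend[OF this Suc.prems, of 3] obtain V c
    where V: "\<forall>q<(3::nat). P (V q) (c q) \<and> finite (V q) \<and> V q \<inter> A = {} \<and> (\<forall>p<q. V p \<inter> V q = {})" by (elim exE)
  let ?Q = "{0, 1, 2 :: nat}"
  have Q: "q < (3::nat)" if "q \<in> ?Q" for q using that by auto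
  have disj: "V p \<inter> V q = {}" if "p \<in> ?Q" "q \<in> ?Q" "p \<noteq> q" for p q :: nat
    using V Q[OF that(1)] Q[OF that(2)] that(3) by (cases p q rule: linorder_cases) (auto simp: Int_commute)
  have "finite (A \<union> (\<Union>q\<in>?Q. V q))" using V Suc.prems by simp
  \<comment> \<open>The new root and the three subdividing vertices are numbered from
    \<open>M\<close> on, above all names in use.\<close>
  then obtain M where M: "\<And>x. x \<in> A \<union> (\<Union>q\<in>?Q. V q) \<Longrightarrow> x < M"
    using finite_nat_set_iff_bounded by (metis (no_types, lifting))
  define a where "a q = M + q" for q
  define z where "z = M + 3"
  have tree: "rooted_tree (V q) (fst (c q)) (snd (c q))" if "q \<in> ?Q" for q
    using V Q[OF that] by (simp add: P_def)
  have new1: "a p \<notin> V q" if "p \<in> ?Q" "q \<in> ?Q" for p q using M[of "a p"] that by (auto simp: a_def)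
  have new2: "z \<notin> V q" if "q \<in> ?Q" for q using M[of z] that by (auto simp: z_def)
  have new3: "z \<notin> a ` ?Q" "inj_on a ?Q" by (auto simp: z_def a_def)
  note step = forces_wide_step[where Q = ?Q and V = V and F = "\<lambda>q. fst (c q)" and r = "\<lambda>q. snd (c q)"
      and a = a and c = z, OF HOL.refl tree disj new1 new2 new3]
  let ?V = "{z} \<union> (\<Union>q\<in>?Q. V q \<union> {a q})"
  let ?F = "\<Union>q\<in>?Q. fst (c q) \<union> {} \<union> {(snd (c q), a q), (a q, snd (c q))} \<union> {(a q, z), (z, a q)}"
  have "rooted_tree ?V ?F z" by (rule step(1))
  moreover have "?V \<inter> A = {}"
  proof -
    have "x \<notin> A" if "x \<ge> M" for x using M[of x] that by auto
    then have "z \<notin> A" "\<And>q. a q \<notin> A" by (auto simp: z_def a_def)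
    moreover have "V q \<inter> A = {}" if "q \<in> ?Q" for q using V Q[OF that] by blast
    ultimately show ?thesis by blast
  qed
  moreover have "forces_wide E ?V ?F (Suc (Suc k))" if E: "ugraph E" for E :: "('a \<times> 'a) set"
  proof (rule step(2)[OF _ _ _ _ _ _ _ E zero_less_Suc])
    fix q assume "q \<in> ?Q"
    then show "forces_wide E (V q) (fst (c q)) (Suc k)" using V Q[of q] E unfolding P_def by blast
  qed
  ultimately show ?case by (intro exI[of _ ?V] exI[of _ ?F] exI[of _ z] conjI allI impI)
qed

section \<open>The path independence number\<close>

text \<open>The set of vertices reachable from \<open>u\<close> is left by no edge within
  \<open>S\<close>, so a cut-connected \<open>S\<close> is all reachable; conversely a walk that
  leaves \<open>A\<close> has a crossing edge.\<close>

lemma conn_in_rtrancl_on: "conn_in R S \<longleftrightarrow> S \<noteq> {} \<and> (\<forall>u\<in>S. \<forall>v\<in>S. (u, v) \<in> rtrancl_on S R)"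
proof
  assume c: "conn_in R S"
  have "(u, v) \<in> rtrancl_on S R" if uv: "u \<in> S" "v \<in> S" for u v
  proof (rule ccontr)
    assume "(u, v) \<notin> rtrancl_on S R"
    then obtain x y where "x \<in> S" "(u, x) \<in> rtrancl_on S R" "y \<in> S" "(u, y) \<notin> rtrancl_on S R" "(x, y) \<in> R"
      using conn_in_cut'[OF c uv(1), of "{v. (u, v) \<in> rtrancl_on S R}" v] uv by auto
    then show False using rtrancl_on_into_rtrancl_on by metis
  qed
  then show "S \<noteq> {} \<and> (\<forall>u\<in>S. \<forall>v\<in>S. (u, v) \<in> rtrancl_on S R)" using conn_in_nonempty[OF c] by blast
next
  assume r: "S \<noteq> {} \<and> (\<forall>u\<in>S. \<forall>v\<in>S. (u, v) \<in> rtrancl_on S R)"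
  show "conn_in R S"
  proof (rule conn_inI)
    fix A a b assume ab: "a \<in> S" "a \<in> A" "b \<in> S" "b \<notin> A"
    have "(a, b) \<in> rtrancl_on S R" using r ab by blast
    then have "b \<in> A \<or> (\<exists>x\<in>S. \<exists>y\<in>S. x \<in> A \<and> y \<notin> A \<and> (x, y) \<in> R)"
    proof (induction rule: rtrancl_on_induct)
      case base
      then show ?case using ab by blast
    next
      case (step y z)
      then show ?case by blast
    qed
    then show "\<exists>x\<in>S. \<exists>y\<in>S. x \<in> A \<and> y \<notin> A \<and> (x, y) \<in> R" using ab by blast
  qed (use r in blast)
qed

lemma connected_restrict_iff:
  assumes "sym (parcs T)"
  shows "connected (with_proj T \<restriction> S) \<longleftrightarrow> conn_in (parcs T) S"
proof -
  have "parcs (mk_symmetric (with_proj T \<restriction> S)) = Restr (parcs T) S"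
    using assms by (auto simp: mk_symmetric_def dest: symD)
  then have "connected (with_proj T \<restriction> S) \<longleftrightarrow> conn_in (Restr (parcs T) S) S"
    unfolding connected_def strongly_connected_def conn_in_rtrancl_on reachable_def
    by (simp add: mk_symmetric_def)
  then show ?thesis by (simp add: conn_in_Restr)
qed

lemma connected_iff:
  assumes "pair_graph T"
  shows "connected (with_proj T) \<longleftrightarrow> conn_in (parcs T) (pverts T)"
proof -
  have "with_proj T \<restriction> pverts T = with_proj T"
    using assms unfolding pair_graph_iff by (auto simp: induce_subgraph_def with_proj_def)
  then show ?thesis using connected_restrict_iff[of T "pverts T"] assms by (simp add: pair_graph_iff)
qed

text \<open>For the interval property, the positions before \<open>j\<close> form a cut of the path,
  crossed only by the edge arriving at position \<open>j\<close>. A vertex present on both sides has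
  a connected set of bags and therefore lies in bag \<open>j\<close>.\<close>

lemma path_decomposition_path_dec:
  assumes "path_decomposition G T B"
  shows "\<exists>Bs. path_dec (parcs G) (pverts G) Bs \<and> set Bs = B ` pverts T"
proof -
  have tree: "tree_graph T" and sub: "\<And>x. x \<in> pverts T \<Longrightarrow> B x \<subseteq> pverts G"
    and cover: "\<And>u v. (u, v) \<in> parcs G \<Longrightarrow> \<exists>x\<in>pverts T. u \<in> B x \<and> v \<in> B x"
    and conn: "\<And>v. v \<in> pverts G \<Longrightarrow> connected (with_proj T \<restriction> {x \<in> pverts T. v \<in> B x})"
    using assms by (auto simp: path_decomposition_def tree_decomposition_def)
  have "sym (parcs T)" using tree by (simp add: tree_graph_def forest_graph_def pair_graph_iff)
  then have conn: "conn_in (parcs T) {x \<in> pverts T. v \<in> B x}" if "v \<in> pverts G" for v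
    using conn[OF that] by (simp add: connected_restrict_iff)
  obtain xs where xs: "xs \<noteq> []" "distinct xs" "pverts T = set xs"
    "parcs T = set (zip xs (tl xs)) \<union> (set (zip xs (tl xs)))\<inverse>"
    using assms unfolding path_decomposition_def path_graph_def by blast
  have zip: "\<exists>m. Suc m < length xs \<and> x = xs ! m \<and> y = xs ! Suc m" if e: "(x, y) \<in> set (zip xs (tl xs))" for x y
  proof -
    obtain i where "i < length xs - 1" "x = xs ! i" "y = xs ! Suc i" using e by (auto simp: set_zip nth_tl)
    then show ?thesis by (intro exI[of _ i]) auto
  qed
  have "path_dec (parcs G) (pverts G) (map B xs)"
  proof (rule path_decI)
    show "map B xs \<noteq> []" using xs(1) by simp
    show "\<Union>(set (map B xs)) = pverts G"
    proof
      show "\<Union>(set (map B xs)) \<subseteq> pverts G" using sub xs(3) by auto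
      show "pverts G \<subseteq> \<Union>(set (map B xs))" using conn_in_nonempty[OF conn] xs(3) by fastforce
    qed
    show "\<exists>B\<in>set (map B xs). u \<in> B \<and> v \<in> B" if "(u, v) \<in> parcs G" for u v
      using cover[OF that] xs(3) by auto
    fix i j l assume ij: "i \<le> j" "j \<le> l" "l < length (map B xs)"
    show "map B xs ! i \<inter> map B xs ! l \<subseteq> map B xs ! j"
    proof (rule subsetI, rule ccontr)
      fix v assume v: "v \<in> map B xs ! i \<inter> map B xs ! l" "v \<notin> map B xs ! j"
      then have v': "v \<in> B (xs ! i)" "v \<in> B (xs ! l)" "v \<notin> B (xs ! j)" using ij by auto
      have vG: "v \<in> pverts G" using v'(1) sub[of "xs ! i"] xs(3) ij by auto
      define A where "A = {xs ! m | m. m < j}"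
      have inA: "xs ! m \<in> A \<longleftrightarrow> m < j" if "m < length xs" for m
        using that ij xs(2) by (auto simp: A_def nth_eq_iff_index_eq)
      have "i \<noteq> j" using v' by auto
      then have A: "xs ! i \<in> A" "xs ! l \<notin> A" using inA ij by auto
      have S: "xs ! i \<in> {x \<in> pverts T. v \<in> B x}" "xs ! l \<in> {x \<in> pverts T. v \<in> B x}"
        using v' xs(3) ij by auto
      obtain x y where "x \<in> {x \<in> pverts T. v \<in> B x}" "y \<in> {x \<in> pverts T. v \<in> B x}"
        and xy: "x \<in> A" "y \<notin> A" "(x, y) \<in> parcs T"
        by (rule conn_in_cut'[OF conn[OF vG] S(1) A(1) S(2) A(2)])
      then have vB: "v \<in> B y" by blast
      from xy(3)
      consider "(x, y) \<in> set (zip xs (tl xs))" | "(y, x) \<in> set (zip xs (tl xs))" using xs(4) by blast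
      then show False
      proof cases
        case 1
        then obtain m where m: "Suc m < length xs" "x = xs ! m" "y = xs ! Suc m" using zip by blast
        then have "Suc m = j" using inA[of m] inA[of "Suc m"] xy by auto
        then show False using m vB v' by auto
      next
        case 2
        then obtain m where m: "Suc m < length xs" "y = xs ! m" "x = xs ! Suc m" using zip by blast
        then show False using inA[of m] inA[of "Suc m"] xy by auto
      qed
    qed
  qed
  then show ?thesis using xs(3) by (intro exI[of _ "map B xs"]) simp
qed

section \<open>Bag lists as path-decompositions indexed by an initial segment of the
  naturals\<close>

definition nat_path :: "nat \<Rightarrow> nat pair_pre_digraph" where
  "nat_path n = \<lparr>pverts = {..<n}, parcs = {(i, j). i < n \<and> j < n \<and> (j = Suc i \<or> i = Suc j)}\<rparr>"

text \<open>A discrete intermediate value argument: between an index in \<open>A\<close> and one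
  outside \<open>A\<close>, membership changes at some single step, and convexity keeps this step in
  \<open>S\<close>.\<close>

lemma nat_path_convex_conn:
  assumes "S \<noteq> {}" "S \<subseteq> {..<n}" "\<And>i j l. i \<in> S \<Longrightarrow> l \<in> S \<Longrightarrow> i \<le> j \<Longrightarrow> j \<le> l \<Longrightarrow> j \<in> S"
  shows "conn_in (parcs (nat_path n)) S"
proof (rule conn_inI[OF assms(1)])
  fix A a b assume ab: "a \<in> S" "a \<in> A" "b \<in> S" "b \<notin> A"
  have jump: "\<exists>m. i \<le> m \<and> m < l \<and> (m \<in> A) \<noteq> (Suc m \<in> A)" if "i \<le> l" "(i \<in> A) \<noteq> (l \<in> A)" for i l
    using that
  proof (induction l rule: dec_induct)
    case (step l)
    show ?case
    proof (cases "(i \<in> A) = (l \<in> A)")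
      case True
      then show ?thesis using step.prems step.hyps by (intro exI[of _ l]) auto
    next
      case False
      then show ?thesis using step.IH by (auto intro: less_SucI)
    qed
  qed simp
  obtain i l where il: "i \<le> l" "i \<in> S" "l \<in> S" "(i \<in> A) \<noteq> (l \<in> A)"
    using ab by (metis nat_le_linear)
  then obtain m where m: "i \<le> m" "m < l" "(m \<in> A) \<noteq> (Suc m \<in> A)" using jump[of i l] by blast
  have S: "m \<in> S" "Suc m \<in> S" using assms(3)[OF il(2,3), of m] assms(3)[OF il(2,3), of "Suc m"] m by auto
  then have "(m, Suc m) \<in> parcs (nat_path n)" "(Suc m, m) \<in> parcs (nat_path n)"
    using assms(2) by (auto simp: nat_path_def)
  then show "\<exists>x\<in>S. \<exists>y\<in>S. x \<in> A \<and> y \<notin> A \<and> (x, y) \<in> parcs (nat_path n)" using S m(3) by blast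
qed

lemma nat_path_pair_graph: "pair_graph (nat_path n)"
proof -
  have "finite (pverts (nat_path n))" by (simp add: nat_path_def)
  then show ?thesis unfolding pair_graph_iff by (auto simp: nat_path_def sym_def irrefl_def)
qed

lemma nat_path_tree:
  assumes "0 < n"
  shows "tree_graph (nat_path n)"
proof -
  have "one_degenerate (pverts (nat_path n)) (parcs (nat_path n))" unfolding one_degenerate_def
  proof (intro allI impI)
    fix W assume W: "W \<subseteq> pverts (nat_path n)" "W \<noteq> {}"
    then have "finite W" using finite_subset[of W "{..<n}"] by (simp add: nat_path_def)
    \<comment> \<open>Within \<open>W\<close> the maximum can be adjacent to its predecessor only.
      If the maximum is 0, then \<open>W = {0}\<close> has no edges and the truncated
      \<open>Max W - 1\<close> does no harm.\<close>
    then have "Max W \<in> W" "\<And>v. v \<in> W \<Longrightarrow> v \<le> Max W" using W(2) by auto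
    then show "\<exists>w\<in>W. \<exists>u. \<forall>v\<in>W. (w, v) \<in> parcs (nat_path n) \<longrightarrow> v = u"
      by (intro bexI[of _ "Max W"] exI[of _ "Max W - 1"]) (force simp: nat_path_def)+
  qed
  moreover have "conn_in (parcs (nat_path n)) (pverts (nat_path n))"
    by (rule nat_path_convex_conn) (use assms in \<open>auto simp: nat_path_def\<close>)
  ultimately show ?thesis
    using one_degenerate_forest[OF nat_path_pair_graph] connected_iff[OF nat_path_pair_graph]
    by (simp add: tree_graph_def)
qed

lemma nat_path_path:
  assumes "0 < n"
  shows "path_graph (nat_path n)"
proof -
  have "set (zip [0..<n] (tl [0..<n])) = {(i, Suc i) | i. Suc i < n}"
  proof (intro equalityI subsetI)
    fix e assume "e \<in> {(i, Suc i) | i. Suc i < n}"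
    then obtain i where "e = (i, Suc i)" "Suc i < n" by blast
    then show "e \<in> set (zip [0..<n] (tl [0..<n]))" by (auto simp: set_zip nth_tl intro!: exI[of _ i])
  qed (auto simp: set_zip nth_tl)
  then show ?thesis unfolding path_graph_def using assms
    by (intro exI[of _ "[0..<n]"]) (auto simp: nat_path_def)
qed

lemma path_dec_path_decomposition:
  assumes G: "pair_graph G" and pd: "path_dec (parcs G) (pverts G) Bs"
  shows "path_decomposition G (nat_path (length Bs)) ((!) Bs)"
proof -
  note pd = path_decD[OF pd]
  have n: "0 < length Bs" using pd(1) by simp
  have V: "pverts (nat_path (length Bs)) = {..<length Bs}" by (simp add: nat_path_def)
  have sym: "sym (parcs (nat_path (length Bs)))" using nat_path_pair_graph by (simp add: pair_graph_iff)
  have "tree_decomposition G (nat_path (length Bs)) ((!) Bs)" unfolding tree_decomposition_def V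
  proof (intro conjI ballI nat_path_tree[OF n])
    show "Bs ! x \<subseteq> pverts G" if "x \<in> {..<length Bs}" for x using that pd(2) by auto
    show "case e of (u, v) \<Rightarrow> \<exists>x\<in>{..<length Bs}. u \<in> Bs ! x \<and> v \<in> Bs ! x" if "e \<in> parcs G" for e
    proof (cases e)
      case (Pair u v)
      then have "u \<in> pverts G" "v \<in> pverts G" "(u, v) \<in> parcs G" using that G by (auto simp: pair_graph_iff)
      then obtain B where "B \<in> set Bs" "u \<in> B" "v \<in> B" using pd(3) by blast
      then show ?thesis using Pair by (auto simp: in_set_conv_nth)
    qed
    fix v assume "v \<in> pverts G"
    then obtain B where "B \<in> set Bs" "v \<in> B" using pd(2) by blast
    then have "{x \<in> {..<length Bs}. v \<in> Bs ! x} \<noteq> {}" by (auto simp: in_set_conv_nth)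
    then have "conn_in (parcs (nat_path (length Bs))) {x \<in> {..<length Bs}. v \<in> Bs ! x}"
    proof (rule nat_path_convex_conn)
      fix i j l assume "i \<in> {x \<in> {..<length Bs}. v \<in> Bs ! x}" "l \<in> {x \<in> {..<length Bs}. v \<in> Bs ! x}" "i \<le> j" "j \<le> l"
      then show "j \<in> {x \<in> {..<length Bs}. v \<in> Bs ! x}" using pd(4)[of i j l] by auto
    qed blast
    then show "connected (with_proj (nat_path (length Bs)) \<restriction> {x \<in> {..<length Bs}. v \<in> Bs ! x})"
      by (simp add: connected_restrict_iff[OF sym])
  qed
  then show ?thesis using nat_path_path[OF n] by (simp add: path_decomposition_def)
qed

section \<open>Translation of the invariants and the final equivalence\<close>

lemma independence_number_le_iff:
  assumes "finite X"
  shows "independence_number (with_proj G \<restriction> X) \<le> k \<longleftrightarrow> alpha_le (parcs G) X k"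
proof -
  have "independent_set (with_proj G \<restriction> X) I \<longleftrightarrow> I \<subseteq> X \<and> indep (parcs G) I" for I
    by (auto simp: independent_set_def indep_def arcs_ends_conv subset_iff)
  then have "{I. independent_set (with_proj G \<restriction> X) I} = {I. I \<subseteq> X \<and> indep (parcs G) I}" by simp
  moreover have "finite {I. I \<subseteq> X \<and> indep (parcs G) I}" using assms by simp
  moreover have "{} \<in> {I. I \<subseteq> X \<and> indep (parcs G) I}" by (simp add: indep_def)
  ultimately have "independence_number (with_proj G \<restriction> X) \<le> k \<longleftrightarrow>
      (\<forall>I. I \<subseteq> X \<and> indep (parcs G) I \<longrightarrow> card I \<le> k)"
    unfolding independence_number_def by (subst Max_le_iff) auto
  then show ?thesis using assms finite_subset unfolding alpha_le_def by blast
qed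

text \<open>The decomposition into one bag shows that \<open>LEAST\<close> ranges over a nonempty
  set, so the minimum is attained; monotonicity of \<open>has_pd\<close> in the width gives the
  rest.\<close>

lemma path_independence_number_le_iff:
  assumes G: "pair_graph G"
  shows "path_independence_number G \<le> k \<longleftrightarrow> has_pd (parcs G) (pverts G) k"
proof -
  have finG: "finite (pverts G)" using G by (simp add: pair_graph_iff)
  have "(\<exists>(T :: nat pair_pre_digraph) B. path_decomposition G T B \<and>
      (\<forall>x\<in>pverts T. independence_number (with_proj G \<restriction> B x) \<le> k)) \<longleftrightarrow> has_pd (parcs G) (pverts G) k" (is "?L k \<longleftrightarrow> _") for k
  proof
    assume "?L k"
    then obtain T :: "nat pair_pre_digraph" and B where T: "path_decomposition G T B"
      "\<And>x. x \<in> pverts T \<Longrightarrow> independence_number (with_proj G \<restriction> B x) \<le> k" by blast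
    obtain Bs where Bs: "path_dec (parcs G) (pverts G) Bs" "set Bs = B ` pverts T"
      using path_decomposition_path_dec[OF T(1)] by blast
    have "alpha_le (parcs G) (B x) k" if "x \<in> pverts T" for x
    proof -
      have "B x \<subseteq> pverts G" using T(1) that by (simp add: path_decomposition_def tree_decomposition_def)
      then show ?thesis using T(2)[OF that] independence_number_le_iff finite_subset[OF _ finG] by blast
    qed
    then show "has_pd (parcs G) (pverts G) k" unfolding has_pd_def using Bs by (intro exI[of _ Bs]) simp
  next
    assume "has_pd (parcs G) (pverts G) k"
    then obtain Bs where Bs: "path_dec (parcs G) (pverts G) Bs" "\<forall>B\<in>set Bs. alpha_le (parcs G) B k"
      unfolding has_pd_def by blast
    have "independence_number (with_proj G \<restriction> Bs ! x) \<le> k" if "x \<in> pverts (nat_path (length Bs))" for x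
    proof -
      have B: "Bs ! x \<in> set Bs" using that by (simp add: nat_path_def)
      then have "Bs ! x \<subseteq> pverts G" using path_decD(2)[OF Bs(1)] by blast
      then show ?thesis using independence_number_le_iff[OF finite_subset[OF _ finG]] Bs(2) B by simp
    qed
    then show "?L k"
      using path_dec_path_decomposition[OF G Bs(1)] by (intro exI[of _ "nat_path (length Bs)"] exI[of _ "(!) Bs"]) simp
  qed
  then have pin: "path_independence_number G = (LEAST k. has_pd (parcs G) (pverts G) k)"
    by (simp add: path_independence_number_def)
  have "alpha_le (parcs G) (pverts G) (card (pverts G))" using finG by (simp add: alpha_le_def card_mono)
  then have "has_pd (parcs G) (pverts G) (card (pverts G))"
    unfolding has_pd_def using path_dec_single[of "parcs G" "pverts G"] by (intro exI[of _ "[pverts G]"]) simp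
  then have "has_pd (parcs G) (pverts G) (path_independence_number G)" unfolding pin by (rule LeastI)
  moreover have "path_independence_number G \<le> k" if "has_pd (parcs G) (pverts G) k"
    unfolding pin by (rule Least_le) (rule that)
  ultimately show ?thesis using has_pd_mono by blast
qed

text \<open>A vertex with \<open>t\<close> independent neighbours induces the excluded star. For
  positive \<open>t\<close> the sharp bound is \<open>t - 1\<close>; using \<open>t\<close> avoids
  truncated subtraction.\<close>

lemma star_free_star_bounded:
  assumes G: "pair_graph G" and free: "star_free t G"
  shows "star_bounded (parcs G) t"
proof -
  interpret ugraph "parcs G" by (rule pair_graph_ugraph[OF G])
  have "alpha_le (parcs G) (parcs G `` {x}) t" for x unfolding alpha_le_def
  proof (intro allI impI, rule ccontr)
    fix I assume I: "I \<subseteq> parcs G `` {x}" "finite I" "indep (parcs G) I" "\<not> card I \<le> t"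
    then obtain J where J: "J \<subseteq> I" "card J = t" "finite J" by (meson nat_le_linear obtain_subset_with_card_n)
    define H where "H = \<lparr>pverts = insert x J, parcs = {x} \<times> J \<union> J \<times> {x}\<rparr>"
    have xJ: "x \<notin> J" "\<And>y. y \<in> J \<Longrightarrow> (x, y) \<in> parcs G" "\<And>y. y \<in> J \<Longrightarrow> (y, x) \<in> parcs G"
      using I(1) J(1) E_irrefl E_sym by auto
    have "I \<noteq> {}" using I(4) by auto
    then have xG: "insert x J \<subseteq> pverts G" using I(1) J(1) G by (auto simp: pair_graph_iff)
    have indep: "(y, z) \<notin> parcs G" if "y \<in> J" "z \<in> J" for y z using I(3) J(1) that by (auto simp: indep_def)
    have "Restr (parcs G) (insert x J) = {x} \<times> J \<union> J \<times> {x}"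
      using xJ indep E_irrefl by blast
    then have "induced_subgraph (with_proj H) (with_proj G)"
      using G xG by (subst induced_subgraph_pair_iff) (simp_all add: pair_graph_iff H_def)
    moreover have "complete_bipartite_digraph 1 t (with_proj H)"
      unfolding complete_bipartite_digraph_pair_def
      using xJ(1) J by (intro conjI exI[of _ "{x}"] exI[of _ J]) (auto simp: H_def)
    ultimately show False using free unfolding star_free_def by blast
  qed
  then show ?thesis by unfold_locales
qed

text \<open>\<open>K\<close> belongs to a rooted tree containing the forest as an induced subgraph,
  and a model of the tree restricts to one of the forest. As \<open>forces\<close> speaks about
  connected sets only, it is applied to each component; the decompositions are then lined up with
  empty separator.\<close>

lemma forest_excluded_imp_has_pd:
  fixes F :: "nat pair_pre_digraph"
  assumes F: "forest_graph F"
  shows "\<exists>K. \<forall>G :: 'a pair_pre_digraph. pair_graph G \<longrightarrow> star_free t G \<longrightarrow> \<not> induced_minor F G \<longrightarrow>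
    has_pd (parcs G) (pverts G) K"
proof -
  have pF: "pair_graph F" using F by (simp add: forest_graph_def)
  then have Fp: "finite (pverts F)" "parcs F \<subseteq> pverts F \<times> pverts F" "sym (parcs F)" "irrefl (parcs F)"
    by (auto simp: pair_graph_iff)
  obtain V' F' r where T: "rooted_tree V' F' r" "pverts F \<subseteq> V'" "parcs F = F' \<inter> pverts F \<times> pverts F"
    using forest_in_rooted_tree[OF Fp(1) forest_one_degenerate[OF F] Fp(2-4) finite.emptyI] by auto
  obtain K where K: "\<forall>E :: ('a \<times> 'a) set. star_bounded E t \<longrightarrow> forces E V' F' r K"
    using rooted_tree_forces[OF T(1)] by blast
  have "has_pd (parcs G) (pverts G) K"
    if G: "pair_graph G" and free: "star_free t G" and no: "\<not> induced_minor F G" for G :: "'a pair_pre_digraph"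
  proof -
    interpret ugraph "parcs G" by (rule pair_graph_ugraph[OF G])
    let ?C = "components (parcs G) (pverts G)"
    have finG: "finite (pverts G)" using G by (simp add: pair_graph_iff)
    have forc: "forces (parcs G) V' F' r K" using K star_free_star_bounded[OF G free] by blast
    have "has_pd (parcs G) C K" if C: "C \<in> ?C" for C
    proof (rule ccontr)
      assume "\<not> has_pd (parcs G) C K"
      moreover obtain x where "x \<in> C" using conn_in_nonempty[OF componentsD(2)[OF C]] by blast
      moreover have "finite C" using finite_subset[OF componentsD(1)[OF C] finG] .
      ultimately obtain H where H: "minor_model (parcs G) V' F' H" "\<forall>v\<in>V'. H v \<subseteq> C"
        using forc componentsD(2)[OF C] unfolding forces_def by blast
      have "minor_model (parcs G) (pverts F) (parcs F) H"
        using H(1) T(2) unfolding minor_model_def T(3) by blast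
      moreover have "\<forall>v\<in>pverts F. H v \<subseteq> pverts G" using H(2) T(2) componentsD(1)[OF C] by blast
      ultimately show False using model_induced_minor[OF G pF] no by blast
    qed
    then have "\<exists>Bs. path_dec (parcs G) ({} \<union> \<Union>?C) Bs \<and> (\<forall>B\<in>set Bs. {} \<subseteq> B \<and> alpha_le (parcs G) B (0 + K))"
      using finite_components[OF finG] components_separated by (intro path_dec_components) auto
    then show ?thesis by (auto simp: has_pd_def Union_components)
  qed
  then show ?thesis by blast
qed

theorem theorem4:
  fixes t :: nat and \<G> :: "'a pair_pre_digraph set"
  assumes "t \<ge> 1"
    and "\<forall>G\<in>\<G>. pair_graph G"
    and "\<forall>G\<in>\<G>. star_free t G"
  shows "bounded_path_independence_number \<G> \<longleftrightarrow>
    (\<exists>F :: nat pair_pre_digraph. forest_graph F \<and> (\<forall>G\<in>\<G>. \<not> induced_minor F G))"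
proof
  assume "bounded_path_independence_number \<G>"
  then obtain k where k: "\<And>G. G \<in> \<G> \<Longrightarrow> has_pd (parcs G) (pverts G) k"
    using assms(2) by (auto simp: bounded_path_independence_number_def path_independence_number_le_iff)
  \<comment> \<open>Size \<open>Suc k\<close> is one more than the bags of the given decompositions
    allow.\<close>
  obtain V :: "nat set" and F r where T: "rooted_tree V F r"
    and wide: "\<And>E :: ('a \<times> 'a) set. ugraph E \<Longrightarrow> forces_wide E V F (Suc k)"
    using forces_wide_tree[where 'a = 'a, OF finite.emptyI, of k] by blast
  have "\<not> induced_minor \<lparr>pverts = V, parcs = F\<rparr> G" if G: "G \<in> \<G>" for G
  proof
    assume "induced_minor \<lparr>pverts = V, parcs = F\<rparr> G"
    then obtain H where H: "minor_model (parcs G) V F H" "\<forall>v\<in>V. H v \<subseteq> pverts G"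
      using induced_minor_model[of G "\<lparr>pverts = V, parcs = F\<rparr>"] assms(2) G by auto
    obtain Bs where Bs: "path_dec (parcs G) (pverts G) Bs" "\<forall>B\<in>set Bs. alpha_le (parcs G) B k"
      using k[OF G] unfolding has_pd_def by blast
    have "forces_wide (parcs G) V F (Suc k)" using assms(2) G by (intro wide pair_graph_ugraph) blast
    from forces_wideD[OF this Bs(1) H] obtain j I where I: "j < length Bs" "I \<subseteq> Bs ! j" "finite I"
      "indep (parcs G) I" "card I = Suc k" by metis
    then show False using alpha_leD[of "parcs G" "Bs ! j" k I] Bs(2) by simp
  qed
  then show "\<exists>F :: nat pair_pre_digraph. forest_graph F \<and> (\<forall>G\<in>\<G>. \<not> induced_minor F G)"
    using rooted_tree_forest[OF T] by blast
next
  assume "\<exists>F :: nat pair_pre_digraph. forest_graph F \<and> (\<forall>G\<in>\<G>. \<not> induced_minor F G)"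
  then obtain F :: "nat pair_pre_digraph" where F: "forest_graph F" "\<And>G. G \<in> \<G> \<Longrightarrow> \<not> induced_minor F G" by blast
  obtain K where "\<forall>G :: 'a pair_pre_digraph. pair_graph G \<longrightarrow> star_free t G \<longrightarrow> \<not> induced_minor F G \<longrightarrow>
      has_pd (parcs G) (pverts G) K" using forest_excluded_imp_has_pd[OF F(1), of t] by (elim exE)
  then have "path_independence_number G \<le> K" if "G \<in> \<G>" for G
    using assms(2,3) F(2)[OF that] that path_independence_number_le_iff by blast
  then show "bounded_path_independence_number \<G>" unfolding bounded_path_independence_number_def by blast
qed

end
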